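(* Let $\mathfrak g$ and $V$ be two vector spaces. Then $\big(\bigoplus_{k=0}^{+\infty}C^{k(n-1)|0}(\mathfrak g\oplus V,\mathfrak g\oplus V),[-,-]_{n\text{-Lie}}\big)$ is a graded Lie algebra (with $C^{k(n-1)|0}$ in degree $k$). Its Maurer-Cartan elements are precisely $n$-LieRep pairs: an element $\mu+\rho\in C^{n-1|0}(\mathfrak g\oplus V,\mathfrak g\oplus V)$, with $\mu\in\mathrm{Hom}(\wedge^n\mathfrak g,\mathfrak g)$ and $\rho\in\mathrm{Hom}(\wedge^{n-1}\mathfrak g\otimes V,V)$, is a Maurer-Cartan element if and only if $(\mathfrak g,\mu)$ is an $n$-Lie algebra and $\rho$ is a representation of $(\mathfrak g,\mu)$ on $V$.
   Context: All vector spaces are finite dimensional over an algebraically closed field $\mathbb K$ of characteristic $0$; $n\ge 2$ is an integer; a hat denotes omission. An $n$-Lie algebra is a vector space $\mathfrak g$ with a skew-symmetric linear map $[-,\cdots,-]_{\mathfrak g}:\wedge^n\mathfrak g\to\mathfrak g$ such that $[x_1,\cdots,x_{n-1},[y_1,\cdots,y_n]]=\sum_{i=1}^n[y_1,\cdots,y_{i-1},[x_1,\cdots,x_{n-1},y_i],y_{i+1},\cdots,y_n]$. A representation of it on $V$ is a linear map $\rho:\wedge^{n-1}\mathfrak g\to\mathfrak{gl}(V)$ with (1) $[\rho(\mathfrak X),\rho(\mathfrak Y)]=\rho(\mathfrak X\circ\mathfrak Y)$ (commutator on the left), where for $\mathfrak X=x_1\wedge\cdots\wedge x_{n-1}$,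 $\mathfrak Y=y_1\wedge\cdots\wedge y_{n-1}$, $\mathfrak X\circ\mathfrak Y=\sum_{i=1}^{n-1}y_1\wedge\cdots\wedge[x_1,\cdots,x_{n-1},y_i]_{\mathfrak g}\wedge\cdots\wedge y_{n-1}$; and (2) $\rho(x_1,\cdots,x_{n-2},[y_1,\cdots,y_n]_{\mathfrak g})=\sum_{i=1}^n(-1)^{n-i}\rho(y_1,\cdots,\widehat{y_i},\cdots,y_n)\rho(x_1,\cdots,x_{n-2},y_i)$. An $n$-LieRep pair is an $n$-Lie algebra together with a representation. For a vector space $W$, $\otimes^p(\wedge^{n-1}W)\wedge W$ means $W$ if $p=0$ and $\otimes^{p-1}(\wedge^{n-1}W)\otimes\wedge^nW$ if $p\ge1$; a map on it is written $P(\mathfrak X_1,\cdots,\mathfrak X_p,x)$ with $\mathfrak X_i\in\wedge^{n-1}W$, $x\in W$. Put $C^p(W,W)=\mathrm{Hom}(\otimes^p(\wedge^{n-1}W)\wedge W,W)$ (degree $p$). It is known that $\bigoplus_{p\ge0}C^p(W,W)$ is a graded Lie algebra under $[P,Q]_{n\text{-Lie}}=P\circ Q-(-1)^{pq}Q\circ P$ for $P\in C^p$, $Q\in C^q$, where, with $\mathfrak X_i=x_i^1\wedge\cdots\wedge x_i^{n-1}$, $$(P\circ Q)(\mathfrak X_1,\cdots,\mathfrak X_{p+q},x)=\sum_{k=1}^p(-1)^{(k-1)q}\sum_{\sigma\in S(k-1,q)}(-1)^\sigma\sum_{i=1}^{n-1}P(\mathfrak X_{\sigma(1)},\cdots,\mathfrak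 X_{\sigma(k-1)},x_{k+q}^1\wedge\cdots\wedge x_{k+q}^{i-1}\wedge Q(\mathfrak X_{\sigma(k)},\cdots,\mathfrak X_{\sigma(k+q-1)},x_{k+q}^i)\wedge x_{k+q}^{i+1}\wedge\cdots\wedge x_{k+q}^{n-1},\mathfrak X_{k+q+1},\cdots,\mathfrak X_{p+q},x)$$ $$+\sum_{\sigma\in S(p,q)}(-1)^{pq}(-1)^\sigma P(\mathfrak X_{\sigma(1)},\cdots,\mathfrak X_{\sigma(p)},Q(\mathfrak X_{\sigma(p+1)},\cdots,\mathfrak X_{\sigma(p+q)},x)),$$ and $S(i,j)$ is the set of $(i,j)$-shuffles. Bidegree: for $W=\mathfrak g_1\oplus\mathfrak g_2$ let $\mathfrak g^{l,k}\subset\otimes^m(\wedge^{n-1}W)\wedge W$ be the subspace spanned by elements containing exactly $l$ entries from $\mathfrak g_1$ and $k$ entries from $\mathfrak g_2$ ($l+k=m(n-1)+1$). A map $f\in C^m(W,W)$ has bidegree $k|l$ if $k+l=m(n-1)$, $f(\mathfrak g^{k+1,l})\subset\mathfrak g_1$, $f(\mathfrak g^{k,l+1})\subset\mathfrak g_2$, and $f$ vanishes on all other $\mathfrak g^{i,j}$. $C^{k|l}(W,W)$ denotes the space of maps of bidegree $k|l$. Here $\mathfrak g_1=\mathfrak g$, $\mathfrak g_2=V$. The elements of $C^{n-1|0}(\mathfrak g\oplus V,\mathfrak g\oplus V)$ are exactly the $\mu+\rho$ with $\mu\in\mathrm{Hom}(\wedge^n\mathfrak g,\mathfrak g)$, $\rho\in\mathrm{Hom}(\wedge^{n-1}\mathfrak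 g\otimes V,V)$, meaning the map $(x_1+u_1,\cdots,x_n+u_n)\mapsto\mu(x_1,\cdots,x_n)+\sum_{i=1}^n(-1)^{n-i}\rho(x_1,\cdots,\widehat{x_i},\cdots,x_n)(u_i)$. A Maurer-Cartan element of a graded Lie algebra is a degree $1$ element $\pi$ with $[\pi,\pi]=0$. *)

theory Defs
  imports
    "HOL-Analysis.Product_Vector"
    "HOL-Combinatorics.Permutations"
    "HOL-Computational_Algebra.Polynomial"
    "HOL-Library.Function_Algebras"
begin

section \<open>Alternating maps\<close>

text \<open>
  Linear maps out of an exterior power \<open>\<wedge>\<^sup>m W\<close> are represented by alternating \<open>m\<close>-linear maps, which
  in turn are functions on lists that vanish on lists of length other than \<open>m\<close>.  The latter
  normalisation makes equality of maps the equality of functions.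
\<close>

definition alternating ::
  "('k::field \<Rightarrow> 'a::ab_group_add \<Rightarrow> 'a) \<Rightarrow> ('k \<Rightarrow> 'b::ab_group_add \<Rightarrow> 'b) \<Rightarrow> nat \<Rightarrow> ('a list \<Rightarrow> 'b) \<Rightarrow> bool"
  where "alternating s1 s2 m f \<longleftrightarrow>
    (\<forall>xs. length xs \<noteq> m \<longrightarrow> f xs = 0) \<and>
    (\<forall>xs i. length xs = m \<longrightarrow> i < m \<longrightarrow> Vector_Spaces.linear s1 s2 (\<lambda>y. f (xs[i := y]))) \<and>
    (\<forall>xs i j. length xs = m \<longrightarrow> i < j \<longrightarrow> j < m \<longrightarrow> xs ! i = xs ! j \<longrightarrow> f xs = 0)"

definition delete_nth :: "nat \<Rightarrow> 'a list \<Rightarrow> 'a list"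
  where "delete_nth i xs = take i xs @ drop (Suc i) xs"


section \<open>\<open>n\<close>-Lie algebras and their representations\<close>

definition n_Lie_algebra ::
  "nat \<Rightarrow> ('k::field \<Rightarrow> 'g::ab_group_add \<Rightarrow> 'g) \<Rightarrow> ('g list \<Rightarrow> 'g) \<Rightarrow> bool"
  where "n_Lie_algebra n sg \<mu> \<longleftrightarrow>
    vector_space sg \<and> alternating sg sg n \<mu> \<and>
    (\<forall>xs ys. length xs = n - 1 \<longrightarrow> length ys = n \<longrightarrow>
      \<mu> (xs @ [\<mu> ys]) = (\<Sum>i<n. \<mu> (ys[i := \<mu> (xs @ [ys ! i])])))"

text \<open>\<open>Hom(\<wedge>\<^sup>n\<^sup>-\<^sup>1 g \<otimes> V, V)\<close>, equivalently \<open>Hom(\<wedge>\<^sup>n\<^sup>-\<^sup>1 g, gl(V))\<close>.\<close>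

definition action_map ::
  "nat \<Rightarrow> ('k::field \<Rightarrow> 'g::ab_group_add \<Rightarrow> 'g) \<Rightarrow> ('k \<Rightarrow> 'v::ab_group_add \<Rightarrow> 'v) \<Rightarrow> ('g list \<Rightarrow> 'v \<Rightarrow> 'v) \<Rightarrow> bool"
  where "action_map n sg sv \<rho> \<longleftrightarrow>
    (\<forall>xs. Vector_Spaces.linear sv sv (\<rho> xs)) \<and> (\<forall>u. alternating sg sv (n - 1) (\<lambda>xs. \<rho> xs u))"

text \<open>Indices are shifted to start at \<open>0\<close>, which turns the sign \<open>(-1)\<^sup>n\<^sup>-\<^sup>i\<close> into \<open>(-1)\<^sup>n\<^sup>-\<^sup>1\<^sup>-\<^sup>i\<close>.\<close>

definition n_Lie_representation ::
  "nat \<Rightarrow> ('k::field \<Rightarrow> 'g::ab_group_add \<Rightarrow> 'g) \<Rightarrow> ('k \<Rightarrow> 'v::ab_group_add \<Rightarrow> 'v) \<Rightarrow>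
    ('g list \<Rightarrow> 'g) \<Rightarrow> ('g list \<Rightarrow> 'v \<Rightarrow> 'v) \<Rightarrow> bool"
  where "n_Lie_representation n sg sv \<mu> \<rho> \<longleftrightarrow>
    action_map n sg sv \<rho> \<and>
    (\<forall>xs ys u. length xs = n - 1 \<longrightarrow> length ys = n - 1 \<longrightarrow>
      \<rho> xs (\<rho> ys u) - \<rho> ys (\<rho> xs u) = (\<Sum>i<n - 1. \<rho> (ys[i := \<mu> (xs @ [ys ! i])]) u)) \<and>
    (\<forall>xs ys u. length xs = n - 2 \<longrightarrow> length ys = n \<longrightarrow>
      \<rho> (xs @ [\<mu> ys]) u =
        (\<Sum>i<n. sv ((- 1) ^ (n - 1 - i)) (\<rho> (delete_nth i ys) (\<rho> (xs @ [ys ! i]) u))))"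

definition n_LieRep_pair ::
  "nat \<Rightarrow> ('k::field \<Rightarrow> 'g::ab_group_add \<Rightarrow> 'g) \<Rightarrow> ('k \<Rightarrow> 'v::ab_group_add \<Rightarrow> 'v) \<Rightarrow>
    ('g list \<Rightarrow> 'g) \<Rightarrow> ('g list \<Rightarrow> 'v \<Rightarrow> 'v) \<Rightarrow> bool"
  where "n_LieRep_pair n sg sv \<mu> \<rho> \<longleftrightarrow> n_Lie_algebra n sg \<mu> \<and> n_Lie_representation n sg sv \<mu> \<rho>"


section \<open>Graded Lie algebras\<close>

text \<open>
  The underlying vector space is the internal direct sum \<open>span (\<Union>p. L p)\<close> of the
  homogeneous components \<open>L p\<close>.
\<close>

locale graded_lie_algebra = vector_space scale
  for scale :: "'k::field \<Rightarrow> 'a::ab_group_add \<Rightarrow> 'a" +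
  fixes L :: "nat \<Rightarrow> 'a set" and br :: "'a \<Rightarrow> 'a \<Rightarrow> 'a"
  assumes component_subspace: "subspace (L p)"
    and components_independent:
      "finite I \<Longrightarrow> (\<And>p. p \<in> I \<Longrightarrow> f p \<in> L p) \<Longrightarrow> (\<Sum>p\<in>I. f p) = 0 \<Longrightarrow> p \<in> I \<Longrightarrow> f p = 0"
    and br_add_left: "\<lbrakk>x \<in> span (\<Union>p. L p); y \<in> span (\<Union>p. L p); z \<in> span (\<Union>p. L p)\<rbrakk>
      \<Longrightarrow> br (x + y) z = br x z + br y z"
    and br_add_right: "\<lbrakk>x \<in> span (\<Union>p. L p); y \<in> span (\<Union>p. L p); z \<in> span (\<Union>p. L p)\<rbrakk>
      \<Longrightarrow> br x (y + z) = br x y + br x z"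
    and br_scale_left: "\<lbrakk>x \<in> span (\<Union>p. L p); y \<in> span (\<Union>p. L p)\<rbrakk>
      \<Longrightarrow> br (scale c x) y = scale c (br x y)"
    and br_scale_right: "\<lbrakk>x \<in> span (\<Union>p. L p); y \<in> span (\<Union>p. L p)\<rbrakk>
      \<Longrightarrow> br x (scale c y) = scale c (br x y)"
    and br_degree: "\<lbrakk>x \<in> L p; y \<in> L q\<rbrakk> \<Longrightarrow> br x y \<in> L (p + q)"
    and br_skew: "\<lbrakk>x \<in> L p; y \<in> L q\<rbrakk> \<Longrightarrow> br x y = - scale ((- 1) ^ (p * q)) (br y x)"
    and br_jacobi: "\<lbrakk>x \<in> L p; y \<in> L q; z \<in> L r\<rbrakk>
      \<Longrightarrow> br x (br y z) = br (br x y) z + scale ((- 1) ^ (p * q)) (br y (br x z))"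

definition maurer_cartan :: "(nat \<Rightarrow> 'a::ab_group_add set) \<Rightarrow> ('a \<Rightarrow> 'a \<Rightarrow> 'a) \<Rightarrow> 'a set"
  where "maurer_cartan L br = {\<pi> \<in> L 1. br \<pi> \<pi> = 0}"


section \<open>The cochains \<open>C\<^sup>p(W, W)\<close> and the bracket\<close>

text \<open>
  A cochain takes the list of the blocks \<open>X\<^sub>1, \<dots>, X\<^sub>p\<close>, each a list of \<open>n - 1\<close> vectors standing for
  their wedge product, and the final vector \<open>x\<close>.
\<close>

type_synonym 'w cochain = "'w list list \<Rightarrow> 'w \<Rightarrow> 'w"

definition blocks :: "nat \<Rightarrow> nat \<Rightarrow> 'w list list \<Rightarrow> bool"
  where "blocks n p Xs \<longleftrightarrow> length Xs = p \<and> (\<forall>X \<in> set Xs. length X = n - 1)"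

text \<open>
  For \<open>p \<ge> 1\<close> a cochain is alternating in each of the first \<open>p - 1\<close> blocks and in the \<open>n\<close> vectors
  consisting of the last block and \<open>x\<close>; for \<open>p = 0\<close> it is a linear map.
\<close>

definition cochains ::
  "nat \<Rightarrow> ('k::field \<Rightarrow> 'w::ab_group_add \<Rightarrow> 'w) \<Rightarrow> nat \<Rightarrow> 'w cochain set"
  where "cochains n s p = {P.
    (\<forall>Xs x. \<not> blocks n p Xs \<longrightarrow> P Xs x = 0) \<and>
    (p = 0 \<longrightarrow> Vector_Spaces.linear s s (P [])) \<and>
    (p > 0 \<longrightarrow> (\<forall>Xs. blocks n p Xs \<longrightarrow>
      (\<forall>x. \<forall>j<p - 1. alternating s s (n - 1) (\<lambda>Y. P (Xs[j := Y]) x)) \<and>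
      alternating s s n (\<lambda>zs. P (Xs[p - 1 := butlast zs]) (last zs))))}"

definition cochain_scale :: "('k \<Rightarrow> 'w \<Rightarrow> 'w) \<Rightarrow> 'k \<Rightarrow> 'w cochain \<Rightarrow> 'w cochain"
  where "cochain_scale s c P = (\<lambda>Xs x. s c (P Xs x))"

definition shuffle_perms :: "nat \<Rightarrow> nat \<Rightarrow> (nat \<Rightarrow> nat) set"
  where "shuffle_perms i j =
    {\<sigma>. \<sigma> permutes {..<i + j} \<and> strict_mono_on {..<i} \<sigma> \<and> strict_mono_on {i..<i + j} \<sigma>}"

text \<open>
  The product \<open>P \<circ> Q\<close> of \<open>P\<close> of degree \<open>p\<close> and \<open>Q\<close> of degree \<open>q\<close>.  All indices are shifted to start
  at \<open>0\<close>; in particular the \<open>k\<close> below is \<open>k - 1\<close> in the usual formula.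
\<close>

definition circ ::
  "nat \<Rightarrow> ('k::field \<Rightarrow> 'w::ab_group_add \<Rightarrow> 'w) \<Rightarrow> nat \<Rightarrow> nat \<Rightarrow> 'w cochain \<Rightarrow> 'w cochain \<Rightarrow> 'w cochain"
  where "circ n s p q P Q = (\<lambda>Xs x.
    (\<Sum>k<p. s ((- 1) ^ (k * q))
      (\<Sum>\<sigma>\<in>shuffle_perms k q. s (of_int (sign \<sigma>))
        (\<Sum>i<n - 1.
          P (map (\<lambda>j. Xs ! \<sigma> j) [0..<k] @
             [(Xs ! (k + q))[i := Q (map (\<lambda>j. Xs ! \<sigma> j) [k..<k + q]) (Xs ! (k + q) ! i)]] @
             drop (k + q + 1) Xs) x))) +
    (\<Sum>\<sigma>\<in>shuffle_perms p q. s ((- 1) ^ (p * q) * of_int (sign \<sigma>))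
      (P (map (\<lambda>j. Xs ! \<sigma> j) [0..<p]) (Q (map (\<lambda>j. Xs ! \<sigma> j) [p..<p + q]) x))))"

definition homogeneous_bracket ::
  "nat \<Rightarrow> ('k::field \<Rightarrow> 'w::ab_group_add \<Rightarrow> 'w) \<Rightarrow> nat \<Rightarrow> nat \<Rightarrow> 'w cochain \<Rightarrow> 'w cochain \<Rightarrow> 'w cochain"
  where "homogeneous_bracket n s p q P Q = (\<lambda>Xs x.
    circ n s p q P Q Xs x - s ((- 1) ^ (p * q)) (circ n s q p Q P Xs x))"

text \<open>
  The bilinear extension to the direct sum of all \<open>C\<^sup>p(W, W)\<close>.  An element \<open>P\<close> of this sum has as
  degree \<open>p\<close> component its restriction to arguments with \<open>p\<close> blocks, and \<open>circ n s p q P Q\<close> evaluates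
  \<open>P\<close> and \<open>Q\<close> on \<open>p\<close> and \<open>q\<close> blocks only.  Hence the value on \<open>m\<close> blocks is the sum over \<open>p + q = m\<close>
  of the brackets of the degree \<open>p\<close> component of \<open>P\<close> with the degree \<open>q\<close> component of \<open>Q\<close>.
\<close>

definition n_Lie_bracket ::
  "nat \<Rightarrow> ('k::field \<Rightarrow> 'w::ab_group_add \<Rightarrow> 'w) \<Rightarrow> 'w cochain \<Rightarrow> 'w cochain \<Rightarrow> 'w cochain"
  where "n_Lie_bracket n s P Q = (\<lambda>Xs x.
    \<Sum>p\<le>length Xs. homogeneous_bracket n s p (length Xs - p) P Q Xs x)"


section \<open>Bidegree\<close>

text \<open>
  The decomposable elements with \<open>i\<close> entries from \<open>g\<close> and \<open>j\<close> entries from \<open>V\<close>, which span the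
  subspace \<open>g\<^sup>i\<^sup>,\<^sup>j\<close>; \<open>I\<close> is the set of positions of the entries from \<open>g\<close>.
\<close>

definition bihomogeneous_args ::
  "nat \<Rightarrow> nat \<Rightarrow> nat \<Rightarrow> nat \<Rightarrow> (('g::zero \<times> 'v::zero) list list \<times> ('g \<times> 'v)) set"
  where "bihomogeneous_args n m i j = {(Xs, x). blocks n m Xs \<and>
    (let zs = concat Xs @ [x] in length zs = i + j \<and>
      (\<exists>I \<subseteq> {..<length zs}. card I = i \<and>
        (\<forall>a<length zs. if a \<in> I then snd (zs ! a) = 0 else fst (zs ! a) = 0)))}"

text \<open>
  The space \<open>C\<^bsup>k|l\<^esup>(g \<oplus> V, g \<oplus> V)\<close>.  By linearity, the conditions on the subspaces \<open>g\<^sup>i\<^sup>,\<^sup>j\<close> are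
  imposed on decomposable elements.  For \<open>n \<ge> 2\<close> the degree \<open>m\<close> is determined by \<open>k\<close> and \<open>l\<close>.
\<close>

definition bidegree_cochains ::
  "nat \<Rightarrow> ('k::field \<Rightarrow> 'g::ab_group_add \<Rightarrow> 'g) \<Rightarrow> ('k \<Rightarrow> 'v::ab_group_add \<Rightarrow> 'v) \<Rightarrow> nat \<Rightarrow> nat \<Rightarrow>
    ('g \<times> 'v) cochain set"
  where "bidegree_cochains n sg sv k l = {f. \<exists>m.
    k + l = m * (n - 1) \<and> f \<in> cochains n (module_prod.scale sg sv) m \<and>
    (\<forall>(Xs, x) \<in> bihomogeneous_args n m (k + 1) l. f Xs x \<in> UNIV \<times> {0}) \<and>
    (\<forall>(Xs, x) \<in> bihomogeneous_args n m k (l + 1). f Xs x \<in> {0} \<times> UNIV) \<and>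
    (\<forall>i j. i + j = m * (n - 1) + 1 \<longrightarrow> (i, j) \<noteq> (k + 1, l) \<longrightarrow> (i, j) \<noteq> (k, l + 1) \<longrightarrow>
      (\<forall>(Xs, x) \<in> bihomogeneous_args n m i j. f Xs x = 0))}"

text \<open>The element \<open>\<mu> + \<rho>\<close> of \<open>C\<^bsup>n-1|0\<^esup>\<close>.\<close>

definition pair_cochain ::
  "nat \<Rightarrow> ('k::field \<Rightarrow> 'v::ab_group_add \<Rightarrow> 'v) \<Rightarrow> ('g::ab_group_add list \<Rightarrow> 'g) \<Rightarrow>
    ('g list \<Rightarrow> 'v \<Rightarrow> 'v) \<Rightarrow> ('g \<times> 'v) cochain"
  where "pair_cochain n sv \<mu> \<rho> = (\<lambda>Xs x.
    if blocks n 1 Xs then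
      (let zs = hd Xs @ [x] in
        (\<mu> (map fst zs),
         \<Sum>i<n. sv ((- 1) ^ (n - 1 - i)) (\<rho> (delete_nth i (map fst zs)) (snd (zs ! i)))))
    else 0)"

end

theory Submission
  imports Defs
begin

text \<open>
  Contracting the first block \<open>X\<close> is a graded derivation of the product \<open>P \<circ> Q\<close>, up to the term
  \<open>\<Sum>\<^sub>i P(X[i := Q x\<^sub>i], \<dots>)\<close> if \<open>Q\<close> has degree \<open>0\<close>.  This turns the sum over shuffles into a recursion on the
  number of blocks, by which the associator of \<open>\<circ>\<close> is graded symmetric in its last two arguments;
  the graded Jacobi identity of the commutator follows.  With weight \<open>0\<close> on \<open>g\<close> and weight \<open>1\<close> on \<open>V\<close>,
  bidegree \<open>k(n-1)|0\<close> means that a cochain preserves the total weight, and weight-preserving cochains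
  are closed under \<open>\<circ>\<close>.  Finally \<open>\<pi> \<circ> \<pi>\<close> measures the failure of the fundamental identity for the
  \<open>n\<close>-ary bracket \<open>\<pi>\<close> on \<open>g \<oplus> V\<close>.  As \<open>\<pi> \<circ> \<pi>\<close> is alternating and preserves weights, it suffices to
  test it on arguments with at most one entry from \<open>V\<close>, placed last in one of the two alternating
  groups of arguments; this gives the identity of \<open>\<mu>\<close> and the two axioms of a representation.
\<close>


section \<open>Shuffles\<close>

text \<open>A direct proof of the Jacobi identity would have to match shuffles of shuffles. The
  recursion avoids this: each contraction produces a handful of terms, and the degree of the outer
  factor never enters. The induction for the pre-Lie identity runs over maps that are multilinear in
  any number of blocks, a class closed under contraction. Alternation comes back in the closure
  under the product and in the choice of test arguments. In a shuffle the value \<open>0\<close> is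
  singled out because it is the index of the first block: it can stand only at the head of one of
  the two increasing runs, with sign \<open>1\<close> or \<open>(- 1) ^ k\<close>. The passage from
  the bracket to \<pi> \<circ> \<pi> is a division by \<open>2\<close>, because in degree
  \<open>1\<close> the two composites in the bracket of \<pi> with itself add up.\<close>

text \<open>
  Shuffles are classified by the position \<open>c\<close> of the value \<open>0\<close>; \<open>insert_zero c\<close> reinserts it into
  a shuffle of one element fewer.
\<close>

definition insert_zero :: "nat \<Rightarrow> (nat \<Rightarrow> nat) \<Rightarrow> nat \<Rightarrow> nat"
  where "insert_zero c \<sigma> j = (if j < c then Suc (\<sigma> j) else if j = c then 0 else Suc (\<sigma> (j - 1)))"

text \<open>\<open>insert_zero c id\<close> is the cycle that sends \<open>c\<close> to
  \<open>0\<close> and each smaller \<open>j\<close> to \<open>Suc j\<close>. Splitting off one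
  adjacent transposition per step gives its range and its sign by induction on
  \<open>c\<close>.\<close>

lemma insert_zero_id_Suc: "insert_zero (Suc c) id = insert_zero c id \<circ> transpose c (Suc c)"
  by (auto simp: fun_eq_iff insert_zero_def transpose_def)

text \<open>\<open>insert_zero 0 \<sigma>\<close> fixes \<open>0\<close> and is \<sigma> transported
  along \<open>Suc\<close>. In the form \<open>map_permutation\<close> the library results on range
  and sign apply to it.\<close>

lemma insert_zero_0_eq_map_permutation:
  assumes "\<sigma> permutes {..<m}"
  shows "insert_zero 0 \<sigma> = map_permutation {..<m} Suc \<sigma>"
proof
  fix j
  show "insert_zero 0 \<sigma> j = map_permutation {..<m} Suc \<sigma> j"
  proof (cases "j \<in> Suc ` {..<m}")
    case True
    then obtain i where "j = Suc i" "i \<in> {..<m}" by blast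
    then show ?thesis using map_permutation_apply[of Suc "{..<m}" i \<sigma>] by (simp add: insert_zero_def)
  next
    case False
    moreover from this have "j \<noteq> 0 \<Longrightarrow> j - 1 \<notin> {..<m}"
      by (cases j) auto
    ultimately have "j \<noteq> 0 \<Longrightarrow> \<sigma> (j - 1) = j - 1"
      by (intro permutes_not_in[OF assms])
    then show ?thesis
      using False by (auto simp: insert_zero_def map_permutation_def restrict_id_def)
  qed
qed

lemma insert_zero_eq_comp: "insert_zero c \<sigma> = insert_zero 0 \<sigma> \<circ> insert_zero c id"
  by (auto simp: fun_eq_iff insert_zero_def)

lemma insert_zero_id_permutes: "insert_zero c id permutes {..<Suc c}"
  and sign_insert_zero_id: "sign (insert_zero c id) = (- 1) ^ c"
proof (induction c)
  case 0
  have "insert_zero 0 id = id" by (auto simp: fun_eq_iff insert_zero_def)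
  then show "insert_zero 0 id permutes {..<Suc 0}" "sign (insert_zero 0 id) = (- 1) ^ 0"
    by (auto simp: permutes_id simp flip: id_def)
next
  case (Suc c)
  have t: "transpose c (Suc c) permutes {..<Suc (Suc c)}"
    by (rule permutes_swap_id) auto
  have c: "insert_zero c id permutes {..<Suc (Suc c)}"
    using Suc.IH(1) by (rule permutes_subset) auto
  show "insert_zero (Suc c) id permutes {..<Suc (Suc c)}"
    unfolding insert_zero_id_Suc using t c by (rule permutes_compose)
  show "sign (insert_zero (Suc c) id) = (- 1) ^ Suc c"
    unfolding insert_zero_id_Suc using t c Suc.IH(2)
    by (subst sign_compose) (auto intro: permutes_imp_permutation simp: sign_swap_id id_def)
qed

text \<open>Factoring through the cycle \<open>insert_zero c id\<close> separates the sign: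
  transport along \<open>Suc\<close> keeps \<open>sign \<sigma>\<close>, and the cycle contributes
  \<open>(- 1) ^ c\<close>.\<close>

lemma insert_zero_permutes:
  assumes "\<sigma> permutes {..<m}" "c \<le> m"
  shows "insert_zero c \<sigma> permutes {..<Suc m}"
    and "sign (insert_zero c \<sigma>) = (- 1) ^ c * sign \<sigma>"
proof -
  have 1: "insert_zero 0 \<sigma> permutes Suc ` {..<m}"
    unfolding insert_zero_0_eq_map_permutation[OF assms(1)]
    by (rule map_permutation_permutes[OF _ assms(1)]) (simp add: bij_betw_def)
  then have 2: "insert_zero 0 \<sigma> permutes {..<Suc m}"
    by (rule permutes_subset) auto
  have 3: "insert_zero c id permutes {..<Suc m}"
    using insert_zero_id_permutes by (rule permutes_subset) (use assms in auto)
  show "insert_zero c \<sigma> permutes {..<Suc m}"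
    by (subst insert_zero_eq_comp) (rule permutes_compose[OF 3 2])
  have "sign (insert_zero 0 \<sigma>) = sign \<sigma>"
    unfolding insert_zero_0_eq_map_permutation[OF assms(1)]
    by (rule sign_map_permutation) (use assms in auto)
  then show "sign (insert_zero c \<sigma>) = (- 1) ^ c * sign \<sigma>"
    by (subst insert_zero_eq_comp, subst sign_compose)
      (use 2 3 in \<open>auto intro: permutes_imp_permutation simp: sign_insert_zero_id\<close>)
qed

text \<open>Each of the two runs is increasing, so the smallest value can stand only at the head of
  a nonempty run.\<close>

lemma shuffle_zero:
  assumes "\<sigma> \<in> shuffle_perms k q" "k + q > 0"
  shows "k > 0 \<and> \<sigma> 0 = 0 \<or> q > 0 \<and> \<sigma> k = 0"
proof -
  from assms have p: "\<sigma> permutes {..<k + q}"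
    and m1: "\<And>i j. i < j \<Longrightarrow> j < k \<Longrightarrow> \<sigma> i < \<sigma> j"
    and m2: "\<And>i j. k \<le> i \<Longrightarrow> i < j \<Longrightarrow> j < k + q \<Longrightarrow> \<sigma> i < \<sigma> j"
    by (auto simp: shuffle_perms_def strict_mono_on_def)
  have "0 \<in> \<sigma> ` {..<k + q}" using permutes_image[OF p] assms by simp
  then obtain j where j: "j < k + q" "\<sigma> j = 0" by auto
  show ?thesis
  proof (cases "j < k")
    case True
    then show ?thesis using m1[of 0 j] j by (cases "j = 0") auto
  next
    case False
    then show ?thesis using m2[of k j] j by (cases "j = k") auto
  qed
qed

text \<open>The hypothesis covers both places of \<open>0\<close> at once: the head of the first
  run, which then has one element more, or the head of the second.\<close>

lemma bij_betw_insert_zero: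
  assumes "k = Suc k' \<and> q = q' \<and> c = 0 \<or> k = k' \<and> q = Suc q' \<and> c = k"
  shows "bij_betw (insert_zero c) (shuffle_perms k' q') {\<sigma> \<in> shuffle_perms k q. \<sigma> c = 0}"
proof -
  have m: "k + q = Suc (k' + q')" and c: "c \<le> k' + q'" using assms by auto
  \<comment> \<open>The inverse: delete position \<open>c\<close> and lower the other values by one.
    Outside the range it is the identity, as \<open>permutes\<close> requires.\<close>
  define un where "un = (\<lambda>\<tau> j. if j \<in> {..<k' + q'} then (if j < c then \<tau> j else \<tau> (Suc j)) - 1 else (j :: nat))"
  show ?thesis
  proof (rule bij_betw_byWitness[where f' = un])
    show "\<forall>\<sigma>\<in>shuffle_perms k' q'. un (insert_zero c \<sigma>) = \<sigma>"
      by (auto simp: shuffle_perms_def un_def insert_zero_def fun_eq_iff dest: permutes_not_in)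
    show "insert_zero c ` shuffle_perms k' q' \<subseteq> {\<sigma> \<in> shuffle_perms k q. \<sigma> c = 0}"
    proof safe
      fix \<sigma> assume "\<sigma> \<in> shuffle_perms k' q'"
      then have p: "\<sigma> permutes {..<k' + q'}"
        and m1: "\<And>i j. i < j \<Longrightarrow> j < k' \<Longrightarrow> \<sigma> i < \<sigma> j"
        and m2: "\<And>i j. k' \<le> i \<Longrightarrow> i < j \<Longrightarrow> j < k' + q' \<Longrightarrow> \<sigma> i < \<sigma> j"
        by (auto simp: shuffle_perms_def strict_mono_on_def)
      show "insert_zero c \<sigma> c = 0" by (simp add: insert_zero_def)
      show "insert_zero c \<sigma> \<in> shuffle_perms k q"
        using insert_zero_permutes(1)[OF p c] assms
        by (auto simp: shuffle_perms_def strict_mono_on_def) (auto simp: insert_zero_def m1 m2)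
    qed
    have tau: "insert_zero c (un \<tau>) = \<tau>" "un \<tau> \<in> shuffle_perms k' q'"
      if t: "\<tau> \<in> shuffle_perms k q" "\<tau> c = 0" for \<tau>
    proof -
      from t have p: "\<tau> permutes {..<Suc (k' + q')}"
        and m1: "\<And>i j. i < j \<Longrightarrow> j < k \<Longrightarrow> \<tau> i < \<tau> j"
        and m2: "\<And>i j. k \<le> i \<Longrightarrow> i < j \<Longrightarrow> j < k + q \<Longrightarrow> \<tau> i < \<tau> j"
        by (auto simp: shuffle_perms_def strict_mono_on_def m)
      have inj: "\<tau> i = \<tau> j \<Longrightarrow> i = j" for i j
        using permutes_inj[OF p] by (auto dest: injD)
      have nz: "\<tau> j > 0" if "j \<noteq> c" for j
        using that inj[of j c] t(2) by auto
      have lt: "\<tau> j < Suc (k' + q')" if "j < Suc (k' + q')" for j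
        using permutes_in_image[OF p, of j] that by auto
      have out: "\<tau> j = j" if "\<not> j < Suc (k' + q')" for j
        using permutes_not_in[OF p, of j] that by auto
      have nz': "\<tau> j = Suc (\<tau> j - 1)" if "j \<noteq> c" for j using nz[OF that] by simp
      show "insert_zero c (un \<tau>) = \<tau>"
      proof
        fix j
        consider "j < c" | "j = c" | "j > c" "j < Suc (k' + q')" | "j \<ge> Suc (k' + q')" by linarith
        then show "insert_zero c (un \<tau>) j = \<tau> j"
          using c t nz[of j] out[of j] by cases (auto simp: insert_zero_def un_def)
      qed
      have "un \<tau> permutes {..<k' + q'}"
      proof (rule bij_imp_permutes)
        have "inj_on (un \<tau>) {..<k' + q'}"
        proof (rule inj_onI)
          fix i j assume ij: "i \<in> {..<k' + q'}" "j \<in> {..<k' + q'}" "un \<tau> i = un \<tau> j"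
          \<comment> \<open>The positions of \<open>i\<close> and \<open>j\<close> in \<tau>, before
            position \<open>c\<close> was deleted.\<close>
          define i' j' where "i' = (if i < c then i else Suc i)" and "j' = (if j < c then j else Suc j)"
          have "\<tau> i' - 1 = \<tau> j' - 1" using ij by (simp add: un_def i'_def j'_def split: if_splits)
          moreover have "i' \<noteq> c" "j' \<noteq> c" by (auto simp: i'_def j'_def)
          ultimately have "i' = j'" using nz[of i'] nz[of j'] inj[of i' j'] by linarith
          then show "i = j" by (auto simp: i'_def j'_def split: if_splits)
        qed
        moreover have "un \<tau> ` {..<k' + q'} \<subseteq> {..<k' + q'}"
        proof safe
          fix j assume j: "j < k' + q'"
          have "0 < \<tau> (if j < c then j else Suc j)" by (rule nz) auto
          then show "un \<tau> j < k' + q'" using j lt[of j] lt[of "Suc j"]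
            by (auto simp: un_def split: if_splits)
        qed
        ultimately show "bij_betw (un \<tau>) {..<k' + q'} {..<k' + q'}"
          by (simp add: bij_betw_def endo_inj_surj)
      qed (auto simp: un_def)
      moreover have "un \<tau> i < un \<tau> j" if "i < j" "j < k'" for i j
        using assms m1[of i j] m1[of "Suc i" "Suc j"] nz[of i] nz[of "Suc i"] that by (auto simp: un_def)
      moreover have "un \<tau> i < un \<tau> j" if "k' \<le> i" "i < j" "j < k' + q'" for i j
        using assms m2[of "Suc i" "Suc j"] nz[of "Suc i"] that by (auto simp: un_def)
      ultimately show "un \<tau> \<in> shuffle_perms k' q'"
        by (auto simp: shuffle_perms_def strict_mono_on_def)
    qed
    show "\<forall>\<tau>\<in>{\<sigma> \<in> shuffle_perms k q. \<sigma> c = 0}. insert_zero c (un \<tau>) = \<tau>"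
      using tau(1) by blast
    show "un ` {\<sigma> \<in> shuffle_perms k q. \<sigma> c = 0} \<subseteq> shuffle_perms k' q'"
      using tau(2) by blast
  qed
qed

lemma finite_shuffle_perms: "finite (shuffle_perms k q)"
  by (rule finite_subset[OF _ finite_permutations[of "{..<k + q}"]]) (auto simp: shuffle_perms_def)

lemma shuffle_perms_0_0: "shuffle_perms 0 0 = {id}"
  by (auto simp: shuffle_perms_def permutes_id)

text \<open>Both shuffle sums in \<open>circ\<close> have this shape, with \<open>g\<close>
  receiving the blocks of the first run and those of the second. One recursion then serves for
  both.\<close>

definition shuffle_sum :: "('k::field \<Rightarrow> 'b::ab_group_add \<Rightarrow> 'b) \<Rightarrow> nat \<Rightarrow> nat \<Rightarrow> ('a list \<Rightarrow> 'a list \<Rightarrow> 'b) \<Rightarrow> 'a list \<Rightarrow> 'b"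
  where "shuffle_sum s k q g Xs = (\<Sum>\<sigma>\<in>shuffle_perms k q. s (of_int (sign \<sigma>))
    (g (map (\<lambda>j. Xs ! \<sigma> j) [0..<k]) (map (\<lambda>j. Xs ! \<sigma> j) [k..<k + q])))"

context vector_space
begin

text \<open>The test \<open>k = k'\<close> tells the two places of \<open>0\<close> apart: if it
  holds, \<open>X\<close>, the block of index \<open>0\<close>, heads the second list, otherwise the
  first. The sign is that of the inserted cycle.\<close>

lemma shuffle_sum_zero:
  assumes "k = Suc k' \<and> q = q' \<and> c = 0 \<or> k = k' \<and> q = Suc q' \<and> c = k"
  shows "(\<Sum>\<sigma>\<in>{\<sigma> \<in> shuffle_perms k q. \<sigma> c = 0}. scale (of_int (sign \<sigma>))
      (g (map (\<lambda>j. (X # Xs) ! \<sigma> j) [0..<k]) (map (\<lambda>j. (X # Xs) ! \<sigma> j) [k..<k + q]))) =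
    scale ((- 1) ^ c) (shuffle_sum scale k' q'
      (\<lambda>as bs. if k = k' then g as (X # bs) else g (X # as) bs) Xs)"
proof -
  have list1: "map (\<lambda>j. (X # Xs) ! insert_zero c \<sigma> j) [0..<k] =
      (if k = k' then map (\<lambda>j. Xs ! \<sigma> j) [0..<k'] else X # map (\<lambda>j. Xs ! \<sigma> j) [0..<k'])" for \<sigma>
  proof (cases "k = k'")
    case True
    then have "c = k" using assms by auto
    with True show ?thesis by (auto simp: insert_zero_def)
  next
    case False
    then have "k = Suc k'" "c = 0" using assms by auto
    moreover have "[0..<Suc k'] = 0 # map Suc [0..<k']"
      by (simp add: map_Suc_upt upt_conv_Cons del: upt_Suc)
    ultimately show ?thesis by (auto simp: insert_zero_def simp del: upt_Suc)
  qed
  have list2: "map (\<lambda>j. (X # Xs) ! insert_zero c \<sigma> j) [k..<k + q] =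
      (if k = k' then X # map (\<lambda>j. Xs ! \<sigma> j) [k'..<k' + q'] else map (\<lambda>j. Xs ! \<sigma> j) [k'..<k' + q'])" for \<sigma>
  proof (cases "k = k'")
    case True
    then have "c = k" "q = Suc q'" using assms by auto
    moreover have "[k'..<k' + Suc q'] = k' # map Suc [k'..<k' + q']"
      by (simp add: map_Suc_upt upt_conv_Cons del: upt_Suc)
    ultimately show ?thesis using True by (auto simp: insert_zero_def simp del: upt_Suc)
  next
    case False
    then have "k = Suc k'" "c = 0" "q = q'" using assms by auto
    moreover have "[Suc k'..<Suc k' + q'] = map Suc [k'..<k' + q']"
      by (simp add: map_Suc_upt del: upt_Suc)
    ultimately show ?thesis by (auto simp: insert_zero_def simp del: upt_Suc)
  qed
  have sgn: "sign (insert_zero c \<sigma>) = (- 1) ^ c * sign \<sigma>" if "\<sigma> \<in> shuffle_perms k' q'" for \<sigma>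
    using that assms by (intro insert_zero_permutes(2)[of _ "k' + q'"]) (auto simp: shuffle_perms_def)
  show ?thesis
    unfolding shuffle_sum_def scale_sum_right
    by (subst sum.reindex_bij_betw[OF bij_betw_insert_zero[OF assms], symmetric], rule sum.cong)
      (auto simp: list1 list2 sgn)
qed

lemma shuffle_sum_Cons:
  assumes "k + q > 0"
  shows "shuffle_sum scale k q g (X # Xs) =
    (if k > 0 then shuffle_sum scale (k - 1) q (\<lambda>as bs. g (X # as) bs) Xs else 0) +
    (if q > 0 then scale ((- 1) ^ k) (shuffle_sum scale k (q - 1) (\<lambda>as bs. g as (X # bs)) Xs) else 0)"
proof -
  define F where "F = (\<lambda>\<sigma>. scale (of_int (sign \<sigma>))
      (g (map (\<lambda>j. (X # Xs) ! \<sigma> j) [0..<k]) (map (\<lambda>j. (X # Xs) ! \<sigma> j) [k..<k + q])))"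
  \<comment> \<open>For \<open>k = 0\<close> the positions \<open>0\<close> and \<open>k\<close>
    coincide. The guard then empties \<open>A\<close>, which keeps the two sets disjoint.\<close>
  define A where "A = (if k > 0 then {\<sigma> \<in> shuffle_perms k q. \<sigma> 0 = 0} else {})"
  define B where "B = (if q > 0 then {\<sigma> \<in> shuffle_perms k q. \<sigma> k = 0} else {})"
  have "\<sigma> \<in> A \<union> B" if "\<sigma> \<in> shuffle_perms k q" for \<sigma>
    using shuffle_zero[OF that assms] that by (auto simp: A_def B_def)
  moreover have "A \<union> B \<subseteq> shuffle_perms k q" by (auto simp: A_def B_def)
  ultimately have "shuffle_perms k q = A \<union> B" by blast
  moreover have "A \<inter> B = {}"
    by (auto simp: A_def B_def shuffle_perms_def dest!: permutes_inj injD[of _ 0 k])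
  moreover have "finite A" "finite B" by (auto simp: A_def B_def finite_shuffle_perms)
  ultimately have "shuffle_sum scale k q g (X # Xs) = sum F A + sum F B"
    by (simp add: shuffle_sum_def F_def sum.union_disjoint)
  moreover have "sum F A = (if k > 0 then shuffle_sum scale (k - 1) q (\<lambda>as bs. g (X # as) bs) Xs else 0)"
    unfolding A_def F_def using shuffle_sum_zero[of k "k - 1" q q 0 g X Xs] by auto
  moreover have "sum F B = (if q > 0 then scale ((- 1) ^ k) (shuffle_sum scale k (q - 1) (\<lambda>as bs. g as (X # bs)) Xs) else 0)"
    unfolding B_def F_def using shuffle_sum_zero[of k k q "q - 1" k g X Xs] by auto
  ultimately show ?thesis by simp
qed

lemma shuffle_sum_0_0: "shuffle_sum scale 0 0 g Xs = g [] []"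
  by (simp add: shuffle_sum_def shuffle_perms_0_0)

end


section \<open>A recursion for the product of cochains\<close>

text \<open>
  \<open>circ_rec n s q\<close> evaluates its second argument on \<open>q\<close> blocks only.  On \<open>p + q\<close> blocks it agrees
  with \<open>circ n s p q\<close>, so the degree of the first argument need not be recorded.
\<close>

fun circ_rec ::
  "nat \<Rightarrow> ('k::field \<Rightarrow> 'w::ab_group_add \<Rightarrow> 'w) \<Rightarrow> nat \<Rightarrow> 'w cochain \<Rightarrow> 'w cochain \<Rightarrow> 'w cochain"
  where
    "circ_rec n s q P Q [] x = (if q = 0 then P [] (Q [] x) else 0)"
  | "circ_rec n s q P Q (X # Xs) x =
      s ((- 1) ^ q) (circ_rec n s q (\<lambda>Ys. P (X # Ys)) Q Xs x) +
      (if q = 0 then \<Sum>i<n - 1. P (X[i := Q [] (X ! i)] # Xs) x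
       else circ_rec n s (q - 1) P (\<lambda>Ys. Q (X # Ys)) Xs x)"

context vector_space
begin

lemma circ_eq_shuffle_sum:
  "circ n scale p q P Q Xs x =
    (\<Sum>k<p. scale ((- 1) ^ (k * q)) (shuffle_sum scale k q (\<lambda>as bs. \<Sum>i<n - 1.
      P (as @ [(Xs ! (k + q))[i := Q bs (Xs ! (k + q) ! i)]] @ drop (k + q + 1) Xs) x) Xs)) +
    scale ((- 1) ^ (p * q)) (shuffle_sum scale p q (\<lambda>as bs. P as (Q bs x)) Xs)"
  by (simp add: circ_def shuffle_sum_def scale_sum_right)

lemma circ_0_0: "circ n scale 0 0 P Q Xs x = P [] (Q [] x)"
  by (simp add: circ_eq_shuffle_sum shuffle_sum_0_0)

lemma circ_0_Suc:
  "circ n scale 0 (Suc q) P Q (X # Xs) x = circ n scale 0 q P (\<lambda>Ys. Q (X # Ys)) Xs x"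
  by (simp add: circ_eq_shuffle_sum shuffle_sum_Cons)

text \<open>For \<open>q = 0\<close> the block in which \<open>Q\<close> acts can be the first one:
  the summand \<open>k = 0\<close> of \<open>circ\<close> is the extra sum on the right.\<close>

lemma circ_Suc_0:
  "circ n scale (Suc p) 0 P Q (X # Xs) x =
    circ n scale p 0 (\<lambda>Ys. P (X # Ys)) Q Xs x + (\<Sum>i<n - 1. P (X[i := Q [] (X ! i)] # Xs) x)"
  by (simp add: circ_eq_shuffle_sum sum.lessThan_Suc_shift shuffle_sum_Cons shuffle_sum_0_0
      del: sum.lessThan_Suc)

text \<open>If \<open>X\<close> goes to \<open>P\<close>, the index \<open>k\<close> drops by one,
  which costs \<open>(- 1) ^ Suc q\<close> in every summand. If \<open>X\<close> goes to
  \<open>Q\<close>, the shuffle sign \<open>(- 1) ^ k\<close> turns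
  \<open>(- 1) ^ (k * Suc q)\<close> into \<open>(- 1) ^ (k * q)\<close> and no sign is left over.
  The block in which \<open>Q\<close> acts has at least \<open>Suc q\<close> others before it and is
  never \<open>X\<close>.\<close>

lemma circ_Suc_Suc:
  "circ n scale (Suc p) (Suc q) P Q (X # Xs) x =
    scale ((- 1) ^ Suc q) (circ n scale p (Suc q) (\<lambda>Ys. P (X # Ys)) Q Xs x) +
    circ n scale (Suc p) q P (\<lambda>Ys. Q (X # Ys)) Xs x"
proof -
  have sgn: "(- 1) ^ (k * Suc q) * (- 1) ^ k = ((- 1) ^ (k * q) :: 'a)" for k
    by (simp add: power_add mult.assoc mult.left_commute)
  define F where "F k = (\<lambda>as bs. \<Sum>i<n - 1.
    P (as @ [((X # Xs) ! (k + Suc q))[i := Q bs ((X # Xs) ! (k + Suc q) ! i)]] @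
      drop (k + Suc q + 1) (X # Xs)) x)" for k
  define F1 where "F1 k = shuffle_sum scale k (Suc q) (\<lambda>as bs. F (Suc k) (X # as) bs) Xs" for k
  define F2 where "F2 k = shuffle_sum scale k q (\<lambda>as bs. F k as (X # bs)) Xs" for k
  have "(\<Sum>k<Suc p. scale ((- 1) ^ (k * Suc q)) (shuffle_sum scale k (Suc q) (F k) (X # Xs))) =
    (\<Sum>k<Suc p. scale ((- 1) ^ (k * Suc q)) (if k > 0 then F1 (k - 1) else 0) + scale ((- 1) ^ (k * q)) (F2 k))"
  proof (rule sum.cong[OF refl])
    fix k
    show "scale ((- 1) ^ (k * Suc q)) (shuffle_sum scale k (Suc q) (F k) (X # Xs)) =
      scale ((- 1) ^ (k * Suc q)) (if k > 0 then F1 (k - 1) else 0) + scale ((- 1) ^ (k * q)) (F2 k)"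
    proof -
      have "shuffle_sum scale k (Suc q) (F k) (X # Xs) = (if k > 0 then F1 (k - 1) else 0) + scale ((- 1) ^ k) (F2 k)"
        by (cases k) (simp_all add: shuffle_sum_Cons F1_def F2_def)
      then show ?thesis by (simp only: scale_right_distrib scale_scale sgn)
    qed
  qed
  \<comment> \<open>The condition \<open>k > 0\<close> removes the first summand of the first part;
    the others are reindexed by \<open>Suc\<close>.\<close>
  also have "\<dots> = (\<Sum>k<p. scale ((- 1) ^ (Suc k * Suc q)) (F1 k)) + (\<Sum>k<Suc p. scale ((- 1) ^ (k * q)) (F2 k))"
    unfolding sum.distrib by (simp add: sum.lessThan_Suc_shift del: sum.lessThan_Suc mult_Suc mult_Suc_right)
  also have "(\<Sum>k<p. scale ((- 1) ^ (Suc k * Suc q)) (F1 k)) =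
    scale ((- 1) ^ Suc q) (\<Sum>k<p. scale ((- 1) ^ (k * Suc q)) (F1 k))"
    by (simp add: scale_sum_right power_add mult_ac)
  finally have 1: "(\<Sum>k<Suc p. scale ((- 1) ^ (k * Suc q)) (shuffle_sum scale k (Suc q) (F k) (X # Xs))) =
    scale ((- 1) ^ Suc q) (\<Sum>k<p. scale ((- 1) ^ (k * Suc q)) (F1 k)) + (\<Sum>k<Suc p. scale ((- 1) ^ (k * q)) (F2 k))" .
  have 2: "scale ((- 1) ^ (Suc p * Suc q)) (shuffle_sum scale (Suc p) (Suc q) (\<lambda>as bs. P as (Q bs x)) (X # Xs)) =
    scale ((- 1) ^ Suc q) (scale ((- 1) ^ (p * Suc q)) (shuffle_sum scale p (Suc q) (\<lambda>as bs. P (X # as) (Q bs x)) Xs)) +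
    scale ((- 1) ^ (Suc p * q)) (shuffle_sum scale (Suc p) q (\<lambda>as bs. P as (Q (X # bs) x)) Xs)"
  proof -
    have "shuffle_sum scale (Suc p) (Suc q) (\<lambda>as bs. P as (Q bs x)) (X # Xs) =
      shuffle_sum scale p (Suc q) (\<lambda>as bs. P (X # as) (Q bs x)) Xs +
      scale ((- 1) ^ Suc p) (shuffle_sum scale (Suc p) q (\<lambda>as bs. P as (Q (X # bs) x)) Xs)"
      by (simp add: shuffle_sum_Cons)
    then show ?thesis
      by (simp only: scale_right_distrib scale_scale sgn) (simp only: mult_Suc power_add)
  qed
  have F1: "F1 k = shuffle_sum scale k (Suc q) (\<lambda>as bs. \<Sum>i<n - 1.
      P (X # (as @ [(Xs ! (k + Suc q))[i := Q bs (Xs ! (k + Suc q) ! i)]] @ drop (k + Suc q + 1) Xs)) x) Xs"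
    and F2: "F2 k = shuffle_sum scale k q (\<lambda>as bs. \<Sum>i<n - 1.
      P (as @ [(Xs ! (k + q))[i := Q (X # bs) (Xs ! (k + q) ! i)]] @ drop (k + q + 1) Xs) x) Xs" for k
    by (simp_all add: F1_def F2_def F_def)
  have "circ n scale (Suc p) (Suc q) P Q (X # Xs) x =
    (\<Sum>k<Suc p. scale ((- 1) ^ (k * Suc q)) (shuffle_sum scale k (Suc q) (F k) (X # Xs))) +
    scale ((- 1) ^ (Suc p * Suc q)) (shuffle_sum scale (Suc p) (Suc q) (\<lambda>as bs. P as (Q bs x)) (X # Xs))"
    by (simp only: circ_eq_shuffle_sum F_def)
  then show ?thesis
    unfolding 1 2 by (simp only: circ_eq_shuffle_sum F1 F2 scale_right_distrib ac_simps)
qed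

lemma circ_rec_short: "length Xs < q \<Longrightarrow> circ_rec n scale q P Q Xs x = 0"
  by (induction Xs arbitrary: q P Q) auto

lemma circ_eq_circ_rec:
  "length Xs = p + q \<Longrightarrow> circ n scale p q P Q Xs x = circ_rec n scale q P Q Xs x"
proof (induction Xs arbitrary: p q P Q)
  case Nil
  then show ?case by (simp add: circ_0_0)
next
  case (Cons X Xs)
  show ?case
  proof (cases p; cases q)
    assume "p = 0" "q = 0"
    with Cons.prems show ?thesis by simp
  next
    fix q' assume "p = 0" "q = Suc q'"
    \<comment> \<open>Contracting \<open>P\<close> leaves only \<open>q'\<close> blocks, too few for
      \<open>Q\<close>, which is evaluated on \<open>Suc q'\<close>; that term is zero.\<close>
    with Cons show ?thesis by (simp add: circ_0_Suc circ_rec_short)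
  next
    fix p' assume "p = Suc p'" "q = 0"
    with Cons show ?thesis by (simp add: circ_Suc_0)
  next
    fix p' q' assume "p = Suc p'" "q = Suc q'"
    with Cons show ?thesis by (simp add: circ_Suc_Suc)
  qed
qed

end


section \<open>The graded pre-Lie identity\<close>

text \<open>No degree is fixed: the class is closed under contraction of the first block, as
  inductions need, and under sums of maps of different degrees, so it contains the whole direct
  sum.\<close>

definition multilinear_cochain :: "nat \<Rightarrow> ('k::field \<Rightarrow> 'w::ab_group_add \<Rightarrow> 'w) \<Rightarrow> 'w cochain \<Rightarrow> bool"
  where "multilinear_cochain n s P \<longleftrightarrow>
    (\<forall>Xs x. \<not> (\<forall>X\<in>set Xs. length X = n - 1) \<longrightarrow> P Xs x = 0) \<and>
    (\<forall>Xs. Vector_Spaces.linear s s (P Xs)) \<and>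
    (\<forall>Ys X Zs i x. i < length X \<longrightarrow> Vector_Spaces.linear s s (\<lambda>v. P (Ys @ X[i := v] # Zs) x))"

lemma multilinear_cochain_Cons:
  assumes "multilinear_cochain n s P"
  shows "multilinear_cochain n s (\<lambda>Ys. P (X # Ys))"
  using assms unfolding multilinear_cochain_def append_Cons[symmetric]
  by (metis list.set_intros(2))

lemma multilinear_cochain_linear_last:
  "multilinear_cochain n s P \<Longrightarrow> Vector_Spaces.linear s s (P Xs)"
  by (simp add: multilinear_cochain_def)

lemma multilinear_cochain_linear_block:
  "multilinear_cochain n s P \<Longrightarrow> i < length X \<Longrightarrow> Vector_Spaces.linear s s (\<lambda>v. P (Ys @ X[i := v] # Zs) x)"
  by (simp add: multilinear_cochain_def)

lemma multilinear_cochain_linear_hd: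
  assumes "multilinear_cochain n s P" "i < n - 1"
  shows "Vector_Spaces.linear s s (\<lambda>v. P (X[i := v] # Zs) x)"
proof (cases "length X = n - 1")
  case True
  then show ?thesis
    using multilinear_cochain_linear_block[of n s P i X "[]"] assms by simp
next
  case False
  then have "P (X[i := v] # Zs) x = 0" for v
    using assms by (simp add: multilinear_cochain_def)
  moreover have "vector_space s"
    using multilinear_cochain_linear_last[OF assms(1)] by (simp add: Vector_Spaces.linear_iff)
  ultimately show ?thesis
    by (simp add: Vector_Spaces.linear_iff vector_space.vector_space_assms module.scale_zero_right module_iff_vector_space)
qed

lemma linear_apply_add: "Vector_Spaces.linear s t f \<Longrightarrow> f (x + y) = f x + f y"
  and linear_apply_scale: "Vector_Spaces.linear s t f \<Longrightarrow> f (s c x) = t c (f x)"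
  and linear_apply_zero: "Vector_Spaces.linear s t f \<Longrightarrow> f 0 = 0"
  using module_hom.add module_hom.scale module_hom.zero linear_iff_module_hom by metis+

text \<open>The summands will be pairs of insertions at positions \<open>i\<close> and
  \<open>j\<close> of one block. These commute at distinct positions, so the diagonal is taken out
  on both sides.\<close>

lemma sum_offdiagonal_swap:
  fixes f g :: "nat \<Rightarrow> nat \<Rightarrow> 'a::ab_group_add"
  assumes "\<And>i j. i \<noteq> j \<Longrightarrow> f i j = g j i"
  shows "(\<Sum>i<n. \<Sum>j<n. f i j) - (\<Sum>i<n. f i i) = (\<Sum>i<n. \<Sum>j<n. g i j) - (\<Sum>i<n. g i i)"
proof -
  have diag: "(\<Sum>i<n. \<Sum>j<n. h i j) - (\<Sum>i<n. h i i) = (\<Sum>i<n. \<Sum>j<n. if i = j then 0 else h i j)"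
    for h :: "nat \<Rightarrow> nat \<Rightarrow> 'a"
  proof -
    have "(\<Sum>j<n. h i j) - h i i = (\<Sum>j<n. if i = j then 0 else h i j)" if "i < n" for i
      using that by (simp add: sum.remove[of "{..<n}" i] cong: if_cong)
    then show ?thesis by (simp flip: sum_subtractf)
  qed
  show ?thesis
    unfolding diag by (subst sum.swap) (auto intro!: sum.cong assms assms[symmetric])
qed

definition circ_associator ::
  "nat \<Rightarrow> ('k::field \<Rightarrow> 'w::ab_group_add \<Rightarrow> 'w) \<Rightarrow> nat \<Rightarrow> nat \<Rightarrow> 'w cochain \<Rightarrow> 'w cochain \<Rightarrow> 'w cochain \<Rightarrow> 'w cochain"
  where "circ_associator n s q r P Q R = (\<lambda>Xs x.
    circ_rec n s r (circ_rec n s q P Q) R Xs x - circ_rec n s (q + r) P (circ_rec n s r Q R) Xs x)"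

text \<open>\<open>P\<close> is only ever evaluated on \<open>length Xs - q\<close> blocks and
  \<open>Q\<close> on \<open>q\<close>. This allows a homogeneous cochain to be replaced by zero
  when the number of blocks does not fit its degree.\<close>

lemma circ_rec_cong:
  "(\<And>Ys. length Ys + q = length Xs \<Longrightarrow> P Ys = P' Ys) \<Longrightarrow> (\<And>Ys. length Ys = q \<Longrightarrow> Q Ys = Q' Ys) \<Longrightarrow>
    circ_rec n s q P Q Xs x = circ_rec n s q P' Q' Xs x"
proof (induction Xs arbitrary: q P P' Q Q')
  case (Cons X Xs)
  have "circ_rec n s q (\<lambda>Ys. P (X # Ys)) Q Xs x = circ_rec n s q (\<lambda>Ys. P' (X # Ys)) Q' Xs x"
    by (rule Cons.IH) (use Cons.prems in auto)
  moreover have "circ_rec n s (q - 1) P (\<lambda>Ys. Q (X # Ys)) Xs x = circ_rec n s (q - 1) P' (\<lambda>Ys. Q' (X # Ys)) Xs x"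
    if "q > 0" by (rule Cons.IH) (use Cons.prems that in auto)
  ultimately show ?case using Cons.prems by simp
qed simp

section \<open>Linearity of the product in each factor, and contraction of the associator\<close>

context vector_space
begin

lemma circ_rec_zero_left: "circ_rec n scale q (\<lambda>Ys y. 0) Q Xs x = 0"
  by (induction Xs arbitrary: q Q) auto

lemma circ_rec_add_left:
  "circ_rec n scale q (\<lambda>Ys y. P Ys y + P' Ys y) Q Xs x =
    circ_rec n scale q P Q Xs x + circ_rec n scale q P' Q Xs x"
  by (induction Xs arbitrary: q P P' Q) (auto simp: scale_right_distrib sum.distrib)

lemma circ_rec_scale_left:
  "circ_rec n scale q (\<lambda>Ys y. scale c (P Ys y)) Q Xs x = scale c (circ_rec n scale q P Q Xs x)"
  by (induction Xs arbitrary: q P Q) (auto simp: scale_right_distrib scale_sum_right mult.commute)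

lemma circ_rec_sum_left:
  "circ_rec n scale q (\<lambda>Ys y. \<Sum>i\<in>I. P i Ys y) Q Xs x = (\<Sum>i\<in>I. circ_rec n scale q (P i) Q Xs x)"
  by (induction I rule: infinite_finite_induct) (auto simp: circ_rec_zero_left circ_rec_add_left)

lemma circ_rec_add_right:
  "multilinear_cochain n scale P \<Longrightarrow>
    circ_rec n scale q P (\<lambda>Ys y. Q Ys y + Q' Ys y) Xs x =
    circ_rec n scale q P Q Xs x + circ_rec n scale q P Q' Xs x"
proof (induction Xs arbitrary: q P Q Q')
  case Nil
  then show ?case by (simp add: linear_apply_add[OF multilinear_cochain_linear_last[OF Nil]])
next
  case (Cons X Xs)
  have "(\<Sum>i<n - 1. P (X[i := Q [] (X ! i) + Q' [] (X ! i)] # Xs) x) =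
      (\<Sum>i<n - 1. P (X[i := Q [] (X ! i)] # Xs) x) + (\<Sum>i<n - 1. P (X[i := Q' [] (X ! i)] # Xs) x)"
    unfolding sum.distrib[symmetric]
    by (intro sum.cong refl linear_apply_add[OF multilinear_cochain_linear_hd[OF Cons.prems]]) simp
  then show ?case
    using Cons.IH[OF multilinear_cochain_Cons[OF Cons.prems]] Cons.IH[OF Cons.prems]
    by (simp add: scale_right_distrib)
qed

lemma circ_rec_scale_right:
  "multilinear_cochain n scale P \<Longrightarrow>
    circ_rec n scale q P (\<lambda>Ys y. scale c (Q Ys y)) Xs x = scale c (circ_rec n scale q P Q Xs x)"
proof (induction Xs arbitrary: q P Q)
  case Nil
  then show ?case by (simp add: linear_apply_scale[OF multilinear_cochain_linear_last[OF Nil]])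
next
  case (Cons X Xs)
  have "(\<Sum>i<n - 1. P (X[i := scale c (Q [] (X ! i))] # Xs) x) =
      scale c (\<Sum>i<n - 1. P (X[i := Q [] (X ! i)] # Xs) x)"
    unfolding scale_sum_right
    by (intro sum.cong refl linear_apply_scale[OF multilinear_cochain_linear_hd[OF Cons.prems]]) simp
  then show ?case
    using Cons.IH[OF multilinear_cochain_Cons[OF Cons.prems]] Cons.IH[OF Cons.prems]
    by (simp add: scale_right_distrib mult.commute)
qed

lemma circ_rec_zero_right:
  "multilinear_cochain n scale P \<Longrightarrow> circ_rec n scale q P (\<lambda>Ys y. 0) Xs x = 0"
  using circ_rec_scale_right[of n P q 0 "\<lambda>Ys y. 0"] by simp

lemma circ_rec_sum_right:
  "multilinear_cochain n scale P \<Longrightarrow>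
    circ_rec n scale q P (\<lambda>Ys y. \<Sum>i\<in>I. Q i Ys y) Xs x = (\<Sum>i\<in>I. circ_rec n scale q P (Q i) Xs x)"
  by (induction I rule: infinite_finite_induct) (auto simp: circ_rec_zero_right circ_rec_add_right)

lemma circ_rec_minus_left:
  "circ_rec n scale q (\<lambda>Ys y. - P Ys y) Q Xs x = - circ_rec n scale q P Q Xs x"
  using circ_rec_scale_left[of n q "- 1" P Q Xs x] by simp

lemma circ_rec_diff_left:
  "circ_rec n scale q (\<lambda>Ys y. P Ys y - P' Ys y) Q Xs x =
    circ_rec n scale q P Q Xs x - circ_rec n scale q P' Q Xs x"
  using circ_rec_add_left[of n q P "\<lambda>Ys y. - P' Ys y" Q Xs x] by (simp add: circ_rec_minus_left)

lemma circ_rec_minus_right: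
  "multilinear_cochain n scale P \<Longrightarrow>
    circ_rec n scale q P (\<lambda>Ys y. - Q Ys y) Xs x = - circ_rec n scale q P Q Xs x"
  using circ_rec_scale_right[of n P q "- 1" Q Xs x] by simp

lemma circ_rec_diff_right:
  "multilinear_cochain n scale P \<Longrightarrow>
    circ_rec n scale q P (\<lambda>Ys y. Q Ys y - Q' Ys y) Xs x =
    circ_rec n scale q P Q Xs x - circ_rec n scale q P Q' Xs x"
  using circ_rec_add_right[of n P q Q "\<lambda>Ys y. - Q' Ys y" Xs x] by (simp add: circ_rec_minus_right)

text \<open>Stated without the final vector, so that it also rewrites a composite which is itself a
  factor of another one.\<close>

lemma circ_rec_Cons_fun:
  "circ_rec n s q P Q (X # Xs) = (\<lambda>x.
    s ((- 1) ^ q) (circ_rec n s q (\<lambda>Ys. P (X # Ys)) Q Xs x) +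
    (if q = 0 then \<Sum>i<n - 1. P (X[i := Q [] (X ! i)] # Xs) x
     else circ_rec n s (q - 1) P (\<lambda>Ys. Q (X # Ys)) Xs x))"
  by (simp add: fun_eq_iff)

text \<open>The recursion stands first, so that \<open>circ_rec_linear(2-)\<close> expands by
  linearity alone.\<close>

lemmas circ_rec_linear = circ_rec_Cons_fun circ_rec_minus_left circ_rec_diff_left
  circ_rec_minus_right circ_rec_diff_right circ_rec_add_left circ_rec_scale_left circ_rec_sum_left
  circ_rec_add_right circ_rec_scale_right circ_rec_sum_right

text \<open>The block \<open>X\<close> goes to \<open>P\<close>, \<open>Q\<close> or
  \<open>R\<close> and passes the factors to the right of the one it enters. For \<open>P\<close>
  this gives \<open>Suc q + Suc r\<close> as exponent, which has the parity of \<open>q + r\<close>;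
  for \<open>Q\<close> it gives \<open>Suc r\<close>, and for \<open>R\<close> no sign.\<close>

lemma circ_associator_Suc_Suc:
  assumes "multilinear_cochain n scale P"
  shows "circ_associator n scale (Suc q) (Suc r) P Q R (X # Xs) x =
    scale ((- 1) ^ (q + r)) (circ_associator n scale (Suc q) (Suc r) (\<lambda>Ys. P (X # Ys)) Q R Xs x) +
    scale ((- 1) ^ Suc r) (circ_associator n scale q (Suc r) P (\<lambda>Ys. Q (X # Ys)) R Xs x) +
    circ_associator n scale (Suc q) r P Q (\<lambda>Ys. R (X # Ys)) Xs x"
  using assms unfolding circ_associator_def
  by (simp add: circ_rec_linear algebra_simps power_add)

text \<open>A factor evaluated on no blocks is inserted into the entries of \<open>X\<close> instead
  of absorbing it, which gives the middle sum; its sign comes from \<open>X\<close> passing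
  \<open>R\<close>.\<close>

lemma circ_associator_0_Suc:
  assumes "multilinear_cochain n scale P"
  shows "circ_associator n scale 0 (Suc r) P Q R (X # Xs) x =
    scale ((- 1) ^ Suc r) (circ_associator n scale 0 (Suc r) (\<lambda>Ys. P (X # Ys)) Q R Xs x) +
    scale ((- 1) ^ Suc r) (\<Sum>i<n - 1. circ_rec n scale (Suc r) (\<lambda>Ys. P (X[i := Q [] (X ! i)] # Ys)) R Xs x) +
    circ_associator n scale 0 r P Q (\<lambda>Ys. R (X # Ys)) Xs x"
proof -
  \<comment> \<open>Giving \<open>X\<close> to \<open>Q\<close> here leaves \<open>r\<close> blocks
    for \<open>R\<close>, which is evaluated on \<open>Suc r\<close>; the inner composite is
    zero.\<close>
  have "circ_rec n scale r P (circ_rec n scale (Suc r) (\<lambda>Ys. Q (X # Ys)) R) Xs x =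
      circ_rec n scale r P (\<lambda>Ys y. 0) Xs x"
    by (rule circ_rec_cong) (auto simp: circ_rec_short)
  then show ?thesis
    using assms unfolding circ_associator_def
    by (simp add: circ_rec_linear circ_rec_zero_right algebra_simps power_add)
qed

lemma circ_associator_Suc_0:
  assumes "multilinear_cochain n scale P"
  shows "circ_associator n scale (Suc q) 0 P Q R (X # Xs) x =
    scale ((- 1) ^ Suc q) (circ_associator n scale (Suc q) 0 (\<lambda>Ys. P (X # Ys)) Q R Xs x) +
    circ_associator n scale q 0 P (\<lambda>Ys. Q (X # Ys)) R Xs x +
    scale ((- 1) ^ Suc q) (\<Sum>i<n - 1. circ_rec n scale (Suc q) (\<lambda>Ys. P (X[i := R [] (X ! i)] # Ys)) Q Xs x)"
  using assms unfolding circ_associator_def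
  by (simp add: circ_rec_linear algebra_simps sum.distrib sum_negf sum_subtractf scale_sum_right)

text \<open>Composing twice inserts \<open>R\<close> at \<open>i\<close> and then \<open>Q\<close>
  at \<open>j\<close>, also for \<open>i = j\<close>. The diagonal is what \<open>P\<close> composed
  with the composite of \<open>Q\<close> and \<open>R\<close> contributes, so the associator keeps
  the pairs of distinct positions.\<close>

lemma circ_associator_0_0:
  assumes "multilinear_cochain n scale P"
  shows "circ_associator n scale 0 0 P Q R (X # Xs) x =
    circ_associator n scale 0 0 (\<lambda>Ys. P (X # Ys)) Q R Xs x +
    (\<Sum>i<n - 1. circ_rec n scale 0 (\<lambda>Ys. P (X[i := Q [] (X ! i)] # Ys)) R Xs x) +
    (\<Sum>i<n - 1. circ_rec n scale 0 (\<lambda>Ys. P (X[i := R [] (X ! i)] # Ys)) Q Xs x) +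
    ((\<Sum>i<n - 1. \<Sum>j<n - 1. P (X[i := R [] (X ! i), j := Q [] (X[i := R [] (X ! i)] ! j)] # Xs) x) -
     (\<Sum>i<n - 1. P (X[i := R [] (X ! i), i := Q [] (X[i := R [] (X ! i)] ! i)] # Xs) x))"
proof -
  \<comment> \<open>Beyond the end of \<open>X\<close> the updates do nothing, so this holds for
    every \<open>i\<close>.\<close>
  have "P (X[i := R [] (X ! i), i := Q [] (X[i := R [] (X ! i)] ! i)] # Xs) x =
    P (X[i := Q [] (R [] (X ! i))] # Xs) x" for i
    by (cases "i < length X") (auto simp: list_update_beyond)
  then show ?thesis
    using assms unfolding circ_associator_def
    by (simp add: circ_rec_linear algebra_simps sum.distrib)
qed

text \<open>
  The graded right pre-Lie identity.  Contracting the first block is a graded derivation of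
  \<open>circ_rec\<close> up to terms that are visibly symmetric in \<open>Q\<close> and \<open>R\<close>, so that the identity
  follows by induction on the number of blocks.
\<close>

lemma circ_associator_swap:
  "multilinear_cochain n scale P \<Longrightarrow>
    circ_associator n scale q r P Q R Xs x = scale ((- 1) ^ (q * r)) (circ_associator n scale r q P R Q Xs x)"
proof (induction Xs arbitrary: q r P Q R)
  case Nil
  then show ?case by (cases q; cases r) (simp_all add: circ_associator_def)
next
  case (Cons X Xs)
  note IH = Cons.IH[OF Cons.prems] Cons.IH[OF multilinear_cochain_Cons[OF Cons.prems]]
  \<comment> \<open>For the case that both degrees are \<open>0\<close>: insertions of
    \<open>Q\<close> and \<open>R\<close> at distinct positions of \<open>X\<close> commute.\<close>
  have "(\<Sum>i<n - 1. \<Sum>j<n - 1. P (X[i := R [] (X ! i), j := Q [] (X[i := R [] (X ! i)] ! j)] # Xs) x) -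
      (\<Sum>i<n - 1. P (X[i := R [] (X ! i), i := Q [] (X[i := R [] (X ! i)] ! i)] # Xs) x) =
    (\<Sum>i<n - 1. \<Sum>j<n - 1. P (X[i := Q [] (X ! i), j := R [] (X[i := Q [] (X ! i)] ! j)] # Xs) x) -
      (\<Sum>i<n - 1. P (X[i := Q [] (X ! i), i := R [] (X[i := Q [] (X ! i)] ! i)] # Xs) x)"
    by (rule sum_offdiagonal_swap) (simp add: list_update_swap)
  note swap = this
  show ?case
  proof (cases q; cases r)
    fix q' r' assume "q = Suc q'" "r = Suc r'"
    then show ?thesis
      unfolding \<open>q = Suc q'\<close> \<open>r = Suc r'\<close> circ_associator_Suc_Suc[OF Cons.prems]
      by (simp add: IH(1)[where q = "q'" and r = "Suc r'" and Q = "\<lambda>Ys. Q (X # Ys)" and R = R] IH(1)[where q = "Suc q'" and r = "r'" and Q = Q and R = "\<lambda>Ys. R (X # Ys)"] IH(2)[where q = "Suc q'" and r = "Suc r'" and Q = Q and R = R] algebra_simps power_add)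
  next
    fix r' assume "q = 0" "r = Suc r'"
    then show ?thesis
      by (simp add: circ_associator_Suc_0[OF Cons.prems] circ_associator_0_Suc[OF Cons.prems]
          IH(1)[where q = "0" and r = "r'" and Q = Q and R = "\<lambda>Ys. R (X # Ys)"] IH(2)[where q = "0" and r = "Suc r'" and Q = Q and R = R] algebra_simps)
  next
    fix q' assume "q = Suc q'" "r = 0"
    then show ?thesis
      by (simp add: circ_associator_Suc_0[OF Cons.prems] circ_associator_0_Suc[OF Cons.prems]
          IH(1)[where q = "q'" and r = "0" and Q = "\<lambda>Ys. Q (X # Ys)" and R = R] IH(2)[where q = "Suc q'" and r = "0" and Q = Q and R = R] algebra_simps)
  next
    assume "q = 0" "r = 0"
    then show ?thesis
      using swap by (simp add: circ_associator_0_0[OF Cons.prems] IH(2)[where q = "0" and r = "0" and Q = Q and R = R] algebra_simps)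
  qed
qed

end


section \<open>Alternating maps and cochains\<close>

lemma linear_compose_fun:
  "Vector_Spaces.linear s t f \<Longrightarrow> Vector_Spaces.linear t u g \<Longrightarrow> Vector_Spaces.linear s u (\<lambda>x. g (f x))"
  by (simp add: Vector_Spaces.linear_iff)

lemma linear_zero_fun:
  "vector_space s \<Longrightarrow> vector_space t \<Longrightarrow> Vector_Spaces.linear s t (\<lambda>x. 0)"
  by (simp add: Vector_Spaces.linear_iff module.scale_zero_right module_iff_vector_space)

lemma linear_add_fun:
  "Vector_Spaces.linear s t f \<Longrightarrow> Vector_Spaces.linear s t g \<Longrightarrow> Vector_Spaces.linear s t (\<lambda>x. f x + g x)"
  by (simp add: Vector_Spaces.linear_iff vector_space.vector_space_assms)

lemma linear_scale_fun:
  "Vector_Spaces.linear s t f \<Longrightarrow> Vector_Spaces.linear s t (\<lambda>x. t c (f x))"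
  by (simp add: Vector_Spaces.linear_iff vector_space.vector_space_assms mult.commute)

lemma linear_sum_fun:
  "vector_space s \<Longrightarrow> vector_space t \<Longrightarrow> (\<And>i. i \<in> I \<Longrightarrow> Vector_Spaces.linear s t (f i)) \<Longrightarrow>
    Vector_Spaces.linear s t (\<lambda>x. \<Sum>i\<in>I. f i x)"
  by (induction I rule: infinite_finite_induct) (auto simp: linear_zero_fun linear_add_fun)

lemma alternating_length: "alternating s t m f \<Longrightarrow> length xs \<noteq> m \<Longrightarrow> f xs = 0"
  and alternating_linear: "alternating s t m f \<Longrightarrow> length xs = m \<Longrightarrow> i < m \<Longrightarrow> Vector_Spaces.linear s t (\<lambda>y. f (xs[i := y]))"
  and alternating_repeat: "alternating s t m f \<Longrightarrow> i < j \<Longrightarrow> j < m \<Longrightarrow> xs ! i = xs ! j \<Longrightarrow> f xs = 0"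
  by (simp_all add: alternating_def) metis

lemma alternatingI:
  "(\<And>xs. length xs \<noteq> m \<Longrightarrow> f xs = 0) \<Longrightarrow>
   (\<And>xs i. length xs = m \<Longrightarrow> i < m \<Longrightarrow> Vector_Spaces.linear s t (\<lambda>y. f (xs[i := y]))) \<Longrightarrow>
   (\<And>xs i j. length xs = m \<Longrightarrow> i < j \<Longrightarrow> j < m \<Longrightarrow> xs ! i = xs ! j \<Longrightarrow> f xs = 0) \<Longrightarrow> alternating s t m f"
  by (simp add: alternating_def)

lemma alternating_zero: "vector_space s \<Longrightarrow> vector_space t \<Longrightarrow> alternating s t m (\<lambda>xs. 0)"
  by (simp add: alternating_def linear_zero_fun)

lemma alternating_add:
  "alternating s t m f \<Longrightarrow> alternating s t m g \<Longrightarrow> alternating s t m (\<lambda>xs. f xs + g xs)"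
  unfolding alternating_def by (simp add: linear_add_fun)

lemma alternating_compose:
  "alternating s t m f \<Longrightarrow> Vector_Spaces.linear t u g \<Longrightarrow> alternating s u m (\<lambda>xs. g (f xs))"
  by (rule alternatingI)
    (auto simp: linear_apply_zero alternating_length alternating_repeat intro: linear_compose_fun alternating_linear)

lemma alternating_scale:
  "vector_space t \<Longrightarrow> alternating s t m f \<Longrightarrow> alternating s t m (\<lambda>xs. t c (f xs))"
  by (erule alternating_compose) (simp add: vector_space.linear_scale_self)

lemma alternating_sum:
  "vector_space s \<Longrightarrow> vector_space t \<Longrightarrow> (\<And>i. i \<in> I \<Longrightarrow> alternating s t m (f i)) \<Longrightarrow>
    alternating s t m (\<lambda>xs. \<Sum>i\<in>I. f i xs)"
  by (induction I rule: infinite_finite_induct) (auto simp: alternating_zero alternating_add)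

text \<open>Polarisation: expand the value with \<open>a + b\<close> in both places.\<close>

lemma alternating_swap:
  assumes f: "alternating s t m f" and "length xs = m" "i < j" "j < m"
  shows "f (xs[i := a, j := b]) = - f (xs[i := b, j := a])"
proof -
  have rep: "f (xs[i := c, j := c]) = 0" for c
    using alternating_repeat[OF f assms(3,4)] assms by simp
  have i: "f (xs[i := a + b, j := c]) = f (xs[i := a, j := c]) + f (xs[i := b, j := c])" for c
    using linear_apply_add[OF alternating_linear[OF f, of "xs[j := c]" i]] assms
    by (simp add: list_update_swap)
  have j: "f (xs[i := c, j := a + b]) = f (xs[i := c, j := a]) + f (xs[i := c, j := b])" for c
    using linear_apply_add[OF alternating_linear[OF f, of "xs[i := c]" j]] assms by simp
  have "0 = f (xs[i := a, j := b]) + f (xs[i := b, j := a])"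
    using rep[of "a + b"] by (simp add: i j rep[of a] rep[of b] add.commute)
  then show ?thesis by (metis eq_neg_iff_add_eq_0)
qed

text \<open>If the entries at \<open>i\<close> and \<open>j\<close> agree, a summand acting
  elsewhere keeps the repetition and vanishes, while those acting at \<open>i\<close> and at
  \<open>j\<close> differ by a swap and cancel. This is how a cochain of degree \<open>0\<close>
  acts on an alternating group of vectors.\<close>

lemma alternating_derivation:
  assumes f: "alternating s t m f" and T: "Vector_Spaces.linear s s T"
  shows "alternating s t m (\<lambda>xs. \<Sum>l<m. f (xs[l := T (xs ! l)]))"
proof (rule alternatingI)
  fix xs :: "'b list" and i assume xs: "length xs = m" "i < m"
  have vs: "vector_space s" "vector_space t"
    using alternating_linear[OF f xs] by (auto simp: Vector_Spaces.linear_iff)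
  show "Vector_Spaces.linear s t (\<lambda>y. \<Sum>l<m. f (xs[i := y, l := T (xs[i := y] ! l)]))"
  proof (rule linear_sum_fun[OF vs])
    fix l assume "l \<in> {..<m}"
    show "Vector_Spaces.linear s t (\<lambda>y. f (xs[i := y, l := T (xs[i := y] ! l)]))"
    proof (cases "l = i")
      case True
      then show ?thesis
        using linear_compose_fun[OF T alternating_linear[OF f xs]] xs by simp
    next
      case False
      then show ?thesis
        using alternating_linear[OF f, of "xs[l := T (xs ! l)]" i] xs
        by (simp add: list_update_swap)
    qed
  qed
next
  fix xs :: "'b list" and i j assume ij: "length xs = m" "i < j" "j < m" "xs ! i = xs ! j"
  have "f (xs[l := T (xs ! l)]) = 0" if "l \<notin> {i, j}" for l
    by (rule alternating_repeat[OF f ij(2,3)]) (use that ij in auto)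
  then have "(\<Sum>l<m. f (xs[l := T (xs ! l)])) = (\<Sum>l\<in>{i, j}. f (xs[l := T (xs ! l)]))"
    by (intro sum.mono_neutral_right) (use ij in auto)
  also have "\<dots> = f (xs[i := T (xs ! i), j := xs ! i]) + f (xs[i := xs ! i, j := T (xs ! i)])"
  proof -
    have 1: "xs[i := T (xs ! i), j := xs ! i] = xs[i := T (xs ! i)]"
      by (subst list_update_swap) (use ij in auto)
    have 2: "xs[j := T (xs ! i)] = xs[j := T (xs ! j)]"
      by (simp add: ij(4))
    show ?thesis using ij(2) by (simp add: 1 2)
  qed
  also have "\<dots> = 0"
    using alternating_swap[OF f ij(1-3)] by simp
  finally show "(\<Sum>l<m. f (xs[l := T (xs ! l)])) = 0" .
qed (use f in \<open>simp add: alternating_length\<close>)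

lemma alternating_snoc:
  assumes f: "alternating s t (Suc m) f"
  shows "alternating s t m (\<lambda>xs. f (xs @ [x]))"
proof (rule alternatingI)
  fix xs :: "'b list" and i assume "length xs = m" "i < m"
  then show "Vector_Spaces.linear s t (\<lambda>y. f (xs[i := y] @ [x]))"
    using alternating_linear[OF f, of "xs @ [x]" i] by (simp add: list_update_append)
next
  fix xs :: "'b list" and i j assume "length xs = m" "i < j" "j < m" "xs ! i = xs ! j"
  then show "f (xs @ [x]) = 0"
    by (intro alternating_repeat[OF f, of i j]) (auto simp: nth_append)
qed (use f in \<open>simp add: alternating_length\<close>)

lemma alternating_linear_last:
  assumes "alternating s t (Suc m) f" "length xs = m"
  shows "Vector_Spaces.linear s t (\<lambda>x. f (xs @ [x]))"
proof -
  have "(xs @ [0])[m := x] = xs @ [x]" for x using assms(2) by (simp add: list_update_append)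
  then show ?thesis using alternating_linear[OF assms(1), of "xs @ [0]" m] assms(2) by simp
qed


section \<open>Cochains described through their first block\<close>

lemma cochains_vanish: "P \<in> cochains n s p \<Longrightarrow> \<not> blocks n p Xs \<Longrightarrow> P Xs x = 0"
  by (simp add: cochains_def)

lemma cochains_alternating_block:
  "P \<in> cochains n s p \<Longrightarrow> blocks n p Xs \<Longrightarrow> j < p - 1 \<Longrightarrow> alternating s s (n - 1) (\<lambda>Y. P (Xs[j := Y]) x)"
  by (simp add: cochains_def)

lemma cochains_alternating_last:
  "P \<in> cochains n s (Suc p) \<Longrightarrow> blocks n (Suc p) Xs \<Longrightarrow> alternating s s n (\<lambda>zs. P (Xs[p := butlast zs]) (last zs))"
  by (simp add: cochains_def)

lemma cochains_0_iff:
  "P \<in> cochains n s 0 \<longleftrightarrow> (\<forall>Xs x. Xs \<noteq> [] \<longrightarrow> P Xs x = 0) \<and> Vector_Spaces.linear s s (P [])"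
  by (auto simp: cochains_def blocks_def)

lemma cochains_1_iff:
  "P \<in> cochains n s (Suc 0) \<longleftrightarrow> (\<forall>Xs x. \<not> blocks n 1 Xs \<longrightarrow> P Xs x = 0) \<and>
    alternating s s n (\<lambda>zs. P [butlast zs] (last zs))"
proof -
  have "(\<forall>Xs. blocks n 1 Xs \<longrightarrow> alternating s s n (\<lambda>zs. P (Xs[0 := butlast zs]) (last zs))) \<longleftrightarrow>
    alternating s s n (\<lambda>zs. P [butlast zs] (last zs))" (is "?l \<longleftrightarrow> ?r")
  proof
    assume ?l
    then show ?r
      \<comment> \<open>A dummy block of the right length; it is overwritten by
        \<open>butlast zs\<close>.\<close>
      by (auto dest!: spec[of _ "[replicate (n - 1) 0]"] simp: blocks_def)
  next
    assume ?r
    then show ?l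
      by (auto simp: blocks_def length_Suc_conv)
  qed
  then show ?thesis by (simp add: cochains_def)
qed

lemma blocks_Suc_Cons: "blocks n (Suc p) (X # Xs) \<longleftrightarrow> length X = n - 1 \<and> blocks n p Xs"
  by (auto simp: blocks_def)

context vector_space
begin

lemma alternating_self_zero: "alternating scale scale m (\<lambda>xs. 0)"
  and linear_self_zero: "Vector_Spaces.linear scale scale (\<lambda>x. 0)"
  using vector_space_axioms by (simp_all add: alternating_zero linear_zero_fun)

lemma cochains_zero: "(\<lambda>Xs x. 0) \<in> cochains n scale p"
  by (simp add: cochains_def alternating_self_zero linear_self_zero)

lemma cochains_add:
  "P \<in> cochains n scale p \<Longrightarrow> Q \<in> cochains n scale p \<Longrightarrow> (\<lambda>Xs x. P Xs x + Q Xs x) \<in> cochains n scale p"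
  by (simp add: cochains_def alternating_add linear_add_fun)

lemma cochains_scale:
  "P \<in> cochains n scale p \<Longrightarrow> (\<lambda>Xs x. scale c (P Xs x)) \<in> cochains n scale p"
  unfolding cochains_def using vector_space_axioms
  by (auto intro!: alternating_scale linear_scale_fun)

lemma cochains_sum:
  "(\<And>i. i \<in> I \<Longrightarrow> P i \<in> cochains n scale p) \<Longrightarrow> (\<lambda>Xs x. \<Sum>i\<in>I. P i Xs x) \<in> cochains n scale p"
  by (induction I rule: infinite_finite_induct) (simp_all add: cochains_zero cochains_add)

text \<open>From degree \<open>2\<close> on, the first block is separate from the last alternating
  group, so its alternation and the conditions on the contraction together are the whole condition.
  In degree \<open>1\<close> the block and the final vector form one group, and no such splitting is
  available.\<close>

lemma cochains_Suc_Suc_iff: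
  "P \<in> cochains n scale (Suc (Suc p)) \<longleftrightarrow> (\<forall>x. P [] x = 0) \<and>
    (\<forall>X. (\<lambda>Ys. P (X # Ys)) \<in> cochains n scale (Suc p)) \<and>
    (\<forall>Ys x. alternating scale scale (n - 1) (\<lambda>X. P (X # Ys) x))" (is "?l \<longleftrightarrow> ?r")
proof
  assume P: ?l
  have hd: "alternating scale scale (n - 1) (\<lambda>X. P (X # Ys) x)" for Ys x
  proof (cases "blocks n (Suc p) Ys")
    case True
    then have "blocks n (Suc (Suc p)) (replicate (n - 1) 0 # Ys)"
      by (simp add: blocks_Suc_Cons)
    then have "alternating scale scale (n - 1) (\<lambda>Y. P ((replicate (n - 1) 0 # Ys)[0 := Y]) x)"
      by (intro cochains_alternating_block[OF P]) simp_all
    then show ?thesis by simp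
  next
    case False
    then show ?thesis
      by (simp add: cochains_vanish[OF P] blocks_Suc_Cons alternating_self_zero)
  qed
  have "(\<lambda>Ys. P (X # Ys)) \<in> cochains n scale (Suc p)" for X
  proof (cases "length X = n - 1")
    case True
    have "(\<forall>x. \<forall>j<p. alternating scale scale (n - 1) (\<lambda>Y. P (X # Ys[j := Y]) x)) \<and>
        alternating scale scale n (\<lambda>zs. P (X # Ys[p := butlast zs]) (last zs))" if "blocks n (Suc p) Ys" for Ys
    proof -
      have "blocks n (Suc (Suc p)) (X # Ys)" using that True by (simp add: blocks_Suc_Cons)
      from cochains_alternating_block[OF P this, of "Suc _"] cochains_alternating_last[OF P this]
      show ?thesis by simp
    qed
    then show ?thesis
      using P True by (simp add: cochains_def blocks_Suc_Cons)
  next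
    case False
    then show ?thesis
    proof -
      have "(\<lambda>Ys. P (X # Ys)) = (\<lambda>Ys x. 0)"
        using False by (simp add: fun_eq_iff cochains_vanish[OF P] blocks_Suc_Cons)
      then show ?thesis by (simp add: cochains_zero)
    qed
  qed
  then show ?r using hd P by (auto simp: cochains_vanish blocks_def)
next
  assume r: ?r
  have "P Xs x = 0" if "\<not> blocks n (Suc (Suc p)) Xs" for Xs x
  proof (cases Xs)
    case (Cons X Ys)
    show ?thesis
    proof (cases "length X = n - 1")
      case True
      then show ?thesis
        using that Cons r cochains_vanish[of "\<lambda>Ys. P (X # Ys)" n scale "Suc p" Ys x]
        by (simp add: blocks_Suc_Cons)
    next
      case False
      then show ?thesis
        using r Cons alternating_length by blast
    qed
  qed (use r in simp)
  moreover have "(\<forall>x. \<forall>j<Suc p. alternating scale scale (n - 1) (\<lambda>Y. P (Xs[j := Y]) x)) \<and>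
        alternating scale scale n (\<lambda>zs. P (Xs[Suc p := butlast zs]) (last zs))"
    if b: "blocks n (Suc (Suc p)) Xs" for Xs
  proof -
    obtain X Ys where Xs: "Xs = X # Ys" "blocks n (Suc p) Ys"
      using b by (cases Xs) (auto simp: blocks_def)
    then have "(\<forall>x. \<forall>j<p. alternating scale scale (n - 1) (\<lambda>Y. P (X # Ys[j := Y]) x)) \<and>
        alternating scale scale n (\<lambda>zs. P (X # Ys[p := butlast zs]) (last zs))"
      using r by (simp add: cochains_def)
    then show ?thesis
      using r unfolding Xs(1) by (auto simp: less_Suc_eq_0_disj)
  qed
  ultimately show ?l by (simp add: cochains_def)
qed

lemma cochains_1_linear:
  assumes P: "P \<in> cochains n scale (Suc 0)" and "n \<ge> 1"
  shows "Vector_Spaces.linear scale scale (P [X])"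
proof (cases "length X = n - 1")
  case True
  have "alternating scale scale (Suc (n - 1)) (\<lambda>zs. P [butlast zs] (last zs))"
    using P assms by (simp add: cochains_1_iff)
  from alternating_linear_last[OF this True] show ?thesis by simp
next
  case False
  then have "P [X] = (\<lambda>x. 0)"
    by (simp add: fun_eq_iff cochains_vanish[OF P] blocks_def)
  then show ?thesis by (simp add: linear_self_zero)
qed

lemma cochains_Cons:
  assumes "P \<in> cochains n scale (Suc p)" "n \<ge> 1"
  shows "(\<lambda>Ys. P (X # Ys)) \<in> cochains n scale p"
proof (cases p)
  case 0
  then show ?thesis
    using assms cochains_1_linear
    by (simp add: cochains_0_iff cochains_vanish[OF assms(1)] blocks_def)
next
  case (Suc p')
  then show ?thesis using assms by (simp add: cochains_Suc_Suc_iff)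
qed

text \<open>In degree \<open>1\<close> the block belongs to the joint group of \<open>n\<close>
  vectors, and fixing the final vector leaves an alternating map of the block.\<close>

lemma cochains_alternating_hd:
  assumes "P \<in> cochains n scale (Suc p)" "n \<ge> 1"
  shows "alternating scale scale (n - 1) (\<lambda>X. P (X # Ys) x)"
proof (cases "p = 0 \<and> Ys = []")
  case True
  then have "alternating scale scale (Suc (n - 1)) (\<lambda>zs. P [butlast zs] (last zs))"
    using assms by (simp add: cochains_1_iff)
  from alternating_snoc[OF this, of x] show ?thesis using True by simp
next
  case False
  show ?thesis
  proof (cases p)
    case 0
    then have "P (X # Ys) x = 0" for X
      using False by (intro cochains_vanish[OF assms(1)]) (simp add: blocks_def)
    then show ?thesis by (simp add: alternating_self_zero)
  next
    case (Suc p')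
    then show ?thesis using assms by (simp add: cochains_Suc_Suc_iff)
  qed
qed

lemma multilinear_cochainI:
  assumes "Vector_Spaces.linear scale scale (P [])"
    and Cons: "\<And>X. multilinear_cochain n scale (\<lambda>Ys. P (X # Ys))"
    and hd: "\<And>Ys x. alternating scale scale (n - 1) (\<lambda>X. P (X # Ys) x)"
  shows "multilinear_cochain n scale P"
  unfolding multilinear_cochain_def
proof (intro conjI allI impI)
  fix Xs :: "'b list list" and x assume "\<not> (\<forall>X\<in>set Xs. length X = n - 1)"
  then show "P Xs x = 0"
    using Cons alternating_length[OF hd]
    by (cases Xs) (simp_all add: multilinear_cochain_def, blast)
next
  fix Xs show "Vector_Spaces.linear scale scale (P Xs)"
    using assms(1) multilinear_cochain_linear_last[OF Cons] by (cases Xs) auto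
next
  fix Ys Zs :: "'b list list" and X :: "'b list" and i x assume i: "i < length X"
  show "Vector_Spaces.linear scale scale (\<lambda>v. P (Ys @ X[i := v] # Zs) x)"
  proof (cases Ys)
    case Nil
    then show ?thesis
      using i alternating_linear[OF hd, of X i Zs x] alternating_length[OF hd, of _ Zs x] linear_self_zero
      by (cases "length X = n - 1") auto
  next
    case (Cons Y Ys')
    then show ?thesis
      using multilinear_cochain_linear_block[OF assms(2) i] by simp
  qed
qed

lemma cochains_imp_multilinear:
  "P \<in> cochains n scale p \<Longrightarrow> n \<ge> 1 \<Longrightarrow> multilinear_cochain n scale P"
proof (induction p arbitrary: P)
  case 0
  have P: "P (Y # Ys) = (\<lambda>x. 0)" for Y Ys using 0 by (simp add: cochains_0_iff fun_eq_iff)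
  show ?case
  proof (rule multilinear_cochainI)
    show "Vector_Spaces.linear scale scale (P [])" using 0(1) by (simp add: cochains_0_iff)
    show "multilinear_cochain n scale (\<lambda>Ys. P (X # Ys))" for X
      by (simp add: P multilinear_cochain_def linear_self_zero)
    show "alternating scale scale (n - 1) (\<lambda>X. P (X # Ys) x)" for Ys x
      by (simp add: P alternating_self_zero)
  qed
next
  case (Suc p)
  show ?case
  proof (rule multilinear_cochainI)
    have "P [] = (\<lambda>x. 0)" by (simp add: fun_eq_iff cochains_vanish[OF Suc.prems(1)] blocks_def)
    then show "Vector_Spaces.linear scale scale (P [])" by (simp add: linear_self_zero)
  qed (use Suc cochains_Cons cochains_alternating_hd in auto)
qed

text \<open>Here \<open>X\<close> is a parameter of the outer factor, later its contracted first
  block. Alternation in the parameter survives because \<open>circ_rec\<close> is linear in that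
  factor; the companion lemma for the inner factor uses multilinearity of \<open>P\<close>.\<close>

lemma alternating_circ_rec_left:
  "(\<And>Zs z. alternating scale scale m (\<lambda>X. P X Zs z)) \<Longrightarrow>
    alternating scale scale m (\<lambda>X. circ_rec n scale q (P X) Q Ys x)"
proof (induction Ys arbitrary: q P Q)
  case Nil
  then show ?case by (cases "q = 0") (simp_all add: alternating_self_zero)
next
  case (Cons Y Ys)
  have 1: "alternating scale scale m (\<lambda>X. circ_rec n scale q (\<lambda>Ys. P X (Y # Ys)) Q Ys x)"
    by (rule Cons.IH) (rule Cons.prems)
  show ?case
  proof (cases "q = 0")
    case True
    then show ?thesis
      using vector_space_axioms 1 Cons.prems by (simp add: alternating_add alternating_sum)
  next
    case False
    have "alternating scale scale m (\<lambda>X. circ_rec n scale (q - 1) (P X) (\<lambda>Ys. Q (Y # Ys)) Ys x)"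
      by (rule Cons.IH) (rule Cons.prems)
    with 1 False show ?thesis
      by (simp del: One_nat_def) (intro alternating_add alternating_scale vector_space_axioms)
  qed
qed

lemma alternating_circ_rec_right:
  "multilinear_cochain n scale P \<Longrightarrow> (\<And>Zs z. alternating scale scale m (\<lambda>X. Q X Zs z)) \<Longrightarrow>
    alternating scale scale m (\<lambda>X. circ_rec n scale q P (Q X) Ys x)"
proof (induction Ys arbitrary: q P Q)
  case Nil
  then show ?case
    by (cases "q = 0")
      (simp_all add: alternating_self_zero alternating_compose[OF _ multilinear_cochain_linear_last[OF Nil(1)]])
next
  case (Cons Y Ys)
  have 1: "alternating scale scale m (\<lambda>X. circ_rec n scale q (\<lambda>Ys. P (Y # Ys)) (Q X) Ys x)"
    using Cons.prems by (intro Cons.IH multilinear_cochain_Cons)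
  have 2: "alternating scale scale m (\<lambda>X. circ_rec n scale (q - 1) P (\<lambda>Ys. Q X (Y # Ys)) Ys x)"
    using Cons.prems by (intro Cons.IH)
  have 3: "alternating scale scale m (\<lambda>X. \<Sum>i<n - 1. P (Y[i := Q X [] (Y ! i)] # Ys) x)"
    using vector_space_axioms Cons.prems
    by (intro alternating_sum alternating_compose[OF _ multilinear_cochain_linear_hd[OF Cons.prems(1)]]) auto
  show ?case
    using 1 2 3
    by (cases "q = 0") (simp_all del: One_nat_def, (intro alternating_add alternating_scale vector_space_axioms; simp)+)
qed

lemma circ_rec_vanish_length:
  assumes "P \<in> cochains n scale p" "length Xs \<noteq> p + q"
  shows "circ_rec n scale q P Q Xs x = 0"
proof -
  have "circ_rec n scale q P Q Xs x = circ_rec n scale q (\<lambda>Ys y. 0) Q Xs x"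
    by (rule circ_rec_cong) (use assms(2) in \<open>auto simp: fun_eq_iff blocks_def intro!: cochains_vanish[OF assms(1)]\<close>)
  then show ?thesis by (simp add: circ_rec_zero_left)
qed

text \<open>Induction on the total degree via \<open>cochains_Suc_Suc_iff\<close>, which reaches the
  degrees from \<open>2\<close> on. Total degrees \<open>0\<close> and \<open>1\<close> are handled
  directly.\<close>

lemma circ_rec_in_cochains:
  assumes n: "n \<ge> 2"
  shows "P \<in> cochains n scale p \<Longrightarrow> Q \<in> cochains n scale q \<Longrightarrow> circ_rec n scale q P Q \<in> cochains n scale (p + q)"
proof (induction "p + q" arbitrary: p q P Q rule: less_induct)
  case less
  note P = less.prems(1) and Q = less.prems(2)
  have n1: "n \<ge> 1" using n by simp
  note ml = cochains_imp_multilinear[OF P n1]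
  consider "p = 0" "q = 0" | "p = Suc 0" "q = 0" | "p = 0" "q = Suc 0" | m where "p + q = Suc (Suc m)"
  proof (cases "p + q \<le> 1")
    case True
    then have "p = 0 \<and> q = 0 \<or> p = Suc 0 \<and> q = 0 \<or> p = 0 \<and> q = Suc 0" by arith
    then show ?thesis using that by blast
  next
    case False
    then have "p + q = Suc (Suc (p + q - 2))" by arith
    then show ?thesis by (rule that(4))
  qed
  then show ?case
  proof cases
    case 1
    then have "circ_rec n scale q P Q [] = (\<lambda>x. P [] (Q [] x))" by (simp add: fun_eq_iff)
    then show ?thesis
      using P Q 1 circ_rec_vanish_length[OF P, where q = q and Q = Q]
      by (auto simp: cochains_0_iff intro: linear_compose_fun)
  next
    case 2
    define f where "f = (\<lambda>zs. P [butlast zs] (last zs))"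
    have f: "alternating scale scale n f"
      using P 2 by (simp add: cochains_1_iff f_def)
    have T: "Vector_Spaces.linear scale scale (Q [])"
      using Q 2 by (simp add: cochains_0_iff)
    \<comment> \<open>The \<open>n - 1\<close> insertions into the block and the one into the final
      vector add up to the action of \<open>Q []\<close> on all \<open>n\<close> vectors.\<close>
    have eq: "circ_rec n scale q P Q [butlast zs] (last zs) = (\<Sum>l<n. f (zs[l := Q [] (zs ! l)]))"
      if "length zs = n" for zs
    proof -
      have "zs \<noteq> []" using that n1 by auto
      then obtain X x where zs: "zs = X @ [x]" by (metis append_butlast_last_id)
      have n: "n = Suc (length X)" using that zs by simp
      show ?thesis
        using zs 2 by (simp add: f_def n list_update_append nth_append)
    qed
    have bad: "circ_rec n scale q P Q Xs x = 0" if "\<not> blocks n 1 Xs" for Xs x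
    proof (cases "length Xs = p + q")
      case True
      then obtain X where "Xs = [X]" using 2 by (auto simp: length_Suc_conv)
      then show ?thesis
        using that 2 by (simp add: blocks_def cochains_vanish[OF P])
    qed (rule circ_rec_vanish_length[OF P])
    have "(\<lambda>zs. circ_rec n scale q P Q [butlast zs] (last zs)) = (\<lambda>zs. \<Sum>l<n. f (zs[l := Q [] (zs ! l)]))"
    proof
      fix zs :: "'b list"
      show "circ_rec n scale q P Q [butlast zs] (last zs) = (\<Sum>l<n. f (zs[l := Q [] (zs ! l)]))"
      proof (cases "length zs = n")
        case False
        moreover have "length (butlast zs) \<noteq> n - 1" using False n by (cases zs) auto
        ultimately show ?thesis
          using alternating_length[OF f] bad[of "[butlast zs]"] by (auto simp: blocks_def)
      qed (rule eq)
    qed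
    then have "alternating scale scale n (\<lambda>zs. circ_rec n scale q P Q [butlast zs] (last zs))"
      using alternating_derivation[OF f T] by simp
    then show ?thesis using bad 2 by (simp add: cochains_1_iff)
  next
    case 3
    have f: "alternating scale scale n (\<lambda>zs. P [] (Q [butlast zs] (last zs)))"
      using P Q 3 by (intro alternating_compose[where g = "P []" and t = scale]) (simp_all add: cochains_1_iff cochains_0_iff)
    have 1: "circ_rec n scale q P Q [X] x = P [] (Q [X] x)" for X x
      using 3 by simp
    have bad: "circ_rec n scale q P Q Xs x = 0" if "\<not> blocks n 1 Xs" for Xs x
    proof (cases "length Xs = p + q")
      case True
      then obtain X where "Xs = [X]" using 3 by (auto simp: length_Suc_conv)
      then show ?thesis
        using that 3 1 by (simp add: cochains_vanish[OF Q] linear_apply_zero[OF multilinear_cochain_linear_last[OF ml]]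
            del: circ_rec.simps)
    qed (rule circ_rec_vanish_length[OF P])
    show ?thesis using bad f 1 3 by (simp add: cochains_1_iff del: circ_rec.simps)
  next
    case 4
    \<comment> \<open>A cochain of degree \<open>0\<close> contracts to zero; this replaces the
      induction hypothesis, which would speak of degree \<open>p - 1\<close>.\<close>
    have P0: "P (X # Ys) x = 0" if "p = 0" for X Ys x
      using P that by (simp add: cochains_0_iff)
    have A: "circ_rec n scale q (\<lambda>Ys. P (X # Ys)) Q \<in> cochains n scale (Suc m)" for X
    proof (cases p)
      case 0
      then have "(\<lambda>Ys. P (X # Ys)) = (\<lambda>Ys y. 0)" by (simp add: fun_eq_iff P0)
      then have "circ_rec n scale q (\<lambda>Ys. P (X # Ys)) Q = (\<lambda>Xs x. 0)"
        by (intro ext) (simp add: circ_rec_zero_left)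
      then show ?thesis by (simp add: cochains_zero)
    next
      case (Suc p')
      then have "circ_rec n scale q (\<lambda>Ys. P (X # Ys)) Q \<in> cochains n scale (p' + q)"
        using P Q n1 by (intro less.hyps cochains_Cons) auto
      then show ?thesis using 4 Suc by simp
    qed
    have A': "alternating scale scale (n - 1) (\<lambda>X. circ_rec n scale q (\<lambda>Ys. P (X # Ys)) Q Ys x)" for Ys x
    proof (rule alternating_circ_rec_left)
      show "alternating scale scale (n - 1) (\<lambda>X. P (X # Zs) z)" for Zs z
        using P n1 by (cases p) (simp_all add: P0 alternating_self_zero cochains_alternating_hd del: One_nat_def)
    qed
    have B: "(\<lambda>Xs x. if q = 0 then \<Sum>i<n - 1. P (X[i := Q [] (X ! i)] # Xs) x
        else circ_rec n scale (q - 1) P (\<lambda>Ys. Q (X # Ys)) Xs x) \<in> cochains n scale (Suc m)" for X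
    proof (cases q)
      case 0
      then show ?thesis
        using P 4 n1 by (simp add: cochains_sum cochains_Cons)
    next
      case (Suc q')
      then have "circ_rec n scale q' P (\<lambda>Ys. Q (X # Ys)) \<in> cochains n scale (p + q')"
        using P Q n1 by (intro less.hyps cochains_Cons) auto
      then show ?thesis using 4 Suc by simp
    qed
    have B': "alternating scale scale (n - 1) (\<lambda>X. if q = 0 then \<Sum>i<n - 1. P (X[i := Q [] (X ! i)] # Ys) x
        else circ_rec n scale (q - 1) P (\<lambda>Ys. Q (X # Ys)) Ys x)" for Ys x
    proof (cases q)
      case 0
      \<comment> \<open>As \<open>q = 0\<close>, the degree of \<open>P\<close> is at least
        \<open>2\<close>; \<open>Q []\<close> acts as a derivation on its first block.\<close>
      have "alternating scale scale (n - 1) (\<lambda>X. P (X # Ys) x)"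
        using P 4 0 n1 by (intro cochains_alternating_hd) auto
      from alternating_derivation[OF this, of "Q []"] show ?thesis
        using Q 0 by (simp add: cochains_0_iff)
    next
      case (Suc q')
      have "alternating scale scale (n - 1) (\<lambda>X. circ_rec n scale q' P (\<lambda>Ys. Q (X # Ys)) Ys x)"
        using Q Suc n1 by (intro alternating_circ_rec_right[OF ml] cochains_alternating_hd) auto
      then show ?thesis using Suc by simp
    qed
    show ?thesis
      unfolding 4 cochains_Suc_Suc_iff circ_rec_Cons_fun
    proof (intro conjI allI)
      show "circ_rec n scale q P Q [] x = 0" for x
        by (rule circ_rec_vanish_length[OF P]) (use 4 in simp)
    next
      fix X
      show "(\<lambda>Xs x. scale ((- 1) ^ q) (circ_rec n scale q (\<lambda>Ys. P (X # Ys)) Q Xs x) +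
         (if q = 0 then \<Sum>i<n - 1. P (X[i := Q [] (X ! i)] # Xs) x
          else circ_rec n scale (q - 1) P (\<lambda>Ys. Q (X # Ys)) Xs x)) \<in> cochains n scale (Suc m)"
        by (intro cochains_add cochains_scale A B)
    next
      fix Ys x
      show "alternating scale scale (n - 1) (\<lambda>X. scale ((- 1) ^ q) (circ_rec n scale q (\<lambda>Ys. P (X # Ys)) Q Ys x) +
         (if q = 0 then \<Sum>i<n - 1. P (X[i := Q [] (X ! i)] # Ys) x
          else circ_rec n scale (q - 1) P (\<lambda>Ys. Q (X # Ys)) Ys x))"
        using vector_space_axioms by (intro alternating_add alternating_scale A' B')
    qed
  qed
qed

end


section \<open>Weights\<close>

text \<open>
  Permitting weights above \<open>1\<close>, carried by \<open>0\<close> alone, makes composition additive on weights without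
  case distinctions.
\<close>

definition weight_space :: "nat \<Rightarrow> ('g::zero \<times> 'v::zero) set"
  where "weight_space w = (if w = 0 then UNIV \<times> {0} else if w = 1 then {0} \<times> UNIV else {0})"

text \<open>The shift \<open>d\<close> absorbs the weight of contracted blocks: if the entries of
  \<open>X\<close> have total weight \<open>w\<close>, then contracting \<open>P\<close> with
  \<open>X\<close> raises its shift by \<open>w\<close>. Cochains of bidegree k(n-1)|0 have shift
  \<open>0\<close>.\<close>

definition weighted :: "nat \<Rightarrow> nat \<Rightarrow> ('g::zero \<times> 'v::zero) cochain \<Rightarrow> bool"
  where "weighted n d P \<longleftrightarrow> (\<forall>Xs x vs. (\<forall>X\<in>set Xs. length X = n - 1) \<longrightarrow>
    list_all2 (\<lambda>w z. z \<in> weight_space w) vs (concat Xs @ [x]) \<longrightarrow> P Xs x \<in> weight_space (d + sum_list vs))"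

lemma weight_space_zero: "0 \<in> weight_space w"
  by (simp add: weight_space_def zero_prod_def)

lemma weightedD:
  "weighted n d P \<Longrightarrow> (\<And>X. X \<in> set Xs \<Longrightarrow> length X = n - 1) \<Longrightarrow>
    list_all2 (\<lambda>w z. z \<in> weight_space w) vs (concat Xs @ [x]) \<Longrightarrow> P Xs x \<in> weight_space (d + sum_list vs)"
  unfolding weighted_def by blast

lemma weighted_Cons:
  assumes "weighted n d P" "length X = n - 1" "list_all2 (\<lambda>w z. z \<in> weight_space w) us X"
  shows "weighted n (d + sum_list us) (\<lambda>Ys. P (X # Ys))"
  unfolding weighted_def
proof (intro allI impI)
  fix Xs :: "('a \<times> 'b) list list" and x vs assume "\<forall>X\<in>set Xs. length X = n - 1"
    and "list_all2 (\<lambda>w z. z \<in> weight_space w) vs (concat Xs @ [x])"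
  then have "P (X # Xs) x \<in> weight_space (d + sum_list (us @ vs))"
    using assms by (intro weightedD[OF assms(1)]) (auto intro: list_all2_appendI)
  then show "P (X # Xs) x \<in> weight_space (d + sum_list us + sum_list vs)"
    by (simp add: add.assoc)
qed

lemma length_concat_blocks: "blocks n m Xs \<Longrightarrow> length (concat Xs) = m * (n - 1)"
  by (induction Xs arbitrary: m) (auto simp: blocks_def)

lemma multilinear_cochain_zero_entry:
  assumes "multilinear_cochain n s P" "0 \<in> set (concat Xs @ [x])"
  shows "P Xs x = 0"
proof (cases "x = 0")
  case True
  then show ?thesis using linear_apply_zero[OF multilinear_cochain_linear_last[OF assms(1)]] by simp
next
  case False
  then obtain X where "X \<in> set Xs" "0 \<in> set X" using assms(2) by auto
  then obtain Ys Zs i where "Xs = Ys @ X # Zs" "i < length X" "X ! i = 0"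
    by (metis in_set_conv_nth split_list)
  then show ?thesis
    using linear_apply_zero[OF multilinear_cochain_linear_block[OF assms(1), of i X Ys Zs x]]
    by (metis list_update_id)
qed

context vector_space_prod
begin

lemma weight_space_add:
  fixes x y :: "'b \<times> 'c"
  shows "x \<in> weight_space w \<Longrightarrow> y \<in> weight_space w \<Longrightarrow> x + y \<in> weight_space w"
  by (auto simp: weight_space_def split: if_splits)

lemma weight_space_scale: "x \<in> weight_space w \<Longrightarrow> scale c x \<in> weight_space w"
  by (auto simp: weight_space_def scale_def zero_prod_def split: if_splits)

lemma weight_space_sum:
  fixes f :: "'i \<Rightarrow> 'b \<times> 'c"
  shows "(\<And>i. i \<in> I \<Longrightarrow> f i \<in> weight_space w) \<Longrightarrow> sum f I \<in> weight_space w"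
  by (induction I rule: infinite_finite_induct) (auto simp: weight_space_zero weight_space_add)

text \<open>\<open>Q\<close> raises the total weight of its arguments by \<open>e\<close> and
  \<open>P\<close> that of its own by \<open>d\<close>, wherever the value of \<open>Q\<close> is
  put. The induction varies both shifts, as each contraction adds the weight of its block.\<close>

lemma circ_rec_weighted:
  assumes "weighted n d P" "weighted n e Q"
  shows "weighted n (d + e) (circ_rec n scale q P Q)"
proof -
  have "circ_rec n scale q P Q Xs x \<in> weight_space (d + e + sum_list vs)"
    if "weighted n d P" "weighted n e Q" "\<forall>X\<in>set Xs. length X = n - 1"
      "list_all2 (\<lambda>w z. z \<in> weight_space w) vs (concat Xs @ [x])" for Xs vs x
    using that
  proof (induction Xs arbitrary: d e q P Q vs)
    case Nil
    have Q: "Q [] x \<in> weight_space (e + sum_list vs)"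
      using Nil by (intro weightedD[OF Nil(2)]) auto
    have "P [] (Q [] x) \<in> weight_space (d + sum_list [e + sum_list vs])"
      using Q by (intro weightedD[OF Nil(1)]) auto
    then show ?case by (simp add: weight_space_zero add.assoc)
  next
    case (Cons X Xs)
    obtain us vs' where vs: "vs = us @ vs'" and us: "list_all2 (\<lambda>w z. z \<in> weight_space w) us X"
      and vs': "list_all2 (\<lambda>w z. z \<in> weight_space w) vs' (concat Xs @ [x])"
      using Cons.prems(4) by (auto simp: list_all2_append2)
    have X: "length X = n - 1" and Xs: "\<forall>X\<in>set Xs. length X = n - 1" using Cons.prems(3) by auto
    have A: "circ_rec n scale q (\<lambda>Ys. P (X # Ys)) Q Xs x \<in> weight_space (d + sum_list us + e + sum_list vs')"
      by (intro Cons.IH weighted_Cons Cons.prems X Xs us vs')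
    have B: "circ_rec n scale (q - 1) P (\<lambda>Ys. Q (X # Ys)) Xs x \<in> weight_space (d + (e + sum_list us) + sum_list vs')"
      by (intro Cons.IH weighted_Cons Cons.prems X Xs us vs')
    have C: "P (X[i := Q [] (X ! i)] # Xs) x \<in> weight_space (d + e + sum_list vs)" if "i < n - 1" for i
    proof -
      have len: "length us = n - 1" using us X by (simp add: list_all2_lengthD)
      have "X ! i \<in> weight_space (us ! i)" using us X that by (simp add: list_all2_conv_all_nth)
      then have "Q [] (X ! i) \<in> weight_space (e + sum_list [us ! i])"
        by (intro weightedD[OF Cons.prems(2)]) auto
      \<comment> \<open>The new weight \<open>e + us ! i\<close> may exceed \<open>1\<close>; the
        entry is then \<open>0\<close> and still has that weight.\<close>
      then have "list_all2 (\<lambda>w z. z \<in> weight_space w) (us[i := e + us ! i]) (X[i := Q [] (X ! i)])"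
        using us by (simp add: list_all2_update_cong)
      then have "P (X[i := Q [] (X ! i)] # Xs) x \<in> weight_space (d + sum_list (us[i := e + us ! i] @ vs'))"
        using vs' X Xs by (intro weightedD[OF Cons.prems(1)]) (auto intro: list_all2_appendI)
      moreover have "sum_list (us[i := e + us ! i]) = e + sum_list us"
        using that len elem_le_sum_list[of i us] by (simp add: sum_list_update)
      ultimately show ?thesis by (simp add: vs add_ac)
    qed
    show ?case
      using A B C by (auto simp: vs add_ac intro!: weight_space_add weight_space_scale weight_space_sum)
  qed
  then show ?thesis using assms by (simp add: weighted_def)
qed

section \<open>Bidegree in terms of weights\<close>

lemma bihomogeneous_args_weights:
  assumes "(Xs, x) \<in> bihomogeneous_args n m i j"
  obtains vs where "list_all2 (\<lambda>w z. z \<in> weight_space w) vs (concat Xs @ [x])" "sum_list vs = j"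
proof -
  define zs where "zs = concat Xs @ [x]"
  obtain I where I: "I \<subseteq> {..<length zs}" "card I = i" "length zs = i + j"
    "\<forall>a<length zs. if a \<in> I then snd (zs ! a) = 0 else fst (zs ! a) = 0"
    using assms by (auto simp: bihomogeneous_args_def zs_def Let_def)
  define vs where "vs = map (\<lambda>a. if a \<in> I then 0 else Suc 0) [0..<length zs]"
  have "list_all2 (\<lambda>w z. z \<in> weight_space w) vs zs"
    using I(4) by (auto simp: vs_def list_all2_conv_all_nth weight_space_def mem_Times_iff)
  moreover have "sum_list vs = j"
  proof -
    have "sum_list vs = (\<Sum>a<length zs. if a \<in> I then 0 else Suc 0)"
      by (simp add: vs_def sum_list_sum_nth atLeast0LessThan)
    also have "\<dots> = card ({..<length zs} - I)"
      by (simp add: sum.If_cases Diff_eq)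
    also have "\<dots> = j" using I by (simp add: card_Diff_subset finite_subset)
    finally show ?thesis .
  qed
  ultimately show ?thesis using that by (simp add: zs_def)
qed

lemma weights_bihomogeneous_args:
  assumes "list_all2 (\<lambda>w z. z \<in> weight_space w) vs (concat Xs @ [x])" "blocks n m Xs"
    "\<forall>v\<in>set vs. v \<le> 1"
  shows "\<exists>i. (Xs, x) \<in> bihomogeneous_args n m i (sum_list vs) \<and> i + sum_list vs = m * (n - 1) + 1"
proof -
  define zs where "zs = concat Xs @ [x]"
  have vz: "length vs = length zs" "\<And>a. a < length zs \<Longrightarrow> zs ! a \<in> weight_space (vs ! a)"
    using assms(1) by (auto simp: zs_def list_all2_conv_all_nth)
  define I where "I = {a. a < length zs \<and> vs ! a = 0}"
  have le: "vs ! a \<le> 1" if "a < length zs" for a using assms(3) vz(1) that by simp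
  have "sum_list vs = (\<Sum>a<length zs. if a \<in> I then 0 else 1)"
    unfolding sum_list_sum_nth vz(1) atLeast0LessThan
    using le by (intro sum.cong) (force simp: I_def)+
  also have "\<dots> = card ({..<length zs} - I)"
    by (simp add: sum.If_cases Diff_eq)
  finally have "card I + sum_list vs = length zs"
    using card_mono[of "{..<length zs}" I] by (simp add: card_Diff_subset I_def subset_eq)
  moreover have "length zs = m * (n - 1) + 1"
    using length_concat_blocks[OF assms(2)] by (simp add: zs_def)
  moreover have "if a \<in> I then snd (zs ! a) = 0 else fst (zs ! a) = 0" if "a < length zs" for a
    using vz(2)[OF that] le[OF that] that by (cases "vs ! a = 0") (auto simp: I_def weight_space_def le_Suc_eq)
  moreover have "I \<subseteq> {..<length zs}" by (auto simp: I_def)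
  ultimately have "(Xs, x) \<in> bihomogeneous_args n m (card I) (sum_list vs)"
    using assms(2) unfolding bihomogeneous_args_def Let_def mem_Collect_eq prod.case zs_def[symmetric]
    by (intro conjI exI[of _ I]) simp_all
  with \<open>card I + sum_list vs = length zs\<close> \<open>length zs = m * (n - 1) + 1\<close> show ?thesis by metis
qed

text \<open>For \<open>l = 0\<close> the number \<open>j\<close> of entries from V decides where the
  value must lie: in g for \<open>j = 0\<close>, in V for \<open>j = 1\<close>, and in the zero
  space otherwise. This is \<open>weight_space j\<close>.\<close>

lemma bidegree_cochains_eq:
  assumes n: "n \<ge> 2"
  shows "bidegree_cochains n s1 s2 (m * (n - 1)) 0 = {P \<in> cochains n scale m. weighted n 0 P}"
proof safe
  fix P assume P: "P \<in> bidegree_cochains n s1 s2 (m * (n - 1)) 0"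
  then obtain m' where m': "m * (n - 1) + 0 = m' * (n - 1)" "P \<in> cochains n scale m'"
    and a0: "\<forall>(Xs, x) \<in> bihomogeneous_args n m' (m * (n - 1) + 1) 0. P Xs x \<in> UNIV \<times> {0}"
    and a1: "\<forall>(Xs, x) \<in> bihomogeneous_args n m' (m * (n - 1)) (0 + 1). P Xs x \<in> {0} \<times> UNIV"
    and a2: "\<forall>i j. i + j = m' * (n - 1) + 1 \<longrightarrow> (i, j) \<noteq> (m * (n - 1) + 1, 0) \<longrightarrow> (i, j) \<noteq> (m * (n - 1), 0 + 1) \<longrightarrow>
      (\<forall>(Xs, x) \<in> bihomogeneous_args n m' i j. P Xs x = 0)"
    unfolding bidegree_cochains_def by blast
  have m: "m' = m" using m'(1) n by simp
  show Pm: "P \<in> cochains n scale m" using m' m by simp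
  have ml: "multilinear_cochain n scale P" using p.cochains_imp_multilinear[OF Pm] n by simp
  show "weighted n 0 P"
    unfolding weighted_def
  proof (intro allI impI)
    fix Xs :: "('b \<times> 'c) list list" and x vs assume X: "\<forall>X\<in>set Xs. length X = n - 1"
      and vs: "list_all2 (\<lambda>w z. z \<in> weight_space w) vs (concat Xs @ [x])"
    show "P Xs x \<in> weight_space (0 + sum_list vs)"
    \<comment> \<open>A weight above \<open>1\<close> forces a zero entry. The bidegree conditions
      do not see such weights, and multilinearity gives the value \<open>0\<close>.\<close>
    proof (cases "length Xs = m \<and> (\<forall>v\<in>set vs. v \<le> 1)")
      case True
      then have "blocks n m Xs" using X by (simp add: blocks_def)
      then obtain i where i: "(Xs, x) \<in> bihomogeneous_args n m i (sum_list vs)" "i + sum_list vs = m * (n - 1) + 1"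
        using weights_bihomogeneous_args[OF vs] True by blast
      consider "sum_list vs = 0" | "sum_list vs = 1" | "sum_list vs \<ge> 2" by linarith
      then show ?thesis
      proof cases
        case 1
        then have "(Xs, x) \<in> bihomogeneous_args n m' (m * (n - 1) + 1) 0" using i m by (metis add_0_right)
        with a0 have "P Xs x \<in> UNIV \<times> {0}" by fast
        then show ?thesis unfolding 1 by (simp add: weight_space_def)
      next
        case 2
        then show ?thesis using a1 i m by (auto simp: weight_space_def)
      next
        case 3
        then have "\<forall>(Xs, x)\<in>bihomogeneous_args n m' i (sum_list vs). P Xs x = 0"
          using i(2) m by (intro a2[THEN spec, THEN spec, THEN mp, THEN mp, THEN mp]) auto
        then have "P Xs x = 0" using i(1) m by auto
        then show ?thesis by (simp add: weight_space_zero)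
      qed
    next
      case False
      have "P Xs x = 0"
      proof (cases "length Xs = m")
        case True
        with False obtain v where "v \<in> set vs" "v \<ge> 2" by force
        then obtain a where "a < length vs" "vs ! a \<ge> 2" by (auto simp: in_set_conv_nth)
        then have "(concat Xs @ [x]) ! a = 0" "a < length (concat Xs @ [x])"
          using vs by (auto simp: list_all2_conv_all_nth weight_space_def split: if_splits)
        then have "0 \<in> set (concat Xs @ [x])" by (metis nth_mem)
        then show ?thesis by (rule multilinear_cochain_zero_entry[OF ml])
      next
        case False
        then show ?thesis by (intro cochains_vanish[OF Pm]) (simp add: blocks_def)
      qed
      then show ?thesis by (simp add: weight_space_zero)
    qed
  qed
next
  fix P assume P: "P \<in> cochains n scale m" "weighted n 0 P"
  have w: "P Xs x \<in> weight_space j" if b: "(Xs, x) \<in> bihomogeneous_args n m i j" for Xs x i j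
  proof -
    obtain vs where vs: "list_all2 (\<lambda>w z. z \<in> weight_space w) vs (concat Xs @ [x])" "sum_list vs = j"
      using bihomogeneous_args_weights[OF b] .
    have "P Xs x \<in> weight_space (0 + sum_list vs)"
      using b by (intro weightedD[OF P(2)] vs(1)) (simp add: bihomogeneous_args_def blocks_def)
    then show ?thesis by (simp add: vs(2))
  qed
  have z: "P Xs x = 0" if "(Xs, x) \<in> bihomogeneous_args n m i j" "j \<ge> 2" for Xs x i j
    using w[OF that(1)] that(2) by (simp add: weight_space_def)
  show "P \<in> bidegree_cochains n s1 s2 (m * (n - 1)) 0"
    unfolding bidegree_cochains_def
  proof (intro CollectI exI[of _ m] conjI allI impI)
    show "\<forall>(Xs, x)\<in>bihomogeneous_args n m (m * (n - 1) + 1) 0. P Xs x \<in> UNIV \<times> {0}"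
      using w by (fastforce simp: weight_space_def)
    show "\<forall>(Xs, x)\<in>bihomogeneous_args n m (m * (n - 1)) (0 + 1). P Xs x \<in> {0} \<times> UNIV"
      using w by (fastforce simp: weight_space_def)
    fix i j assume ij: "i + j = m * (n - 1) + 1" "(i, j) \<noteq> (m * (n - 1) + 1, 0)" "(i, j) \<noteq> (m * (n - 1), 0 + 1)"
    then have "j \<ge> 2" by (cases j; cases "j - 1") auto
    then show "\<forall>(Xs, x)\<in>bihomogeneous_args n m i j. P Xs x = 0" using z by blast
  qed (use P in auto)
qed

end


section \<open>The graded Lie algebra\<close>

lemma sum_fun_apply2: "(\<Sum>i\<in>I. f i) x y = (\<Sum>i\<in>I. f i x y :: 'b::ab_group_add)"
  by (induction I rule: infinite_finite_induct) auto

context vector_space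
begin

lemma circ_rec_vanish_right:
  assumes "multilinear_cochain n scale P" "Q \<in> cochains n scale q" "q' \<noteq> q"
  shows "circ_rec n scale q' P Q Xs x = 0"
proof -
  have "circ_rec n scale q' P Q Xs x = circ_rec n scale q' P (\<lambda>Ys y. 0) Xs x"
    by (rule circ_rec_cong) (use assms(3) in \<open>auto simp: fun_eq_iff blocks_def intro!: cochains_vanish[OF assms(2)]\<close>)
  then show ?thesis by (simp add: circ_rec_zero_right assms(1))
qed

lemma n_Lie_bracket_eq_circ_rec:
  "n_Lie_bracket n scale P Q Xs x = (\<Sum>p\<le>length Xs. circ_rec n scale (length Xs - p) P Q Xs x -
    scale ((- 1) ^ (p * (length Xs - p))) (circ_rec n scale p Q P Xs x))"
  unfolding n_Lie_bracket_def homogeneous_bracket_def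
  by (intro sum.cong) (simp_all add: circ_eq_circ_rec)

text \<open>In the sum over all splittings, the summand of any index other than \<open>p\<close>
  evaluates \<open>P\<close> on a wrong number of blocks in both composites. The summand
  \<open>p\<close> in turn vanishes unless there are \<open>p + q\<close> blocks.\<close>

lemma n_Lie_bracket_homogeneous:
  assumes P: "P \<in> cochains n scale p" and Q: "Q \<in> cochains n scale q" and n: "n \<ge> 1"
  shows "n_Lie_bracket n scale P Q = (\<lambda>Xs x. circ_rec n scale q P Q Xs x -
    scale ((- 1) ^ (p * q)) (circ_rec n scale p Q P Xs x))"
proof (intro ext)
  fix Xs x
  note mP = cochains_imp_multilinear[OF P n] and mQ = cochains_imp_multilinear[OF Q n]
  define F where "F = (\<lambda>p'. circ_rec n scale (length Xs - p') P Q Xs x -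
    scale ((- 1) ^ (p' * (length Xs - p'))) (circ_rec n scale p' Q P Xs x))"
  have F0: "F p' = 0" if "p' \<le> length Xs" "p' \<noteq> p" for p'
    using circ_rec_vanish_length[OF P, of Xs "length Xs - p'"] circ_rec_vanish_right[OF mQ P, of p'] that
    by (simp add: F_def)
  have len: "circ_rec n scale q P Q Xs x - scale ((- 1) ^ (p * q)) (circ_rec n scale p Q P Xs x) = 0"
    if "length Xs \<noteq> p + q"
    using circ_rec_vanish_length[OF P that] circ_rec_vanish_length[OF Q, of Xs p] that by simp
  have "n_Lie_bracket n scale P Q Xs x = (\<Sum>p'\<le>length Xs. F p')"
    by (simp add: n_Lie_bracket_eq_circ_rec F_def)
  also have "\<dots> = (\<Sum>p'\<le>length Xs. if p' = p then F p else 0)"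
    by (intro sum.cong) (simp_all add: F0)
  also have "\<dots> = (if p \<le> length Xs then F p else 0)" by simp
  also have "\<dots> = circ_rec n scale q P Q Xs x - scale ((- 1) ^ (p * q)) (circ_rec n scale p Q P Xs x)"
  proof (cases "length Xs = p + q")
    case False
    have "F p = 0" if "p \<le> length Xs"
      using circ_rec_vanish_right[OF mP Q, of "length Xs - p"] circ_rec_vanish_length[OF Q, of Xs p] False that
      by (simp add: F_def)
    then show ?thesis using len[OF False] by simp
  qed (simp add: F_def)
  finally show "n_Lie_bracket n scale P Q Xs x = circ_rec n scale q P Q Xs x -
    scale ((- 1) ^ (p * q)) (circ_rec n scale p Q P Xs x)" .
qed

lemma n_Lie_bracket_in_cochains:
  assumes P: "P \<in> cochains n scale p" and Q: "Q \<in> cochains n scale q" and n: "n \<ge> 2"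
  shows "n_Lie_bracket n scale P Q \<in> cochains n scale (p + q)"
proof -
  have "(\<lambda>Xs x. circ_rec n scale q P Q Xs x + scale (- ((- 1) ^ (p * q))) (circ_rec n scale p Q P Xs x))
      \<in> cochains n scale (p + q)"
    using circ_rec_in_cochains[OF n P Q] circ_rec_in_cochains[OF n Q P]
    by (intro cochains_add cochains_scale) (simp_all add: add.commute)
  then show ?thesis using n by (simp add: n_Lie_bracket_homogeneous[OF P Q])
qed

lemma n_Lie_bracket_skew:
  assumes P: "P \<in> cochains n scale p" and Q: "Q \<in> cochains n scale q" and n: "n \<ge> 1"
  shows "n_Lie_bracket n scale P Q = - cochain_scale scale ((- 1) ^ (p * q)) (n_Lie_bracket n scale Q P)"
  by (simp add: n_Lie_bracket_homogeneous[OF P Q n] n_Lie_bracket_homogeneous[OF Q P n] fun_eq_iff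
      cochain_scale_def scale_right_diff_distrib mult.commute)

text \<open>The three double brackets contain all twelve composites of \<open>P\<close>,
  \<open>Q\<close> and \<open>R\<close>, six for each bracketing. The pre-Lie identity, used once
  with each of the three as outer factor, cancels them.\<close>

lemma n_Lie_bracket_jacobi:
  assumes P: "P \<in> cochains n scale p" and Q: "Q \<in> cochains n scale q" and R: "R \<in> cochains n scale r"
    and n: "n \<ge> 2"
  shows "n_Lie_bracket n scale P (n_Lie_bracket n scale Q R) =
    n_Lie_bracket n scale (n_Lie_bracket n scale P Q) R +
    cochain_scale scale ((- 1) ^ (p * q)) (n_Lie_bracket n scale Q (n_Lie_bracket n scale P R))"
proof (intro ext)
  fix Xs x
  have n1: "n \<ge> 1" using n by simp
  note ml = cochains_imp_multilinear[OF _ n1]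
  note br = n_Lie_bracket_homogeneous[OF _ _ n1] and closed = n_Lie_bracket_in_cochains[OF _ _ n]
  define \<alpha> \<beta> \<gamma> where "\<alpha> = ((- 1) ^ (p * q) :: 'a)" and "\<beta> = ((- 1) ^ (p * r) :: 'a)" and "\<gamma> = ((- 1) ^ (q * r) :: 'a)"
  have sq: "\<alpha> * \<alpha> = 1" "\<beta> * \<beta> = 1" "\<gamma> * \<gamma> = 1" by (simp_all add: \<alpha>_def \<beta>_def \<gamma>_def)
  have pw: "(- 1) ^ (p * (q + r)) = \<alpha> * \<beta>" "(- 1) ^ ((p + q) * r) = \<beta> * \<gamma>" "(- 1) ^ (q * (p + r)) = \<alpha> * \<gamma>"
    by (simp_all add: \<alpha>_def \<beta>_def \<gamma>_def power_add distrib_left distrib_right mult.commute)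
  \<comment> \<open>\<open>a\<close> is bracketed to the left and \<open>d\<close> to the right;
    \<alpha>, \<beta>, \<gamma> are the signs of exchanging \<open>P\<close> with \<open>Q\<close>,
    \<open>P\<close> with \<open>R\<close>, and \<open>Q\<close> with \<open>R\<close>.\<close>
  define a where "a A B C b c = circ_rec n scale c (circ_rec n scale b A B) C Xs x" for A B C b c
  define d where "d A B C b c = circ_rec n scale (b + c) A (circ_rec n scale c B C) Xs x" for A B C b c
  \<comment> \<open>The pre-Lie identity solved for one left-bracketed composite per outer factor,
    ready for use as rewriting rules.\<close>
  have S: "a P Q R q r = d P Q R q r + scale \<gamma> (a P R Q r q - d P R Q r q)"
    "a Q P R p r = d Q P R p r + scale \<beta> (a Q R P r p - d Q R P r p)"
    "a R P Q p q = d R P Q p q + scale \<alpha> (a R Q P q p - d R Q P q p)"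
    using circ_associator_swap[OF ml[OF P], of q r Q R Xs x] circ_associator_swap[OF ml[OF Q], of p r P R Xs x]
      circ_associator_swap[OF ml[OF R], of p q P Q Xs x]
    by (simp_all add: circ_associator_def a_def d_def \<alpha>_def \<beta>_def \<gamma>_def algebra_simps)
  have L: "n_Lie_bracket n scale P (n_Lie_bracket n scale Q R) Xs x =
    d P Q R q r - scale \<gamma> (d P R Q r q) - scale (\<alpha> * \<beta>) (a Q R P r p - scale \<gamma> (a R Q P q p))"
    \<comment> \<open>The outer bracket is expanded while the inner one is still folded, since
      \<open>closed\<close> gives the degree of the folded form.\<close>
    unfolding br[OF P closed[OF Q R]] unfolding br[OF Q R]
    by (simp add: circ_rec_linear(2-) ml[OF P] pw flip: \<gamma>_def) (simp add: a_def d_def add.commute)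
  have R1: "n_Lie_bracket n scale (n_Lie_bracket n scale P Q) R Xs x =
    a P Q R q r - scale \<alpha> (a Q P R p r) - scale (\<beta> * \<gamma>) (d R P Q p q - scale \<alpha> (d R Q P q p))"
    unfolding br[OF closed[OF P Q] R] unfolding br[OF P Q]
    by (simp add: circ_rec_linear(2-) ml[OF R] pw flip: \<alpha>_def) (simp add: a_def d_def add.commute)
  have R2: "n_Lie_bracket n scale Q (n_Lie_bracket n scale P R) Xs x =
    d Q P R p r - scale \<beta> (d Q R P r p) - scale (\<alpha> * \<gamma>) (a P R Q r q - scale \<beta> (a R P Q p q))"
    unfolding br[OF Q closed[OF P R]] unfolding br[OF P R]
    by (simp add: circ_rec_linear(2-) ml[OF Q] pw flip: \<beta>_def) (simp add: a_def d_def add.commute)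
  have sq': "\<alpha> * (\<alpha> * z) = z" "\<beta> * (\<beta> * z) = z" "\<gamma> * (\<gamma> * z) = z" for z
    using sq by (simp_all flip: mult.assoc)
  show "n_Lie_bracket n scale P (n_Lie_bracket n scale Q R) Xs x =
    (n_Lie_bracket n scale (n_Lie_bracket n scale P Q) R +
    cochain_scale scale ((- 1) ^ (p * q)) (n_Lie_bracket n scale Q (n_Lie_bracket n scale P R))) Xs x"
    unfolding \<alpha>_def[symmetric] plus_fun_apply cochain_scale_def L R1 R2 S
    by (simp add: algebra_simps sq sq')
qed

section \<open>The bracket on the direct sum of all degrees\<close>

lemma vector_space_cochain_scale: "vector_space (cochain_scale scale)"
  by unfold_locales (auto simp: cochain_scale_def fun_eq_iff scale_right_distrib scale_left_distrib)

text \<open>\<open>circ_rec\<close> is linear in the inner factor when the outer one is multilinear.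
  The varying argument is inner exactly where the fixed \<open>Q\<close> is outer, hence the
  hypothesis on \<open>Q\<close>.\<close>

lemma n_Lie_bracket_bilinear:
  assumes Q: "multilinear_cochain n scale Q"
  shows "n_Lie_bracket n scale (P + P') Q = n_Lie_bracket n scale P Q + n_Lie_bracket n scale P' Q"
    and "n_Lie_bracket n scale Q (P + P') = n_Lie_bracket n scale Q P + n_Lie_bracket n scale Q P'"
    and "n_Lie_bracket n scale (cochain_scale scale c P) Q = cochain_scale scale c (n_Lie_bracket n scale P Q)"
    and "n_Lie_bracket n scale Q (cochain_scale scale c P) = cochain_scale scale c (n_Lie_bracket n scale Q P)"
proof -
  have add: "P + P' = (\<lambda>Xs x. P Xs x + P' Xs x)" by (simp add: fun_eq_iff)
  show "n_Lie_bracket n scale (P + P') Q = n_Lie_bracket n scale P Q + n_Lie_bracket n scale P' Q"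
    by (simp add: fun_eq_iff n_Lie_bracket_eq_circ_rec add circ_rec_add_left circ_rec_add_right[OF Q]
        algebra_simps flip: sum.distrib)
  show "n_Lie_bracket n scale Q (P + P') = n_Lie_bracket n scale Q P + n_Lie_bracket n scale Q P'"
    by (simp add: fun_eq_iff n_Lie_bracket_eq_circ_rec add circ_rec_add_left circ_rec_add_right[OF Q]
        algebra_simps flip: sum.distrib)
  show "n_Lie_bracket n scale (cochain_scale scale c P) Q = cochain_scale scale c (n_Lie_bracket n scale P Q)"
    by (simp add: fun_eq_iff n_Lie_bracket_eq_circ_rec cochain_scale_def circ_rec_scale_left
        circ_rec_scale_right[OF Q] scale_sum_right scale_right_diff_distrib mult.commute)
  show "n_Lie_bracket n scale Q (cochain_scale scale c P) = cochain_scale scale c (n_Lie_bracket n scale Q P)"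
    by (simp add: fun_eq_iff n_Lie_bracket_eq_circ_rec cochain_scale_def circ_rec_scale_left
        circ_rec_scale_right[OF Q] scale_sum_right scale_right_diff_distrib mult.commute)
qed

text \<open>The bilinearity axioms of \<open>graded_lie_algebra\<close> concern the span of all
  components; this subspace contains that span.\<close>

lemma subspace_multilinear_cochain:
  "module.subspace (cochain_scale scale) {P. multilinear_cochain n scale P}"
proof -
  interpret c: vector_space "cochain_scale scale" by (rule vector_space_cochain_scale)
  show ?thesis
    by (auto simp: c.subspace_def multilinear_cochain_def cochain_scale_def linear_self_zero
        linear_add_fun[where s = scale and t = scale] linear_scale_fun[where s = scale and t = scale] plus_fun_def zero_fun_def)
qed

end

context vector_space_prod
begin

lemma weighted_linear:
  assumes "weighted n d P" "weighted n d Q"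
  shows "weighted n d (\<lambda>Xs x. P Xs x + scale c (Q Xs x))"
  using assms unfolding weighted_def by (blast intro: weight_space_add weight_space_scale)

lemma graded_lie_algebra_weighted:
  assumes n: "n \<ge> 2"
  shows "graded_lie_algebra (cochain_scale scale) (\<lambda>p. {P \<in> cochains n scale p. weighted n 0 P}) (n_Lie_bracket n scale)"
proof -
  define L where "L = (\<lambda>p. {P \<in> cochains n scale p. weighted n 0 P})"
  have n1: "n \<ge> 1" using n by simp
  have LD: "P \<in> cochains n scale p" "weighted n 0 P" if "P \<in> L p" for P p using that by (auto simp: L_def)
  interpret c: vector_space "cochain_scale scale" by (rule p.vector_space_cochain_scale)
  have zero: "0 \<in> L p" for p
    by (simp add: L_def zero_fun_def p.cochains_zero weighted_def weight_space_zero)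
  have lin: "P + cochain_scale scale c Q \<in> L p" if "P \<in> L p" "Q \<in> L p" for P Q p c
    using weighted_linear[of n 0 P Q c] p.cochains_add[OF _ p.cochains_scale] that
    by (simp add: L_def plus_fun_def cochain_scale_def)
  have sub: "c.subspace (L p)" for p
  proof (rule c.subspaceI)
    show "x + y \<in> L p" if "x \<in> L p" "y \<in> L p" for x y using lin[OF that, of 1] by simp
    show "cochain_scale scale c x \<in> L p" if "x \<in> L p" for c x using lin[OF zero that, of c] by simp
  qed (rule zero)
  have span: "multilinear_cochain n scale P" if "P \<in> c.span (\<Union>p. L p)" for P
  proof -
    have "c.span (\<Union>p. L p) \<subseteq> {P. multilinear_cochain n scale P}"
      by (rule c.span_minimal[OF _ p.subspace_multilinear_cochain])
        (auto simp: L_def intro: p.cochains_imp_multilinear[OF _ n1])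
    then show ?thesis using that by auto
  qed
  have "graded_lie_algebra (cochain_scale scale) L (n_Lie_bracket n scale)"
  proof
    show "c.subspace (L p)" for p by (rule sub)
    fix I f p assume fin: "finite I" and f: "\<And>p. p \<in> I \<Longrightarrow> f p \<in> L p" and s: "(\<Sum>p\<in>I. f p) = 0" and p: "p \<in> I"
    show "f p = 0"
    proof (intro ext)
      fix Xs x
      \<comment> \<open>Different degrees are supported on different numbers of blocks, so
        evaluation on \<open>p\<close> blocks isolates the component \<open>f p\<close>.\<close>
      have van: "f q Xs x = 0" if "q \<in> I" "length Xs \<noteq> q" for q
        using f[OF that(1)] that(2) cochains_vanish[of "f q" n scale q Xs x] by (auto simp: L_def blocks_def)
      have "0 = (\<Sum>q\<in>I. f q Xs x)" using s by (simp flip: sum_fun_apply2)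
      show "f p Xs x = 0 Xs x"
      proof (cases "length Xs = p")
        case True
        have "(\<Sum>q\<in>I. f q Xs x) = (\<Sum>q\<in>{p}. f q Xs x)"
          by (rule sum.mono_neutral_right) (use fin p True van in auto)
        with \<open>0 = (\<Sum>q\<in>I. f q Xs x)\<close> show ?thesis by simp
      qed (use van p in simp)
    qed
  next
    fix x y p q assume xy: "x \<in> L p" "y \<in> L q"
    have "weighted n 0 (n_Lie_bracket n scale x y)"
      using weighted_linear[OF circ_rec_weighted[OF LD(2)[OF xy(1)] LD(2)[OF xy(2)], of q]
          circ_rec_weighted[OF LD(2)[OF xy(2)] LD(2)[OF xy(1)], of p], of "- ((- 1) ^ (p * q))"]
      by (simp add: p.n_Lie_bracket_homogeneous[OF LD(1)[OF xy(1)] LD(1)[OF xy(2)] n1])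
    then show "n_Lie_bracket n scale x y \<in> L (p + q)"
      using p.n_Lie_bracket_in_cochains[OF LD(1)[OF xy(1)] LD(1)[OF xy(2)] n] by (simp add: L_def)
  next
    show "n_Lie_bracket n scale x (n_Lie_bracket n scale y z) = n_Lie_bracket n scale (n_Lie_bracket n scale x y) z +
        cochain_scale scale ((- 1) ^ (p * q)) (n_Lie_bracket n scale y (n_Lie_bracket n scale x z))"
      if "x \<in> L p" "y \<in> L q" "z \<in> L r" for x y z p q r
      using that by (intro p.n_Lie_bracket_jacobi[OF _ _ _ n]) (auto intro: LD)
    show "n_Lie_bracket n scale x y = - cochain_scale scale ((- 1) ^ (p * q)) (n_Lie_bracket n scale y x)"
      if "x \<in> L p" "y \<in> L q" for x y p q
      using that by (intro p.n_Lie_bracket_skew[OF _ _ n1]) (auto intro: LD)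
  qed (use span in \<open>simp_all add: p.n_Lie_bracket_bilinear\<close>)
  then show ?thesis by (simp add: L_def)
qed

end


section \<open>Maps on the direct sum\<close>

lemma alternating_zero_entry:
  assumes f: "alternating s t m f" and "0 \<in> set xs"
  shows "f xs = 0"
proof (cases "length xs = m")
  case True
  with assms(2) obtain i where "i < m" "xs ! i = 0" by (metis in_set_conv_nth)
  then show ?thesis using linear_apply_zero[OF alternating_linear[OF f True, of i]] by (metis list_update_id)
qed (rule alternating_length[OF f])

lemma alternating_precompose:
  assumes f: "alternating s t m f" and T: "Vector_Spaces.linear u s T"
  shows "alternating u t m (\<lambda>xs. f (map T xs))"
proof (rule alternatingI)
  fix xs :: "'d list" and i assume "length xs = m" "i < m"
  then show "Vector_Spaces.linear u t (\<lambda>y. f (map T (xs[i := y])))"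
    using linear_compose_fun[OF T alternating_linear[OF f, of "map T xs" i]] by (simp add: map_update)
next
  fix xs :: "'d list" and i j assume "length xs = m" "i < j" "j < m" "xs ! i = xs ! j"
  then show "f (map T xs) = 0" by (intro alternating_repeat[OF f, of i j]) auto
qed (simp add: alternating_length[OF f])

text \<open>One adjacent swap for each element of \<open>bs\<close>; for lists of the wrong length
  both sides are zero.\<close>

lemma alternating_move:
  assumes f: "alternating s t m f" and t: "vector_space t"
  shows "f (us @ a # bs @ vs) = t ((- 1) ^ length bs) (f (us @ bs @ a # vs))"
proof (cases "length us + length bs + length vs + 1 = m")
  case True
  interpret t: vector_space t by (rule t)
  show ?thesis using True
  proof (induction bs arbitrary: us)
    case Nil
    then show ?case by simp
  next
    case (Cons b bs)
    define xs where "xs = us @ a # b # bs @ vs"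
    have "f (xs[length us := a, Suc (length us) := b]) = - f (xs[length us := b, Suc (length us) := a])"
      by (rule alternating_swap[OF f]) (use Cons.prems in \<open>auto simp: xs_def\<close>)
    then have "f (us @ a # b # bs @ vs) = - f (us @ b # a # bs @ vs)"
      by (simp add: xs_def list_update_append)
    also have "f (us @ b # a # bs @ vs) = t ((- 1) ^ length bs) (f (us @ b # bs @ a # vs))"
      using Cons.IH[of "us @ [b]"] Cons.prems by simp
    finally show ?case by simp
  qed
next
  case False
  interpret t: vector_space t by (rule t)
  have "f (us @ a # bs @ vs) = 0" "f (us @ bs @ a # vs) = 0"
    by (rule alternating_length[OF f]; use False in simp)+
  then show ?thesis by simp
qed

lemma length_delete_nth: "i < length xs \<Longrightarrow> length (delete_nth i xs) = length xs - 1"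
  by (simp add: delete_nth_def)

lemma nth_delete_nth:
  "i < length xs \<Longrightarrow> a < length xs - 1 \<Longrightarrow> delete_nth i xs ! a = xs ! (if a < i then a else Suc a)"
  by (auto simp: delete_nth_def nth_append)

lemma delete_nth_update_same: "delete_nth i (xs[i := y]) = delete_nth i xs"
  by (simp add: delete_nth_def)

lemma delete_nth_update:
  "i < length xs \<Longrightarrow> j < length xs \<Longrightarrow> i \<noteq> j \<Longrightarrow>
    delete_nth i (xs[j := y]) = (delete_nth i xs)[(if j < i then j else j - 1) := y]"
  by (rule nth_equalityI) (auto simp: length_delete_nth nth_delete_nth nth_list_update)

lemma delete_nth_snoc: "delete_nth (length xs) (xs @ [x]) = xs"
  by (simp add: delete_nth_def)

lemma in_set_delete_nth: "j < length xs \<Longrightarrow> i \<noteq> j \<Longrightarrow> xs ! j \<in> set (delete_nth i xs)"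
proof (cases "j < i")
  case True
  assume "j < length xs"
  then have "take i xs ! j \<in> set (take i xs)" using True by (intro nth_mem) simp
  then show ?thesis using True by (simp add: delete_nth_def)
next
  case False
  assume "j < length xs" "i \<noteq> j"
  then have "drop (Suc i) xs ! (j - Suc i) \<in> set (drop (Suc i) xs)" using False by (intro nth_mem) simp
  then show ?thesis using False \<open>j < length xs\<close> \<open>i \<noteq> j\<close> by (simp add: delete_nth_def)
qed

section \<open>Vanishing of alternating maps, tested on pure vectors\<close>

definition pure :: "'g::zero \<times> 'v::zero \<Rightarrow> bool"
  where "pure z \<longleftrightarrow> fst z = 0 \<or> snd z = 0"

text \<open>The zero vector gets weight \<open>1\<close> by convention, which is consistent because
  it lies in every weight space.\<close>

definition pure_weight :: "'g::zero \<times> 'v \<Rightarrow> nat"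
  where "pure_weight z = (if fst z = 0 then 1 else 0)"

lemma pure_weight_space: "pure z \<Longrightarrow> z \<in> weight_space (pure_weight z)"
  by (auto simp: pure_def pure_weight_def weight_space_def mem_Times_iff)

lemma weight_space_ge_2: "z \<in> weight_space w \<Longrightarrow> w \<ge> 2 \<Longrightarrow> z = 0"
  by (simp add: weight_space_def)

lemma list_all2_pure_weight:
  "(\<And>z. z \<in> set zs \<Longrightarrow> pure z) \<Longrightarrow> list_all2 (\<lambda>w z. z \<in> weight_space w) (map pure_weight zs) zs"
  by (simp add: list_all2_conv_all_nth pure_weight_space)

lemma weighted_vanish:
  assumes "weighted n 0 P" "\<And>X. X \<in> set Xs \<Longrightarrow> length X = n - 1"
    "\<And>z. z \<in> set (concat Xs @ [x]) \<Longrightarrow> pure z" "sum_list (map pure_weight (concat Xs @ [x])) \<ge> 2"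
  shows "P Xs x = 0"
proof -
  have "P Xs x \<in> weight_space (0 + sum_list (map pure_weight (concat Xs @ [x])))"
    by (rule weightedD[OF assms(1) assms(2) list_all2_pure_weight[OF assms(3)]])
  then show ?thesis by (rule weight_space_ge_2) (use assms(4) in simp)
qed

text \<open>The semidirect product bracket on the sum of g and V, as a function of all
  \<open>n\<close> vectors at once. The length test makes the second component vanish on other
  lists, as \<open>alternating\<close> demands.\<close>

definition pair_bracket ::
  "nat \<Rightarrow> ('k::field \<Rightarrow> 'v::ab_group_add \<Rightarrow> 'v) \<Rightarrow> ('g::ab_group_add list \<Rightarrow> 'g) \<Rightarrow>
    ('g list \<Rightarrow> 'v \<Rightarrow> 'v) \<Rightarrow> ('g \<times> 'v) list \<Rightarrow> 'g \<times> 'v"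
  where "pair_bracket n sv \<mu> \<rho> zs = (\<mu> (map fst zs), if length zs = n then
    \<Sum>i<n. sv ((- 1) ^ (n - 1 - i)) (\<rho> (delete_nth i (map fst zs)) (snd (zs ! i))) else 0)"

context vector_space_prod
begin

lemma linear_inl: "Vector_Spaces.linear s1 scale (\<lambda>a. (a, 0))"
  and linear_inr: "Vector_Spaces.linear s2 scale (\<lambda>a. (0, a))"
  using vs1.vector_space_axioms vs2.vector_space_axioms p.vector_space_axioms
  by (simp_all add: Vector_Spaces.linear_iff scale_def)

lemma linear_Pair_fun:
  "Vector_Spaces.linear s s1 f \<Longrightarrow> Vector_Spaces.linear s s2 g \<Longrightarrow> Vector_Spaces.linear s scale (\<lambda>x. (f x, g x))"
  using p.vector_space_axioms by (simp add: Vector_Spaces.linear_iff scale_def)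

lemma alternating_Pair:
  "alternating s s1 m f \<Longrightarrow> alternating s s2 m g \<Longrightarrow> alternating s scale m (\<lambda>xs. (f xs, g xs))"
  by (rule alternatingI)
    (auto simp: alternating_length zero_prod_def intro: alternating_repeat linear_Pair_fun alternating_linear)

text \<open>Every vector is the sum of its g part and its V part, and both are pure; linearity in
  one slot at a time splits all entries.\<close>

lemma alternating_vanish_pure:
  assumes f: "alternating scale t m f"
    and pure: "\<And>zs. length zs = m \<Longrightarrow> (\<And>z. z \<in> set zs \<Longrightarrow> pure z) \<Longrightarrow> f zs = 0"
  shows "f zs = 0"
proof (cases "length zs = m")
  case True
  \<comment> \<open>The entries from position \<open>k\<close> on are pure and those before are
    arbitrary; raising \<open>k\<close> splits the entry at \<open>k\<close>.\<close>
  have "\<forall>zs. length zs = m \<longrightarrow> (\<forall>i<m. k \<le> i \<longrightarrow> pure (zs ! i)) \<longrightarrow> f zs = 0" for k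
  proof (induction k)
    case 0
    show ?case by (intro allI impI pure) (metis in_set_conv_nth le0)+
  next
    case (Suc k)
    show ?case
    proof (intro allI impI)
      fix zs :: "('b \<times> 'c) list"
      assume zs: "length zs = m" "\<forall>i<m. Suc k \<le> i \<longrightarrow> pure (zs ! i)"
      show "f zs = 0"
      proof (cases "k < m")
        case True
        have "f (zs[k := (fst (zs ! k), 0) + (0, snd (zs ! k))]) =
          f (zs[k := (fst (zs ! k), 0)]) + f (zs[k := (0, snd (zs ! k))])"
          by (rule linear_apply_add[OF alternating_linear[OF f zs(1) True]])
        moreover have "f (zs[k := (fst (zs ! k), 0)]) = 0" "f (zs[k := (0, snd (zs ! k))]) = 0"
          using zs by (intro Suc.IH[rule_format]; force simp: nth_list_update pure_def)+
        ultimately show ?thesis by simp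
      next
        case False
        then show ?thesis using zs Suc.IH by auto
      qed
    qed
  qed
  from this[of m] show ?thesis using True by auto
qed (rule alternating_length[OF f])

text \<open>For pure entries the total weight counts those from V: with none, \<open>g\<close>
  applies; a single one is swapped into the last place for \<open>v\<close>; and \<open>two\<close>
  covers the rest.\<close>

lemma alternating_vanish:
  assumes f: "alternating scale t (Suc k) f"
    and g: "\<And>xs. length xs = Suc k \<Longrightarrow> f (map (\<lambda>a. (a, 0)) xs) = 0"
    and v: "\<And>xs u. length xs = k \<Longrightarrow> f (map (\<lambda>a. (a, 0)) xs @ [(0, u)]) = 0"
    and two: "\<And>zs. length zs = Suc k \<Longrightarrow> (\<And>z. z \<in> set zs \<Longrightarrow> pure z) \<Longrightarrow>
      sum_list (map pure_weight zs) \<ge> 2 \<Longrightarrow> f zs = 0"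
  shows "f zs = 0"
proof (rule alternating_vanish_pure[OF f])
  fix zs :: "('b \<times> 'c) list"
  assume zs: "length zs = Suc k" "\<And>z. z \<in> set zs \<Longrightarrow> pure z"
  have eq: "z = (fst z, 0)" if "pure_weight z = 0" "z \<in> set zs" for z
    using that(1) zs(2)[OF that(2)] by (auto simp: pure_def pure_weight_def prod_eq_iff split: if_splits)
  consider "sum_list (map pure_weight zs) = 0" | "sum_list (map pure_weight zs) = 1"
    | "sum_list (map pure_weight zs) \<ge> 2" by linarith
  then show "f zs = 0"
  proof cases
    case 1
    then have "zs = map (\<lambda>a. (a, 0)) (map fst zs)"
      using eq by (auto simp: comp_def intro!: map_idI[symmetric])
    then show ?thesis using g[of "map fst zs"] zs by simp
  next
    case 2
    then have "(\<Sum>i<Suc k. pure_weight (zs ! i)) = 1"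
      using zs(1) by (simp add: sum_list_sum_nth atLeast0LessThan)
    then obtain i where i: "i < Suc k" "pure_weight (zs ! i) = 1"
      "\<And>j. j < Suc k \<Longrightarrow> j \<noteq> i \<Longrightarrow> pure_weight (zs ! j) = 0"
      by (subst (asm) sum_eq_1_iff) auto
    \<comment> \<open>The entry from V trades places with the last one, at the price of a sign if
      \<open>i\<close> differs from \<open>k\<close>.\<close>
    define ys where "ys = zs[i := zs ! k, k := zs ! i]"
    have ys: "ys = map (\<lambda>a. (a, 0)) (map fst (take k ys)) @ [(0, snd (zs ! i))]"
    proof (rule nth_equalityI)
      fix j assume j: "j < length ys"
      have fi: "zs ! i = (0, snd (zs ! i))"
        using i(2) by (simp add: pure_weight_def prod_eq_iff split: if_splits)
      have "ys ! j = (fst (ys ! j), 0)" if "j \<noteq> k"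
      proof (rule eq)
        show "pure_weight (ys ! j) = 0" "ys ! j \<in> set zs"
          using that j i zs(1) by (auto simp: ys_def nth_list_update)
      qed
      then show "ys ! j = (map (\<lambda>a. (a, 0)) (map fst (take k ys)) @ [(0, snd (zs ! i))]) ! j"
        using j zs(1) fi i(1) by (cases "j = k") (auto simp: nth_append ys_def)
    qed (simp add: ys_def zs)
    have 0: "f ys = 0" by (subst ys, rule v) (simp add: ys_def zs)
    show ?thesis
    proof (cases "i = k")
      case True
      then show ?thesis using 0 by (simp add: ys_def)
    next
      case False
      then have "f (zs[i := zs ! i, k := zs ! k]) = - f ys"
        unfolding ys_def using i(1) by (intro alternating_swap[OF f zs(1)]) auto
      then show ?thesis using 0 by simp
    qed
  qed (use two zs in auto)
qed

lemma pair_cochain_eq_pair_bracket: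
  "n \<ge> 2 \<Longrightarrow> length X = n - 1 \<Longrightarrow> pair_cochain n s2 \<mu> \<rho> [X] x = pair_bracket n s2 \<mu> \<rho> (X @ [x])"
  by (simp add: pair_cochain_def pair_bracket_def blocks_def Let_def)

text \<open>If entries \<open>i < j\<close> agree, a summand other than \<open>i\<close> and
  \<open>j\<close> still contains both of them among the arguments of \<rho> and vanishes. In
  summands \<open>i\<close> and \<open>j\<close> the remaining copy stands at places that differ by
  \<open>j - i - 1\<close> swaps, and with the signs of the two summands they cancel.\<close>

lemma alternating_pair_bracket:
  assumes \<mu>: "alternating s1 s1 n \<mu>" and \<rho>: "action_map n s1 s2 \<rho>"
  shows "alternating scale scale n (pair_bracket n s2 \<mu> \<rho>)"
proof -
  have lin: "Vector_Spaces.linear s2 s2 (\<rho> xs)" and alt: "alternating s1 s2 (n - 1) (\<lambda>xs. \<rho> xs u)" for xs u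
    using \<rho> by (auto simp: action_map_def)
  have snd: "Vector_Spaces.linear scale s2 snd" and fst: "Vector_Spaces.linear scale s1 fst"
    by (simp_all add: linear_snd linear_fst)
  have "alternating scale s2 n (\<lambda>zs. if length zs = n then
      \<Sum>i<n. s2 ((- 1) ^ (n - 1 - i)) (\<rho> (delete_nth i (map fst zs)) (snd (zs ! i))) else 0)"
  proof (rule alternatingI)
    fix zs :: "('b \<times> 'c) list" and j assume zs: "length zs = n" "j < n"
    have "Vector_Spaces.linear scale s2 (\<lambda>y. \<Sum>i<n. s2 ((- 1) ^ (n - 1 - i))
      (\<rho> (delete_nth i (map fst (zs[j := y]))) (snd (zs[j := y] ! i))))"
    proof (intro linear_sum_fun p.vector_space_axioms vs2.vector_space_axioms linear_scale_fun)
      fix i assume i: "i \<in> {..<n}"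
      show "Vector_Spaces.linear scale s2 (\<lambda>y. \<rho> (delete_nth i (map fst (zs[j := y]))) (snd (zs[j := y] ! i)))"
      proof (cases "i = j")
        case True
        then show ?thesis
          using linear_compose_fun[OF snd lin] zs by (simp add: map_update delete_nth_update_same)
      next
        case False
        have "Vector_Spaces.linear s1 s2 (\<lambda>y. \<rho> ((delete_nth i (map fst zs))[(if j < i then j else j - 1) := y]) (snd (zs ! i)))"
          by (rule alternating_linear[OF alt]) (use i zs False in \<open>auto simp: length_delete_nth\<close>)
        from linear_compose_fun[OF fst this] show ?thesis
          using i zs False by (simp add: map_update delete_nth_update)
      qed
    qed
    then show "Vector_Spaces.linear scale s2 (\<lambda>y. if length (zs[j := y]) = n then
      \<Sum>i<n. s2 ((- 1) ^ (n - 1 - i)) (\<rho> (delete_nth i (map fst (zs[j := y]))) (snd (zs[j := y] ! i))) else 0)"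
      using zs by simp
  next
    fix zs :: "('b \<times> 'c) list" and i j assume zs: "length zs = n" "i < j" "j < n" "zs ! i = zs ! j"
    define as where "as = map fst zs"
    define F where "F = (\<lambda>l. s2 ((- 1) ^ (n - 1 - l)) (\<rho> (delete_nth l as) (snd (zs ! l))))"
    have as: "length as = n" "as ! i = as ! j" using zs by (simp_all add: as_def)
    have F0: "F l = 0" if l: "l < n" "l \<notin> {i, j}" for l
    proof -
      have "\<rho> (delete_nth l as) (snd (zs ! l)) = 0"
      proof (rule alternating_repeat[OF alt])
        show "(if i < l then i else i - 1) < (if j < l then j else j - 1)"
          "(if j < l then j else j - 1) < n - 1"
          "delete_nth l as ! (if i < l then i else i - 1) = delete_nth l as ! (if j < l then j else j - 1)"
          using l zs(2,3) as by (auto simp: nth_delete_nth)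
      qed
      then show ?thesis by (simp add: F_def)
    qed
    \<comment> \<open>The list of g parts cut at \<open>i\<close> and \<open>j\<close>;
      \<open>a\<close> is the common entry.\<close>
    define us ms vs a where "us = take i as" and "ms = drop (Suc i) (take j as)"
      and "vs = drop (Suc j) as" and "a = as ! j"
    have len: "length ms = j - i - 1" using zs(2,3) as by (simp add: ms_def)
    have di: "delete_nth i as = us @ ms @ a # vs"
    proof -
      have "drop (Suc i) as = ms @ a # vs"
        unfolding ms_def a_def vs_def using zs(2,3) as(1)
        by (metis Cons_nth_drop_Suc append_take_drop_id drop_append[of "Suc i" "take j as" "drop j as"]
            length_take less_imp_le min.absorb2 Suc_leI diff_is_0_eq drop0)
      then show ?thesis by (simp add: delete_nth_def us_def)
    qed
    have dj: "delete_nth j as = us @ a # ms @ vs"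
    proof -
      have "take j as = us @ a # ms"
        unfolding ms_def a_def us_def as(2)[symmetric] using zs(2,3) as(1)
        by (metis (no_types, lifting) append_take_drop_id Cons_nth_drop_Suc drop_take take_take length_take min.absorb1
            less_imp_le nth_take order.strict_trans min.absorb2)
      then show ?thesis by (simp add: delete_nth_def vs_def)
    qed
    have "F j = s2 ((- 1) ^ (n - 1 - j) * (- 1) ^ (j - i - 1)) (\<rho> (us @ ms @ a # vs) (snd (zs ! i)))"
      unfolding F_def dj using alternating_move[OF alt vs2.vector_space_axioms, of us a ms vs] len zs(4) by simp
    \<comment> \<open>The exponents add up to one less than \<open>n - 1 - i\<close>.\<close>
    also have "(- 1) ^ (n - 1 - j) * (- 1) ^ (j - i - 1) = - ((- 1) ^ (n - 1 - i) :: 'a)"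
    proof -
      have "n - 1 - i = Suc (n - 1 - j + (j - i - 1))" using zs(2,3) by simp
      then show ?thesis by (simp only: power_Suc power_add) simp
    qed
    finally have "F i + F j = 0" by (simp add: F_def di)
    moreover have "(\<Sum>l<n. F l) = (\<Sum>l\<in>{i, j}. F l)"
      by (rule sum.mono_neutral_right) (use zs F0 in auto)
    ultimately show "(if length zs = n then
      \<Sum>i<n. s2 ((- 1) ^ (n - 1 - i)) (\<rho> (delete_nth i (map fst zs)) (snd (zs ! i))) else 0) = 0"
      using zs by (simp add: F_def as_def)
  qed simp
  from alternating_Pair[OF alternating_precompose[OF \<mu> fst] this]
  show ?thesis by (simp add: pair_bracket_def[abs_def])
qed

text \<open>An entry of nonzero weight has zero g part, so the first component survives only in
  weight \<open>0\<close>. A summand of the second needs entry \<open>i\<close> of weight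
  \<open>1\<close> and all others of weight \<open>0\<close>, which is total weight
  \<open>1\<close>.\<close>

lemma weighted_pair_bracket:
  assumes \<mu>: "alternating s1 s1 n \<mu>" and \<rho>: "action_map n s1 s2 \<rho>"
    and vs: "list_all2 (\<lambda>w z. z \<in> weight_space w) vs zs"
  shows "pair_bracket n s2 \<mu> \<rho> zs \<in> weight_space (sum_list vs)"
proof -
  have lin: "Vector_Spaces.linear s2 s2 (\<rho> xs)" and alt: "alternating s1 s2 (n - 1) (\<lambda>xs. \<rho> xs u)" for xs u
    using \<rho> by (auto simp: action_map_def)
  have len: "length vs = length zs" using vs by (rule list_all2_lengthD)
  have w: "zs ! i \<in> weight_space (vs ! i)" if "i < length zs" for i
    using vs that by (simp add: list_all2_conv_all_nth)
  have fst0: "fst (zs ! i) = 0" if "i < length zs" "vs ! i \<noteq> 0" for i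
    using w[OF that(1)] that(2) by (auto simp: weight_space_def split: if_splits)
  have snd0: "snd (zs ! i) = 0" if "i < length zs" "vs ! i \<noteq> 1" for i
    using w[OF that(1)] that(2) by (auto simp: weight_space_def split: if_splits)
  have A: "fst (pair_bracket n s2 \<mu> \<rho> zs) = 0" if "sum_list vs \<noteq> 0"
  proof -
    have "\<exists>v\<in>set vs. v \<noteq> 0" using that by (simp add: sum_list_eq_0_iff)
    then obtain i where i: "i < length zs" "vs ! i \<noteq> 0" using len by (metis in_set_conv_nth)
    then have "0 \<in> set (map fst zs)" using fst0[OF i] by (metis length_map nth_map nth_mem)
    then show ?thesis using alternating_zero_entry[OF \<mu>] by (simp add: pair_bracket_def)
  qed
  have B: "snd (pair_bracket n s2 \<mu> \<rho> zs) = 0" if s: "sum_list vs \<noteq> 1"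
  proof -
    have "\<rho> (delete_nth i (map fst zs)) (snd (zs ! i)) = 0" if i: "i < length zs" for i
    proof (cases "vs ! i = 1")
      case False
      then show ?thesis using snd0[OF i] linear_apply_zero[OF lin] by simp
    next
      case True
      have "\<exists>j<length zs. j \<noteq> i \<and> vs ! j \<noteq> 0"
      proof (rule ccontr)
        assume "\<not> (\<exists>j<length zs. j \<noteq> i \<and> vs ! j \<noteq> 0)"
        then have "(\<Sum>j<length zs. vs ! j) = (\<Sum>j\<in>{i}. vs ! j)"
          using i by (intro sum.mono_neutral_right) auto
        then show False using s True len by (simp add: sum_list_sum_nth atLeast0LessThan)
      qed
      then obtain j where j: "j < length zs" "j \<noteq> i" "vs ! j \<noteq> 0" by auto
      then have "0 \<in> set (delete_nth i (map fst zs))"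
        using in_set_delete_nth[of j "map fst zs" i] fst0[of j] by auto
      then show ?thesis by (rule alternating_zero_entry[OF alt])
    qed
    then show ?thesis by (auto simp: pair_bracket_def intro!: sum.neutral)
  qed
  consider "sum_list vs = 0" | "sum_list vs = 1" | "sum_list vs \<ge> 2" by linarith
  then show ?thesis
  proof cases
    case 1
    then show ?thesis using B unfolding 1 by (simp add: weight_space_def mem_Times_iff)
  next
    case 2
    then show ?thesis using A unfolding 2 by (simp add: weight_space_def mem_Times_iff)
  next
    case 3
    have "fst (pair_bracket n s2 \<mu> \<rho> zs) = 0" by (rule A) (use 3 in linarith)
    moreover have "snd (pair_bracket n s2 \<mu> \<rho> zs) = 0" by (rule B) (use 3 in linarith)
    ultimately have "pair_bracket n s2 \<mu> \<rho> zs = 0" by (simp add: prod_eq_iff)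
    then show ?thesis by (simp add: weight_space_zero)
  qed
qed

lemma pair_cochain_in_cochains:
  assumes n: "n \<ge> 2" and \<mu>: "alternating s1 s1 n \<mu>" and \<rho>: "action_map n s1 s2 \<rho>"
  shows "pair_cochain n s2 \<mu> \<rho> \<in> cochains n scale (Suc 0)" and "weighted n 0 (pair_cochain n s2 \<mu> \<rho>)"
proof -
  have van: "pair_cochain n s2 \<mu> \<rho> Xs x = 0" if "\<not> blocks n 1 Xs" for Xs x
    using that by (simp add: pair_cochain_def)
  have "(\<lambda>zs. pair_cochain n s2 \<mu> \<rho> [butlast zs] (last zs)) = pair_bracket n s2 \<mu> \<rho>"
  proof
    fix zs :: "('b \<times> 'c) list"
    show "pair_cochain n s2 \<mu> \<rho> [butlast zs] (last zs) = pair_bracket n s2 \<mu> \<rho> zs"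
    proof (cases "length zs = n")
      case True
      then have "zs \<noteq> []" using n by auto
      then show ?thesis using True n by (simp add: pair_cochain_eq_pair_bracket)
    next
      case False
      then have "\<not> blocks n 1 [butlast zs]" using n by (cases zs) (auto simp: blocks_def)
      then show ?thesis
        using van alternating_length[OF alternating_pair_bracket[OF \<mu> \<rho>] False] by simp
    qed
  qed
  then show "pair_cochain n s2 \<mu> \<rho> \<in> cochains n scale (Suc 0)"
    using alternating_pair_bracket[OF \<mu> \<rho>] van by (simp add: cochains_1_iff)
  show "weighted n 0 (pair_cochain n s2 \<mu> \<rho>)"
    unfolding weighted_def
  proof (intro allI impI)
    fix Xs :: "('b \<times> 'c) list list" and x vs
    assume X: "\<forall>X\<in>set Xs. length X = n - 1" and vs: "list_all2 (\<lambda>w z. z \<in> weight_space w) vs (concat Xs @ [x])"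
    show "pair_cochain n s2 \<mu> \<rho> Xs x \<in> weight_space (0 + sum_list vs)"
    proof (cases "length Xs = 1")
      case True
      then obtain X where [simp]: "Xs = [X]" by (auto simp: length_Suc_conv)
      show ?thesis
        using X vs weighted_pair_bracket[OF \<mu> \<rho>, of vs "X @ [x]"] n by (simp add: pair_cochain_eq_pair_bracket)
    next
      case False
      then show ?thesis by (subst van) (auto simp: blocks_def weight_space_zero)
    qed
  qed
qed

end


section \<open>Maurer-Cartan elements\<close>

context vector_space_prod
begin

lemma pair_bracket_left:
  assumes \<rho>: "action_map n s1 s2 \<rho>"
  shows "pair_bracket n s2 \<mu> \<rho> (map (\<lambda>a. (a, 0)) xs) = (\<mu> xs, 0)"
proof -
  have lin: "Vector_Spaces.linear s2 s2 (\<rho> ys)" for ys using \<rho> by (simp add: action_map_def)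
  show ?thesis
    by (simp add: pair_bracket_def comp_def linear_apply_zero[OF lin])
qed

text \<open>The entry \<open>(0, u)\<close> puts a zero among the g parts, so the term with \<mu>
  vanishes, and only summand \<open>i\<close> has a V part that can be nonzero.\<close>

lemma pair_bracket_right:
  assumes \<mu>: "alternating s1 s1 n \<mu>" and \<rho>: "action_map n s1 s2 \<rho>" and "length xs = n" "i < n"
  shows "pair_bracket n s2 \<mu> \<rho> ((map (\<lambda>a. (a, 0)) xs)[i := (0, u)]) =
    (0, s2 ((- 1) ^ (n - 1 - i)) (\<rho> (delete_nth i xs) u))"
proof -
  have lin: "Vector_Spaces.linear s2 s2 (\<rho> ys)" for ys using \<rho> by (simp add: action_map_def)
  have fst: "map fst ((map (\<lambda>a. (a, 0)) xs)[i := (0, u)]) = xs[i := 0]"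
    by (simp add: map_update comp_def)
  have "\<mu> (xs[i := 0]) = 0"
    by (rule alternating_zero_entry[OF \<mu>]) (use assms in \<open>auto intro: set_update_memI\<close>)
  moreover have "(\<Sum>j<n. s2 ((- 1) ^ (n - 1 - j)) (\<rho> (delete_nth j (xs[i := 0])) (snd ((map (\<lambda>a. (a, 0)) xs)[i := (0, u)] ! j)))) =
    (\<Sum>j\<in>{i}. s2 ((- 1) ^ (n - 1 - j)) (\<rho> (delete_nth j (xs[i := 0])) (snd ((map (\<lambda>a. (a, 0)) xs)[i := (0, u)] ! j))))"
    by (rule sum.mono_neutral_right)
      (use assms(3,4) in \<open>auto simp: nth_list_update linear_apply_zero[OF lin]\<close>)
  ultimately show ?thesis
    using assms(3,4) unfolding pair_bracket_def fst by (simp add: delete_nth_update_same)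
qed

lemma pair_bracket_right_last:
  assumes \<mu>: "alternating s1 s1 n \<mu>" and \<rho>: "action_map n s1 s2 \<rho>" and "Suc (length xs) = n"
  shows "pair_bracket n s2 \<mu> \<rho> (map (\<lambda>a. (a, 0)) xs @ [(0, u)]) = (0, \<rho> xs u)"
  using pair_bracket_right[OF \<mu> \<rho>, of "xs @ [0]" "length xs" u] assms(3)
    list_update_length[of "map (\<lambda>a. (a, 0)) xs" "(0, 0)" "[]" "(0, u)"]
  by (auto simp: delete_nth_snoc)

text \<open>Counted from \<open>0\<close>, the entry from V stands at \<open>n - 2\<close>, so its
  sign is \<open>(- 1) ^ 1\<close>.\<close>

lemma pair_bracket_right_butlast:
  assumes \<mu>: "alternating s1 s1 n \<mu>" and \<rho>: "action_map n s1 s2 \<rho>" and "Suc (Suc (length xs)) = n"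
  shows "pair_bracket n s2 \<mu> \<rho> (map (\<lambda>a. (a, 0)) xs @ [(0, u), (a, 0)]) = (0, - \<rho> (xs @ [a]) u)"
  using pair_bracket_right[OF \<mu> \<rho>, of "xs @ [0, a]" "length xs" u] assms(3)
    list_update_length[of "map (\<lambda>a. (a, 0)) xs" "(0, 0)" "[(a, 0)]" "(0, u)"]
  by (auto simp: delete_nth_def)

text \<open>The minus sign arises where \<open>X\<close> goes to the outer factor and passes the
  inner one of degree \<open>1\<close>.\<close>

lemma circ_rec_square:
  "circ_rec n scale (Suc 0) \<pi> \<pi> [X, Y] x =
    \<pi> [Y] (\<pi> [X] x) - \<pi> [X] (\<pi> [Y] x) + (\<Sum>i<n - 1. \<pi> [Y[i := \<pi> [X] (Y ! i)]] x)"
  by simp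

text \<open>The term in which the bracket with \<open>X\<close> acts on the final vector is the
  summand that extends the sum from the block to all \<open>n\<close> vectors.\<close>

lemma circ_rec_square_pair_cochain:
  fixes \<mu> :: "'b list \<Rightarrow> 'b" and \<rho> :: "'b list \<Rightarrow> 'c \<Rightarrow> 'c"
  assumes n: "n \<ge> 2" and "length X = n - 1" "length zs = n"
  defines "B \<equiv> pair_bracket n s2 \<mu> \<rho>"
  shows "circ_rec n scale (Suc 0) (pair_cochain n s2 \<mu> \<rho>) (pair_cochain n s2 \<mu> \<rho>) [X, butlast zs] (last zs) =
    (\<Sum>i<n. B (zs[i := B (X @ [zs ! i])])) - B (X @ [B zs])"
proof -
  have "zs \<noteq> []" using assms by auto
  then obtain Y x where zs: "zs = Y @ [x]" by (metis append_butlast_last_id)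
  obtain m where m: "n = Suc m" using n by (cases n) auto
  have len: "length Y = m" "length X = m" using assms zs m by simp_all
  show ?thesis
    using n len unfolding circ_rec_square zs B_def
    by (simp add: m pair_cochain_eq_pair_bracket nth_append list_update_append)
qed

text \<open>\<open>G\<close> is alternating in each of its two groups, so
  \<open>alternating_vanish\<close> is applied in \<open>zs\<close> for every kind of pure
  \<open>X\<close>, and then once in \<open>X\<close> for arbitrary \<open>zs\<close>.\<close>

lemma circ_rec_square_vanish_iff:
  assumes n: "n \<ge> 2" and P: "\<pi> \<in> cochains n scale (Suc 0)" "weighted n 0 \<pi>"
  defines "G \<equiv> \<lambda>X zs. circ_rec n scale (Suc 0) \<pi> \<pi> [X, butlast zs] (last zs)"
  shows "circ_rec n scale (Suc 0) \<pi> \<pi> = (\<lambda>Xs x. 0) \<longleftrightarrow>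
    (\<forall>xs ys. length xs = n - 1 \<longrightarrow> length ys = n \<longrightarrow> G (map (\<lambda>a. (a, 0)) xs) (map (\<lambda>a. (a, 0)) ys) = 0) \<and>
    (\<forall>xs ys u. length xs = n - 1 \<longrightarrow> length ys = n - 1 \<longrightarrow>
      G (map (\<lambda>a. (a, 0)) xs) (map (\<lambda>a. (a, 0)) ys @ [(0, u)]) = 0) \<and>
    (\<forall>xs ys u. length xs = n - 2 \<longrightarrow> length ys = n \<longrightarrow>
      G (map (\<lambda>a. (a, 0)) xs @ [(0, u)]) (map (\<lambda>a. (a, 0)) ys) = 0)" (is "_ \<longleftrightarrow> ?a \<and> ?b \<and> ?c")
proof
  assume "?a \<and> ?b \<and> ?c"
  then have a: "\<And>xs ys. length xs = n - 1 \<Longrightarrow> length ys = n \<Longrightarrow> G (map (\<lambda>a. (a, 0)) xs) (map (\<lambda>a. (a, 0)) ys) = 0"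
    and b: "\<And>xs ys u. length xs = n - 1 \<Longrightarrow> length ys = n - 1 \<Longrightarrow>
      G (map (\<lambda>a. (a, 0)) xs) (map (\<lambda>a. (a, 0)) ys @ [(0, u)]) = 0"
    and c: "\<And>xs ys u. length xs = n - 2 \<Longrightarrow> length ys = n \<Longrightarrow>
      G (map (\<lambda>a. (a, 0)) xs @ [(0, u)]) (map (\<lambda>a. (a, 0)) ys) = 0"
    by auto
  define F where "F = circ_rec n scale (Suc 0) \<pi> \<pi>"
  have F: "F \<in> cochains n scale (Suc (Suc 0))"
    using p.circ_rec_in_cochains[OF n P(1) P(1)] by (simp add: F_def)
  have w: "weighted n 0 F"
    using circ_rec_weighted[OF P(2) P(2)] by (simp add: F_def)
  have altz: "alternating scale scale (Suc (n - 1)) (G X)" if "length X = n - 1" for X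
  proof -
    have "blocks n (Suc (Suc 0)) [X, X]" using that by (simp add: blocks_def)
    from cochains_alternating_last[OF F this] show ?thesis using n by (simp add: G_def F_def)
  qed
  have altX: "alternating scale scale (Suc (n - 2)) (\<lambda>X. G X zs)" for zs
    using p.cochains_alternating_hd[OF F, of "[butlast zs]" "last zs"] n
    by (simp add: G_def F_def Suc_diff_Suc numeral_2_eq_2)
  have two: "G X zs = 0" if "length X = n - 1" "length zs = n"
    "\<And>z. z \<in> set (X @ zs) \<Longrightarrow> pure z" "sum_list (map pure_weight (X @ zs)) \<ge> 2" for X zs
  proof -
    have "zs \<noteq> []" using that(2) n by auto
    then have "concat [X, butlast zs] @ [last zs] = X @ zs" by simp
    with that show ?thesis unfolding G_def F_def[symmetric]
      by (intro weighted_vanish[OF w]) auto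
  qed
  have pure: "pure (a, 0 :: 'c)" "pure (0 :: 'b, u)" for a u by (simp_all add: pure_def)
  have wt: "pure_weight (0 :: 'b, u :: 'c) = 1" for u by (simp add: pure_weight_def)
  have nn: "Suc (n - 1) = n" "Suc (n - 2) = n - 1" using n by auto
  have 1: "G (map (\<lambda>a. (a, 0)) xs) zs = 0" if "length xs = n - 1" for xs zs
    by (rule alternating_vanish[OF altz]) (use that nn pure in \<open>auto intro!: a b two\<close>)
  \<comment> \<open>Since \<open>X\<close> already has weight \<open>1\<close>, a further entry from
    V in \<open>zs\<close> brings the total weight to at least \<open>2\<close>.\<close>
  have 2: "G (map (\<lambda>a. (a, 0)) xs @ [(0, u)]) zs = 0" if "length xs = n - 2" for xs u zs
    by (rule alternating_vanish[OF altz]) (use that nn pure wt in \<open>auto intro!: c two\<close>)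
  have 3: "G X zs = 0" if "length X = n - 1" "\<And>z. z \<in> set X \<Longrightarrow> pure z" "sum_list (map pure_weight X) \<ge> 2" for X zs
    by (rule alternating_vanish[OF altz]) (use that nn pure in \<open>auto intro!: two\<close>)
  have 4: "G X zs = 0" for X zs
    by (rule alternating_vanish[OF altX]) (use 1 2 3 nn in auto)
  show "circ_rec n scale (Suc 0) \<pi> \<pi> = (\<lambda>Xs x. 0)"
  proof (intro ext)
    fix Xs x
    show "circ_rec n scale (Suc 0) \<pi> \<pi> Xs x = 0"
    proof (cases "blocks n (Suc (Suc 0)) Xs")
      case True
      then obtain X Y where "Xs = [X, Y]" by (auto simp: blocks_def length_Suc_conv)
      then show ?thesis using 4[of X "Y @ [x]"] by (simp add: G_def)
    next
      case False
      then show ?thesis using cochains_vanish[OF F] by (simp add: F_def)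
    qed
  qed
qed (simp add: G_def del: circ_rec.simps)

text \<open>The facts \<open>a\<close>, \<open>b\<close> and \<open>c\<close> evaluate the three
  families of test arguments. They give, in this order, the fundamental identity of \<mu>, the
  commutator axiom of \<rho> and its axiom for a bracket in the last argument.\<close>

lemma pair_cochain_square_iff:
  assumes n: "n \<ge> 2" and \<mu>: "alternating s1 s1 n \<mu>" and \<rho>: "action_map n s1 s2 \<rho>"
  shows "circ_rec n scale (Suc 0) (pair_cochain n s2 \<mu> \<rho>) (pair_cochain n s2 \<mu> \<rho>) = (\<lambda>Xs x. 0) \<longleftrightarrow>
    n_LieRep_pair n s1 s2 \<mu> \<rho>"
proof -
  define B where "B = pair_bracket n s2 \<mu> \<rho>"
  have lin: "Vector_Spaces.linear s2 s2 (\<rho> ys)" for ys using \<rho> by (simp add: action_map_def)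
  have neg: "\<rho> ys (- u) = - \<rho> ys u" for ys u
    using linear_apply_scale[OF lin, of ys "- 1" u] by simp
  have sum_left: "(\<Sum>i\<in>I. (f i, 0)) = (\<Sum>i\<in>I. f i, 0)" for f :: "nat \<Rightarrow> 'b" and I
    by (simp add: prod_eq_iff fst_sum snd_sum)
  have sum_right: "(\<Sum>i\<in>I. (0, f i)) = (0, \<Sum>i\<in>I. f i)" for f :: "nat \<Rightarrow> 'c" and I
    by (simp add: prod_eq_iff fst_sum snd_sum)
  note left = pair_bracket_left[OF \<rho>, of \<mu>, folded B_def]
  note right = pair_bracket_right[OF \<mu> \<rho>, folded B_def]
  note last = pair_bracket_right_last[OF \<mu> \<rho>, folded B_def]
  note butlast = pair_bracket_right_butlast[OF \<mu> \<rho>, folded B_def]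
  define G where "G = (\<lambda>X zs. circ_rec n scale (Suc 0) (pair_cochain n s2 \<mu> \<rho>) (pair_cochain n s2 \<mu> \<rho>) [X, butlast zs] (last zs))"
  have G: "G X zs = (\<Sum>i<n. B (zs[i := B (X @ [zs ! i])])) - B (X @ [B zs])"
    if "length X = n - 1" "length zs = n" for X zs
    unfolding G_def B_def by (rule circ_rec_square_pair_cochain[OF n that])
  have a: "G (map (\<lambda>a. (a, 0)) xs) (map (\<lambda>a. (a, 0)) ys) =
      ((\<Sum>i<n. \<mu> (ys[i := \<mu> (xs @ [ys ! i])])) - \<mu> (xs @ [\<mu> ys]), 0)"
    if "length xs = n - 1" "length ys = n" for xs ys
  proof -
    have snoc: "B (map (\<lambda>a. (a, 0)) xs @ [(y, 0)]) = (\<mu> (xs @ [y]), 0)" for y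
      using left[of "xs @ [y]"] by simp
    have upd: "B ((map (\<lambda>a. (a, 0)) ys)[i := (y, 0)]) = (\<mu> (ys[i := y]), 0)" for i y
      using left[of "ys[i := y]"] by (simp add: map_update)
    have "(\<Sum>i<n. B ((map (\<lambda>a. (a, 0)) ys)[i := B (map (\<lambda>a. (a, 0)) xs @ [map (\<lambda>a. (a, 0)) ys ! i])])) =
      (\<Sum>i<n. (\<mu> (ys[i := \<mu> (xs @ [ys ! i])]), 0))"
      by (rule sum.cong) (use that in \<open>auto simp: snoc upd\<close>)
    then show ?thesis using that by (simp add: G left snoc sum_left)
  qed
  have b: "G (map (\<lambda>a. (a, 0)) xs) (map (\<lambda>a. (a, 0)) ys @ [(0, u)]) =
      (0, (\<Sum>i<n - 1. \<rho> (ys[i := \<mu> (xs @ [ys ! i])]) u) + \<rho> ys (\<rho> xs u) - \<rho> xs (\<rho> ys u))"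
    if "length xs = n - 1" "length ys = n - 1" for xs ys u
  proof -
    obtain m where m: "n = Suc m" using n by (cases n) auto
    have snoc: "B (map (\<lambda>a. (a, 0)) xs @ [(y, 0)]) = (\<mu> (xs @ [y]), 0)" for y
      using left[of "xs @ [y]"] by simp
    have snoc': "B (map (\<lambda>a. (a, 0)) xs @ [(0, v)]) = (0, \<rho> xs v)" for v
      using last[of xs v] that m by simp
    have snoc'': "B (map (\<lambda>a. (a, 0)) ys @ [(0, v)]) = (0, \<rho> ys v)" for v
      using last[of ys v] that m by simp
    have upd: "B ((map (\<lambda>a. (a, 0)) ys)[i := (y, 0)] @ [(0, u)]) = (0, \<rho> (ys[i := y]) u)" for i y
      using last[of "ys[i := y]" u] that m by (simp add: map_update)
    let ?zs = "map (\<lambda>a. (a, 0)) ys @ [(0, u)]"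
    have "(\<Sum>i<m. B (?zs[i := B (map (\<lambda>a. (a, 0)) xs @ [?zs ! i])])) =
      (\<Sum>i<m. (0, \<rho> (ys[i := \<mu> (xs @ [ys ! i])]) u))"
      by (rule sum.cong) (use that m in \<open>auto simp: snoc upd nth_append list_update_append\<close>)
    then show ?thesis using that m by (simp add: G snoc' snoc'' sum_right nth_append list_update_append)
  qed
  have c: "G (map (\<lambda>a. (a, 0)) xs @ [(0, u)]) (map (\<lambda>a. (a, 0)) ys) =
      (0, \<rho> (xs @ [\<mu> ys]) u - (\<Sum>i<n. s2 ((- 1) ^ (n - 1 - i)) (\<rho> (delete_nth i ys) (\<rho> (xs @ [ys ! i]) u))))"
    if "length xs = n - 2" "length ys = n" for xs ys u
  proof -
    \<comment> \<open>Every bracket with this \<open>X\<close> carries a minus sign, so both sides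
      of the axiom appear with reversed sign in \<open>c\<close>.\<close>
    have snoc: "B (map (\<lambda>a. (a, 0)) xs @ [(0, u), (y, 0)]) = (0, - \<rho> (xs @ [y]) u)" for y
      using butlast[of xs u y] that n by simp
    have "(\<Sum>i<n. B ((map (\<lambda>a. (a, 0)) ys)[i := B ((map (\<lambda>a. (a, 0)) xs @ [(0, u)]) @ [map (\<lambda>a. (a, 0)) ys ! i])])) =
      (\<Sum>i<n. (0, - s2 ((- 1) ^ (n - 1 - i)) (\<rho> (delete_nth i ys) (\<rho> (xs @ [ys ! i]) u))))"
      by (rule sum.cong) (use that in \<open>auto simp: snoc right neg\<close>)
    then show ?thesis using that n by (simp add: G left snoc sum_right sum_negf)
  qed
  have "circ_rec n scale (Suc 0) (pair_cochain n s2 \<mu> \<rho>) (pair_cochain n s2 \<mu> \<rho>) = (\<lambda>Xs x. 0) \<longleftrightarrow>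
    (\<forall>xs ys. length xs = n - 1 \<longrightarrow> length ys = n \<longrightarrow> G (map (\<lambda>a. (a, 0)) xs) (map (\<lambda>a. (a, 0)) ys) = 0) \<and>
    (\<forall>xs ys u. length xs = n - 1 \<longrightarrow> length ys = n - 1 \<longrightarrow>
      G (map (\<lambda>a. (a, 0)) xs) (map (\<lambda>a. (a, 0)) ys @ [(0, u)]) = 0) \<and>
    (\<forall>xs ys u. length xs = n - 2 \<longrightarrow> length ys = n \<longrightarrow>
      G (map (\<lambda>a. (a, 0)) xs @ [(0, u)]) (map (\<lambda>a. (a, 0)) ys) = 0)"
    unfolding G_def by (rule circ_rec_square_vanish_iff[OF n pair_cochain_in_cochains[OF n \<mu> \<rho>]])
  also have "\<dots> \<longleftrightarrow>
    (\<forall>xs ys. length xs = n - 1 \<longrightarrow> length ys = n \<longrightarrow>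
      \<mu> (xs @ [\<mu> ys]) = (\<Sum>i<n. \<mu> (ys[i := \<mu> (xs @ [ys ! i])]))) \<and>
    (\<forall>xs ys u. length xs = n - 1 \<longrightarrow> length ys = n - 1 \<longrightarrow>
      \<rho> xs (\<rho> ys u) - \<rho> ys (\<rho> xs u) = (\<Sum>i<n - 1. \<rho> (ys[i := \<mu> (xs @ [ys ! i])]) u)) \<and>
    (\<forall>xs ys u. length xs = n - 2 \<longrightarrow> length ys = n \<longrightarrow>
      \<rho> (xs @ [\<mu> ys]) u =
        (\<Sum>i<n. s2 ((- 1) ^ (n - 1 - i)) (\<rho> (delete_nth i ys) (\<rho> (xs @ [ys ! i]) u))))"
  proof -
    have a': "G (map (\<lambda>a. (a, 0)) xs) (map (\<lambda>a. (a, 0)) ys) = 0 \<longleftrightarrow>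
        \<mu> (xs @ [\<mu> ys]) = (\<Sum>i<n. \<mu> (ys[i := \<mu> (xs @ [ys ! i])]))"
      if "length xs = n - 1" "length ys = n" for xs ys
      unfolding a[OF that] by (auto simp: zero_prod_def)
    have b': "G (map (\<lambda>a. (a, 0)) xs) (map (\<lambda>a. (a, 0)) ys @ [(0, u)]) = 0 \<longleftrightarrow>
        \<rho> xs (\<rho> ys u) - \<rho> ys (\<rho> xs u) = (\<Sum>i<n - 1. \<rho> (ys[i := \<mu> (xs @ [ys ! i])]) u)"
      if "length xs = n - 1" "length ys = n - 1" for xs ys u
      unfolding b[OF that] by (auto simp: zero_prod_def algebra_simps)
    have c': "G (map (\<lambda>a. (a, 0)) xs @ [(0, u)]) (map (\<lambda>a. (a, 0)) ys) = 0 \<longleftrightarrow>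
        \<rho> (xs @ [\<mu> ys]) u =
          (\<Sum>i<n. s2 ((- 1) ^ (n - 1 - i)) (\<rho> (delete_nth i ys) (\<rho> (xs @ [ys ! i]) u)))"
      if "length xs = n - 2" "length ys = n" for xs ys u
      unfolding c[OF that] by (auto simp: zero_prod_def)
    show ?thesis
      by (intro arg_cong2[where f = "(\<and>)"] all_cong1 imp_cong refl a' b' c')
  qed
  also have "\<dots> \<longleftrightarrow> n_LieRep_pair n s1 s2 \<mu> \<rho>"
    unfolding n_LieRep_pair_def n_Lie_algebra_def n_Lie_representation_def
    using \<mu> \<rho> vs1.vector_space_axioms by (simp only: simp_thms)
  finally show ?thesis .
qed

text \<open>\<mu> and \<rho> are read off from \<pi> on arguments from g and on arguments with one
  final entry from V. The difference \<open>D\<close> to the pair they define is alternating and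
  preserves weights, so these arguments suffice to show that it is zero.\<close>

lemma pair_cochain_cases:
  assumes n: "n \<ge> 2" and P: "\<pi> \<in> cochains n scale (Suc 0)" "weighted n 0 \<pi>"
  shows "\<exists>\<mu> \<rho>. alternating s1 s1 n \<mu> \<and> action_map n s1 s2 \<rho> \<and> \<pi> = pair_cochain n s2 \<mu> \<rho>"
proof -
  have n1: "n \<ge> 1" and nn: "Suc (n - 1) = n" using n by auto
  define f where "f = (\<lambda>zs. \<pi> [butlast zs] (last zs))"
  define \<mu> where "\<mu> = (\<lambda>xs. fst (f (map (\<lambda>a. (a, 0)) xs)))"
  define \<rho> where "\<rho> = (\<lambda>xs u. snd (\<pi> [map (\<lambda>a. (a, 0)) xs] (0, u)))"
  have f: "alternating scale scale n f" using P(1) by (simp add: cochains_1_iff f_def)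
  have \<mu>: "alternating s1 s1 n \<mu>"
    unfolding \<mu>_def by (rule alternating_compose[OF alternating_precompose[OF f linear_inl] linear_fst])
  have \<rho>: "action_map n s1 s2 \<rho>"
    unfolding action_map_def
  proof (intro conjI allI)
    show "Vector_Spaces.linear s2 s2 (\<rho> xs)" for xs
      unfolding \<rho>_def
      by (rule linear_compose_fun[OF linear_compose_fun[OF linear_inr p.cochains_1_linear[OF P(1) n1]] linear_snd])
    show "alternating s1 s2 (n - 1) (\<lambda>xs. \<rho> xs u)" for u
      unfolding \<rho>_def
      by (rule alternating_compose[OF alternating_precompose[OF p.cochains_alternating_hd[OF P(1) n1] linear_inl] linear_snd])
  qed
  define D where "D = (\<lambda>Xs x. \<pi> Xs x + scale (- 1) (pair_cochain n s2 \<mu> \<rho> Xs x))"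
  note pc = pair_cochain_in_cochains[OF n \<mu> \<rho>]
  have D: "D \<in> cochains n scale (Suc 0)"
    unfolding D_def by (intro p.cochains_add p.cochains_scale P pc)
  have wD: "weighted n 0 D" unfolding D_def by (rule weighted_linear[OF P(2) pc(2)])
  have D0: "D [butlast zs] (last zs) = 0" for zs
  proof (rule alternating_vanish[where f = "\<lambda>zs. D [butlast zs] (last zs)"])
    show "alternating scale scale (Suc (n - 1)) (\<lambda>zs. D [butlast zs] (last zs))"
      using D nn by (simp add: cochains_1_iff)
    have pb: "pair_cochain n s2 \<mu> \<rho> [butlast zs] (last zs) = pair_bracket n s2 \<mu> \<rho> zs" if "length zs = n" for zs
    proof -
      have "zs \<noteq> []" using that n by auto
      then show ?thesis using that n by (simp add: pair_cochain_eq_pair_bracket)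
    qed
    have wf: "f zs \<in> weight_space (0 + sum_list vs)"
      if "length zs = n" "list_all2 (\<lambda>w z. z \<in> weight_space w) vs zs" for zs vs
    proof -
      have "zs \<noteq> []" using that n by auto
      then show ?thesis unfolding f_def using that by (intro weightedD[OF P(2)]) auto
    qed
    show "D [butlast (map (\<lambda>a. (a, 0)) xs)] (last (map (\<lambda>a. (a, 0)) xs)) = 0" if "length xs = Suc (n - 1)" for xs
    proof -
      \<comment> \<open>Total weight \<open>0\<close> puts the value in g, so its first component
        \<mu> is all of it.\<close>
      have "f (map (\<lambda>a. (a, 0)) xs) \<in> weight_space (0 + sum_list (replicate n 0))"
        by (rule wf) (use that nn in \<open>auto simp: list_all2_conv_all_nth weight_space_def\<close>)
      then have "f (map (\<lambda>a. (a, 0)) xs) = (\<mu> xs, 0)"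
        by (simp add: weight_space_def \<mu>_def prod_eq_iff mem_Times_iff sum_list_replicate)
      then show ?thesis
        using that nn pb[of "map (\<lambda>a. (a, 0)) xs"] pair_bracket_left[OF \<rho>, of \<mu> xs]
        by (simp add: D_def f_def)
    qed
    show "D [butlast (map (\<lambda>a. (a, 0)) xs @ [(0, u)])] (last (map (\<lambda>a. (a, 0)) xs @ [(0, u)])) = 0"
      if "length xs = n - 1" for xs u
    proof -
      have "f (map (\<lambda>a. (a, 0)) xs @ [(0, u)]) \<in> weight_space (0 + sum_list (replicate (n - 1) 0 @ [1]))"
      proof (rule wf)
        have "list_all2 (\<lambda>w z. z \<in> weight_space w) (replicate (n - 1) 0) (map (\<lambda>a. (a, 0 :: 'c)) xs)"
          using that by (auto simp: list_all2_conv_all_nth weight_space_def)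
        then show "list_all2 (\<lambda>w z. z \<in> weight_space w) (replicate (n - 1) 0 @ [1]) (map (\<lambda>a. (a, 0)) xs @ [(0, u)])"
          by (rule list_all2_appendI) (simp add: weight_space_def)
      qed (use that nn in simp)
      then have "f (map (\<lambda>a. (a, 0)) xs @ [(0, u)]) = (0, \<rho> xs u)"
        by (simp add: weight_space_def \<rho>_def f_def prod_eq_iff mem_Times_iff sum_list_replicate)
      then show ?thesis
        using that nn pb[of "map (\<lambda>a. (a, 0)) xs @ [(0, u)]"] pair_bracket_right_last[OF \<mu> \<rho>, of xs u]
        by (simp add: D_def f_def)
    qed
    show "D [butlast zs] (last zs) = 0" if "length zs = Suc (n - 1)" "\<And>z. z \<in> set zs \<Longrightarrow> pure z"
      "sum_list (map pure_weight zs) \<ge> 2" for zs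
    proof -
      have "zs \<noteq> []" using that by auto
      then have "concat [butlast zs] @ [last zs] = zs" by simp
      with that show ?thesis by (intro weighted_vanish[OF wD]) auto
    qed
  qed
  have "\<pi> Xs x = pair_cochain n s2 \<mu> \<rho> Xs x" for Xs x
  proof (cases "blocks n 1 Xs")
    case True
    then obtain X where "Xs = [X]" by (auto simp: blocks_def length_Suc_conv)
    then show ?thesis using D0[of "X @ [x]"] by (simp add: D_def)
  next
    case False
    then show ?thesis using cochains_vanish[OF P(1)] cochains_vanish[OF pc(1)] by simp
  qed
  then show ?thesis using \<mu> \<rho> by blast
qed

text \<open>The same test arguments recover \<mu> and \<rho>; on lists of other lengths both vanish
  by normalisation.\<close>

lemma pair_cochain_inj:
  assumes n: "n \<ge> 2" and \<mu>: "alternating s1 s1 n \<mu>" and \<rho>: "action_map n s1 s2 \<rho>"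
    and \<mu>': "alternating s1 s1 n \<mu>'" and \<rho>': "action_map n s1 s2 \<rho>'"
    and eq: "pair_cochain n s2 \<mu> \<rho> = pair_cochain n s2 \<mu>' \<rho>'"
  shows "\<mu> = \<mu>' \<and> \<rho> = \<rho>'"
proof
  have B: "pair_bracket n s2 \<mu> \<rho> zs = pair_bracket n s2 \<mu>' \<rho>' zs" if "length zs = n" for zs
  proof -
    have "zs \<noteq> []" using that n by auto
    then show ?thesis
      using that n pair_cochain_eq_pair_bracket[of n "butlast zs" \<mu> \<rho> "last zs"]
        pair_cochain_eq_pair_bracket[of n "butlast zs" \<mu>' \<rho>' "last zs"] eq by simp
  qed
  show "\<mu> = \<mu>'"
  proof
    fix xs
    show "\<mu> xs = \<mu>' xs"
      using B[of "map (\<lambda>a. (a, 0)) xs"] pair_bracket_left[OF \<rho>, of \<mu> xs] pair_bracket_left[OF \<rho>', of \<mu>' xs]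
        alternating_length[OF \<mu>, of xs] alternating_length[OF \<mu>', of xs]
      by (cases "length xs = n") auto
  qed
  show "\<rho> = \<rho>'"
  proof (intro ext)
    fix xs u
    have alt: "alternating s1 s2 (n - 1) (\<lambda>xs. \<rho> xs u)" "alternating s1 s2 (n - 1) (\<lambda>xs. \<rho>' xs u)"
      using \<rho> \<rho>' by (auto simp: action_map_def)
    show "\<rho> xs u = \<rho>' xs u"
      using B[of "map (\<lambda>a. (a, 0)) xs @ [(0, u)]"] pair_bracket_right_last[OF \<mu> \<rho>, of xs u]
        pair_bracket_right_last[OF \<mu>' \<rho>', of xs u] n alternating_length[OF alt(1), of xs] alternating_length[OF alt(2), of xs]
      by (cases "length xs = n - 1") auto
  qed
qed

end

theorem proposition2p7:
  fixes sg :: "'k::{alg_closed_field, field_char_0} \<Rightarrow> 'g::ab_group_add \<Rightarrow> 'g"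
    and sv :: "'k \<Rightarrow> 'v::ab_group_add \<Rightarrow> 'v"
    and Bg :: "'g set" and Bv :: "'v set"
    and n :: nat
  assumes "finite_dimensional_vector_space sg Bg"
    and "finite_dimensional_vector_space sv Bv"
    and "n \<ge> 2"
  shows "let W = module_prod.scale sg sv;
             L = (\<lambda>k. bidegree_cochains n sg sv (k * (n - 1)) 0);
             br = n_Lie_bracket n W
         in graded_lie_algebra (cochain_scale W) L br \<and>
            bij_betw (\<lambda>(\<mu>, \<rho>). pair_cochain n sv \<mu> \<rho>)
              {(\<mu>, \<rho>). n_LieRep_pair n sg sv \<mu> \<rho>} (maurer_cartan L br) \<and>
            (\<forall>\<mu> \<rho>. alternating sg sg n \<mu> \<longrightarrow> action_map n sg sv \<rho> \<longrightarrow>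
              (pair_cochain n sv \<mu> \<rho> \<in> maurer_cartan L br \<longleftrightarrow>
                n_Lie_algebra n sg \<mu> \<and> n_Lie_representation n sg sv \<mu> \<rho>))"
proof -
  note n = assms(3)
  have vs: "vector_space sg" "vector_space sv"
    using assms(1,2) by (simp_all add: finite_dimensional_vector_space_def)
  interpret vector_space_prod sg sv
    using vs by (simp add: vector_space_prod_def vector_space_pair_def)
  define L where "L = (\<lambda>k. bidegree_cochains n sg sv (k * (n - 1)) 0)"
  have L: "L = (\<lambda>k. {P \<in> cochains n scale k. weighted n 0 P})"
    unfolding L_def by (intro ext bidegree_cochains_eq n)
  have br: "n_Lie_bracket n scale \<pi> \<pi> = 0 \<longleftrightarrow> circ_rec n scale (Suc 0) \<pi> \<pi> = (\<lambda>Xs x. 0)"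
    if "\<pi> \<in> cochains n scale (Suc 0)" for \<pi>
  proof -
    \<comment> \<open>In degree \<open>1\<close> the sign \<open>(- 1) ^ (1 * 1)\<close> makes the
      two composites add up; characteristic \<open>0\<close> allows the factor \<open>2\<close> to
      be cancelled.\<close>
    have "n_Lie_bracket n scale \<pi> \<pi> = (\<lambda>Xs x. scale 2 (circ_rec n scale (Suc 0) \<pi> \<pi> Xs x))"
      using n p.scale_left_distrib[of 1 1]
      by (simp add: p.n_Lie_bracket_homogeneous[OF that that] fun_eq_iff del: circ_rec.simps)
    then show ?thesis by (simp add: fun_eq_iff del: circ_rec.simps)
  qed
  have mc: "pair_cochain n sv \<mu> \<rho> \<in> maurer_cartan L (n_Lie_bracket n scale) \<longleftrightarrow> n_LieRep_pair n sg sv \<mu> \<rho>"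
    if "alternating sg sg n \<mu>" "action_map n sg sv \<rho>" for \<mu> \<rho>
    using pair_cochain_in_cochains[OF n that] br pair_cochain_square_iff[OF n that]
    by (simp add: maurer_cartan_def L del: circ_rec.simps)
  have rep: "alternating sg sg n \<mu> \<and> action_map n sg sv \<rho>" if "n_LieRep_pair n sg sv \<mu> \<rho>" for \<mu> \<rho>
    using that by (simp add: n_LieRep_pair_def n_Lie_algebra_def n_Lie_representation_def)
  have "bij_betw (\<lambda>(\<mu>, \<rho>). pair_cochain n sv \<mu> \<rho>)
      {(\<mu>, \<rho>). n_LieRep_pair n sg sv \<mu> \<rho>} (maurer_cartan L (n_Lie_bracket n scale))"
    unfolding bij_betw_def
  proof
    show "inj_on (\<lambda>(\<mu>, \<rho>). pair_cochain n sv \<mu> \<rho>) {(\<mu>, \<rho>). n_LieRep_pair n sg sv \<mu> \<rho>}"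
      by (auto simp: inj_on_def dest!: rep dest: pair_cochain_inj[OF n])
    show "(\<lambda>(\<mu>, \<rho>). pair_cochain n sv \<mu> \<rho>) ` {(\<mu>, \<rho>). n_LieRep_pair n sg sv \<mu> \<rho>} =
      maurer_cartan L (n_Lie_bracket n scale)"
    proof
      show "(\<lambda>(\<mu>, \<rho>). pair_cochain n sv \<mu> \<rho>) ` {(\<mu>, \<rho>). n_LieRep_pair n sg sv \<mu> \<rho>}
        \<subseteq> maurer_cartan L (n_Lie_bracket n scale)"
        using mc rep by auto
      show "maurer_cartan L (n_Lie_bracket n scale) \<subseteq>
        (\<lambda>(\<mu>, \<rho>). pair_cochain n sv \<mu> \<rho>) ` {(\<mu>, \<rho>). n_LieRep_pair n sg sv \<mu> \<rho>}"
      proof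
        fix \<pi> assume \<pi>: "\<pi> \<in> maurer_cartan L (n_Lie_bracket n scale)"
        then obtain \<mu> \<rho> where "alternating sg sg n \<mu>" "action_map n sg sv \<rho>" "\<pi> = pair_cochain n sv \<mu> \<rho>"
          using pair_cochain_cases[OF n, of \<pi>] by (auto simp: maurer_cartan_def L)
        then show "\<pi> \<in> (\<lambda>(\<mu>, \<rho>). pair_cochain n sv \<mu> \<rho>) ` {(\<mu>, \<rho>). n_LieRep_pair n sg sv \<mu> \<rho>}"
          using mc \<pi> by auto
      qed
    qed
  qed
  moreover have "graded_lie_algebra (cochain_scale scale) L (n_Lie_bracket n scale)"
    unfolding L by (rule graded_lie_algebra_weighted[OF n])
  ultimately show ?thesis
    unfolding Let_def L_def[symmetric] using mc by (simp flip: n_LieRep_pair_def)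
qed

end
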